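(* Let $k,\ell\ge 2$ be integers and let $C_m$ denote the cycle on $m$ vertices. Then, as $n\to\infty$ (constants depending only on $k,\ell$): (a) $\mathrm{ex}(n,C_{2k+1},\textup{rainbow-}C_{2k+1})=\Theta(n^{2k-1})$; (b) $\Omega(n^{k-1})=\mathrm{ex}(n,C_{2k},\textup{rainbow-}C_{2k})=O(n^{k})$; (c) if $k\neq \ell$, then $\mathrm{ex}(n,C_{2\ell},\textup{rainbow-}C_{2k})=\Theta(n^{\ell})$.
   Context: An edge-coloring of a graph is proper if any two edges sharing a vertex receive different colors. A subgraph of an edge-colored graph is rainbow if all its edges have distinct colors. For graphs $H$ and $F$, $\mathrm{ex}(n,H,\textup{rainbow-}F)$ denotes the maximum number of copies of $H$ (subgraphs isomorphic to $H$) in a graph $G$ on $n$ vertices equipped with a proper edge-coloring in which there is no rainbow copy of $F$. *)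

theory Defs
  imports Complex_Main "HOL-Library.Landau_Symbols"
begin

type_synonym 'a ugraph = "'a set \<times> 'a set set"

abbreviation vertices :: "'a ugraph \<Rightarrow> 'a set" where "vertices \<equiv> fst"

abbreviation uedges :: "'a ugraph \<Rightarrow> 'a set set" where "uedges \<equiv> snd"

definition simple_graph :: "'a ugraph \<Rightarrow> bool" where
  "simple_graph G \<longleftrightarrow> finite (vertices G) \<and> (\<forall>e\<in>uedges G. e \<subseteq> vertices G \<and> card e = 2)"

definition is_subgraph :: "'a ugraph \<Rightarrow> 'a ugraph \<Rightarrow> bool" where
  "is_subgraph S G \<longleftrightarrow> simple_graph S \<and> vertices S \<subseteq> vertices G \<and> uedges S \<subseteq> uedges G"

definition isomorphic :: "'a ugraph \<Rightarrow> 'b ugraph \<Rightarrow> bool" where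
  "isomorphic G H \<longleftrightarrow>
     (\<exists>f. bij_betw f (vertices G) (vertices H) \<and> uedges H = (\<lambda>e. f ` e) ` uedges G)"

definition copies :: "'b ugraph \<Rightarrow> 'a ugraph \<Rightarrow> 'a ugraph set" where
  "copies H G = {S. is_subgraph S G \<and> isomorphic S H}"

text \<open>Colours are natural numbers, which is enough for finite graphs; values of a colouring
  outside the edge set are irrelevant.\<close>

definition proper_edge_coloring :: "'a ugraph \<Rightarrow> ('a set \<Rightarrow> nat) \<Rightarrow> bool" where
  "proper_edge_coloring G c \<longleftrightarrow>
     (\<forall>e\<in>uedges G. \<forall>e'\<in>uedges G. e \<noteq> e' \<and> e \<inter> e' \<noteq> {} \<longrightarrow> c e \<noteq> c e')"

definition rainbow :: "('a set \<Rightarrow> nat) \<Rightarrow> 'a ugraph \<Rightarrow> bool" where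
  "rainbow c S \<longleftrightarrow> inj_on c (uedges S)"

definition rainbow_free :: "nat \<Rightarrow> 'b ugraph \<Rightarrow> nat ugraph set" where
  "rainbow_free n F =
     {G. simple_graph G \<and> card (vertices G) = n \<and>
         (\<exists>c. proper_edge_coloring G c \<and> (\<forall>S\<in>copies F G. \<not> rainbow c S))}"

definition ex_rainbow :: "nat \<Rightarrow> 'b ugraph \<Rightarrow> 'c ugraph \<Rightarrow> nat" where
  "ex_rainbow n H F = Max ((\<lambda>G. card (copies H G)) ` rainbow_free n F)"

text \<open>The cycle on the vertices \<open>0, \<dots>, m - 1\<close>; meaningful for \<open>m \<ge> 3\<close>.\<close>

definition cycle_graph :: "nat \<Rightarrow> nat ugraph" where
  "cycle_graph m = ({..<m}, {{i, Suc i mod m} | i. i < m})"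

lemma simple_cycle_graph:
  assumes "m \<ge> 3"
  shows "simple_graph (cycle_graph m)"
proof -
  have "i \<noteq> Suc i mod m" if "i < m" for i
    using that assms by (cases "Suc i = m") auto
  then show ?thesis
    using assms by (auto simp: simple_graph_def cycle_graph_def)
qed

text \<open>The maximum in \<^const>\<open>ex_rainbow\<close> is over a finite set, which is nonempty as soon as
  \<open>F\<close> has an edge, so it is attained.\<close>

lemma finite_copies:
  assumes "simple_graph G"
  shows "finite (copies H G)"
    and "card (copies H G) \<le> 2 ^ card (vertices G) * 2 ^ 2 ^ card (vertices G)"
proof -
  let ?B = "Pow (vertices G) \<times> Pow (Pow (vertices G))"
  have sub: "copies H G \<subseteq> ?B"
  proof
    fix S assume "S \<in> copies H G"
    then have "vertices S \<subseteq> vertices G" "uedges S \<subseteq> Pow (vertices G)"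
      unfolding copies_def is_subgraph_def simple_graph_def by blast+
    then show "S \<in> ?B" by (simp add: mem_Times_iff)
  qed
  have fin: "finite (vertices G)"
    using assms by (simp add: simple_graph_def)
  then have finB: "finite ?B" by simp
  show "finite (copies H G)"
    using finite_subset[OF sub finB] .
  have "card ?B = 2 ^ card (vertices G) * 2 ^ 2 ^ card (vertices G)"
    using fin by (simp add: card_cartesian_product card_Pow)
  then show "card (copies H G) \<le> 2 ^ card (vertices G) * 2 ^ 2 ^ card (vertices G)"
    using card_mono[OF finB sub] by simp
qed

lemma finite_copy_counts: "finite ((\<lambda>G. card (copies H G)) ` rainbow_free n F)"
proof (rule finite_subset)
  show "(\<lambda>G. card (copies H G)) ` rainbow_free n F \<subseteq> {..2 ^ n * 2 ^ 2 ^ n}"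
  proof
    fix x assume "x \<in> (\<lambda>G. card (copies H G)) ` rainbow_free n F"
    then obtain G :: "nat ugraph" where "x = card (copies H G)" "simple_graph G" "card (vertices G) = n"
      by (auto simp: rainbow_free_def)
    then show "x \<in> {..2 ^ n * 2 ^ 2 ^ n}"
      using finite_copies(2)[of G H] by simp
  qed
qed (rule finite_atMost)

lemma rainbow_free_nonempty:
  assumes "uedges F \<noteq> {}"
  shows "rainbow_free n F \<noteq> {}"
proof -
  have "copies F ({..<n}, {}) = {}"
    using assms by (auto simp: copies_def is_subgraph_def isomorphic_def)
  then have "({..<n}, {}) \<in> rainbow_free n F"
    by (simp add: rainbow_free_def simple_graph_def proper_edge_coloring_def)
  then show ?thesis by blast
qed

lemma ex_rainbow_attained:
  assumes "uedges F \<noteq> {}"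
  shows "\<exists>G\<in>rainbow_free n F. ex_rainbow n H F = card (copies H G)"
proof -
  have "ex_rainbow n H F \<in> (\<lambda>G. card (copies H G)) ` rainbow_free n F"
    unfolding ex_rainbow_def
    by (rule Max_in[OF finite_copy_counts]) (simp add: rainbow_free_nonempty[OF assms])
  then show ?thesis by blast
qed

lemma ex_rainbow_upper:
  assumes "G \<in> rainbow_free n F"
  shows "card (copies H G) \<le> ex_rainbow n H F"
  using Max_ge[OF finite_copy_counts] assms unfolding ex_rainbow_def by blast

end

theory Submission
  imports Defs "HOL-Library.FuncSet" "HOL-Library.Nat_Bijection" "HOL-Algebra.Algebraic_Closure_Type"
begin

text \<open>
  Upper bound for even cycles. Call two vertices a fat pair if they have many common neighbours.
  A path of \<open>k\<close> vertices through fat pairs inside a neighbourhood \<open>N(a)\<close> can be subdivided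
  greedily to a rainbow \<open>C\<^sub>2\<^sub>k\<close> through \<open>a\<close>; hence every subset of \<open>N(a)\<close> spans linearly
  many fat pairs only. This bounds the number of 4-cycles, that is the sum of the squared
  codegrees, by \<open>O(n\<^sup>2)\<close>, and Cauchy-Schwarz along the even vertices of a cycle gives
  \<open>O(n\<^sup>l)\<close> cycles \<open>C\<^sub>2\<^sub>l\<close>.

  Upper bound for odd cycles. On a cycle with two independent colour coincidences the other
  vertices determine two of them. With exactly one coincidence, between \<open>e\<close> and \<open>e'\<close>, fixing all
  vertices but one endpoint of \<open>e\<close> and one of \<open>e'\<close> leaves boundedly many completions, since two
  completions can be mixed to a rainbow cycle.

  Lower bounds. Matchings of a single colour force coincidences in blow-ups. For
  \<open>C\<^sub>2\<^sub>l\<close> against \<open>C\<^sub>2\<^sub>k\<close> with \<open>k \<ge> 3\<close>, every other vertex of \<open>C\<^sub>2\<^sub>l\<close> is blown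
  up; against \<open>C\<^sub>4\<close> one takes the incidence graph of an affine plane over a field with
  \<open>2\<^sup>t\<close> elements, where generic \<open>l\<close>-tuples of points yield \<open>2 * l\<close>-cycles.
\<close>

section \<open>Cycles as injective cyclic sequences\<close>

text \<open>The bound for even cycles is a trace estimate. Let A be the matrix of codegrees with
  zero diagonal. Embedded cycles \<open>C_2l\<close> are counted by the trace of the l-th power of
  A, hence by the l-th power of its Hilbert-Schmidt norm, whose square is the \<open>O(n^2)\<close>
  energy. So the exponent is l, whatever k is. The fat path has to lie in one neighbourhood because
  its subdivision has \<open>2 * k - 1\<close> vertices and needs an apex to close up. For odd
  cycles the exponent \<open>m - 2\<close> asks for two lost degrees of freedom. A coincidence of
  colours determines one vertex only, so cycles with exactly one coincidence are the obstacle that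
  forces the mixing argument. Blowing up alternate vertices always creates 4-cycles. Against
  \<open>C_4\<close> a graph without 4-cycles but with about \<open>n^(3/2)\<close> edges is
  required; since powers of two reach every n up to a constant factor, fields of characteristic 2
  suffice.\<close>

definition cycle_edge :: "nat \<Rightarrow> (nat \<Rightarrow> 'a) \<Rightarrow> nat \<Rightarrow> 'a set" where
  "cycle_edge m v i = {v i, v (Suc i mod m)}"

text \<open>Extensional functions make the set finite and count each cyclic sequence once; a cycle
  occurs with all its rotations and reflections.\<close>

definition embeddings :: "nat \<Rightarrow> 'a ugraph \<Rightarrow> (nat \<Rightarrow> 'a) set" where
  "embeddings m G = {v \<in> {..<m} \<rightarrow>\<^sub>E vertices G.
     inj_on v {..<m} \<and> (\<forall>i<m. cycle_edge m v i \<in> uedges G)}"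

definition cycle_image :: "nat \<Rightarrow> (nat \<Rightarrow> 'a) \<Rightarrow> 'a ugraph" where
  "cycle_image m v = (v ` {..<m}, cycle_edge m v ` {..<m})"

text \<open>In a cyclic order of at least three positions no position succeeds its own successor.
  For \<open>m = 2\<close> this fails, and with it the injectivity of
  \<open>cycle_edge\<close>.\<close>

lemma Suc_mod_neq:
  fixes m i j :: nat
  assumes "3 \<le> m" "i < m" "j < m" "j = Suc i mod m"
  shows "i \<noteq> Suc j mod m"
  using assms by (auto simp: mod_Suc split: if_splits)

lemma Suc_mod_inject:
  fixes m i j :: nat
  assumes "i < m" "j < m" "Suc i mod m = Suc j mod m"
  shows "i = j"
  using assms by (cases "Suc i = m"; cases "Suc j = m") auto

lemma inj_on_cycle_edge:
  assumes "3 \<le> m" "inj_on v {..<m}"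
  shows "inj_on (cycle_edge m v) {..<m}"
proof (rule inj_onI)
  fix i j assume ij: "i \<in> {..<m}" "j \<in> {..<m}" "cycle_edge m v i = cycle_edge m v j"
  have *: "Suc i mod m < m" "Suc j mod m < m" using assms by auto
  from ij(3) have "v i = v j \<or> (v i = v (Suc j mod m) \<and> v j = v (Suc i mod m))"
    unfolding cycle_edge_def doubleton_eq_iff by auto
  then have "i = j \<or> (i = Suc j mod m \<and> j = Suc i mod m)"
    using assms(2) ij(1,2) * by (auto simp: inj_on_def)
  then show "i = j" using Suc_mod_neq[of m i j] assms(1) ij by auto
qed

lemma finite_embeddings:
  assumes "finite (vertices G)"
  shows "finite (embeddings m G)"
proof (rule finite_subset)
  show "embeddings m G \<subseteq> {..<m} \<rightarrow>\<^sub>E vertices G" by (auto simp: embeddings_def)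
  show "finite ({..<m} \<rightarrow>\<^sub>E vertices G)" using assms by (intro finite_PiE) auto
qed

lemma cycle_edges_eq: "uedges (cycle_graph m) = cycle_edge m id ` {..<m}"
  by (auto simp: cycle_graph_def cycle_edge_def)

lemma cycle_image_in_copies:
  assumes m: "3 \<le> m" and G: "simple_graph G" and v: "v \<in> embeddings m G"
  shows "cycle_image m v \<in> copies (cycle_graph m) G"
proof -
  have v1: "v \<in> {..<m} \<rightarrow>\<^sub>E vertices G" and inj: "inj_on v {..<m}"
    and e: "\<And>i. i < m \<Longrightarrow> cycle_edge m v i \<in> uedges G"
    using v by (auto simp: embeddings_def)
  have "is_subgraph (cycle_image m v) G"
    unfolding is_subgraph_def simple_graph_def
  proof (intro conjI ballI)
    fix x assume "x \<in> uedges (cycle_image m v)"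
    then obtain i where i: "i < m" "x = cycle_edge m v i" by (auto simp: cycle_image_def)
    then show "x \<subseteq> vertices (cycle_image m v)"
      using m by (auto simp: cycle_image_def cycle_edge_def)
    show "card x = 2" using e[OF i(1)] i G by (auto simp: simple_graph_def)
  qed (use v1 e in \<open>auto simp: cycle_image_def\<close>)
  moreover have "isomorphic (cycle_image m v) (cycle_graph m)"
    unfolding isomorphic_def
  proof (intro exI conjI)
    let ?f = "inv_into {..<m} v"
    show "bij_betw ?f (vertices (cycle_image m v)) (vertices (cycle_graph m))"
      using bij_betw_inv_into[of v "{..<m}" "v ` {..<m}"] inj
      by (simp add: cycle_image_def cycle_graph_def inj_on_imp_bij_betw)
    have "?f ` cycle_edge m v i = cycle_edge m id i" if "i < m" for i
    proof -
      have "Suc i mod m < m" using m by simp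
      then show ?thesis using that inj by (simp add: cycle_edge_def)
    qed
    then show "uedges (cycle_graph m) = (`) ?f ` uedges (cycle_image m v)"
      unfolding cycle_edges_eq by (simp add: cycle_image_def image_image)
  qed
  ultimately show ?thesis by (simp add: copies_def)
qed

text \<open>Inverting an isomorphism onto the cycle and restricting it to \<open>{..<m}\<close>
  yields a sequence with the given image.\<close>

lemma copies_cycle_graph:
  assumes m: "3 \<le> m" and G: "simple_graph G"
  shows "copies (cycle_graph m) G = cycle_image m ` embeddings m G"
proof
  show "cycle_image m ` embeddings m G \<subseteq> copies (cycle_graph m) G"
    using cycle_image_in_copies[OF m G] by auto
  show "copies (cycle_graph m) G \<subseteq> cycle_image m ` embeddings m G"
  proof
    fix S assume "S \<in> copies (cycle_graph m) G"
    then obtain f where S: "is_subgraph S G" and f: "bij_betw f (vertices S) {..<m}"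
      and E: "uedges (cycle_graph m) = (`) f ` uedges S"
      by (auto simp: copies_def isomorphic_def cycle_graph_def)
    define g where "g = inv_into (vertices S) f"
    define v where "v = restrict g {..<m}"
    have g: "bij_betw g {..<m} (vertices S)" unfolding g_def by (rule bij_betw_inv_into[OF f])
    then have v: "bij_betw v {..<m} (vertices S)"
      unfolding v_def using bij_betw_cong[of "{..<m}" g "restrict g {..<m}"] by simp
    have gf: "g ` f ` e = e" if "e \<in> uedges S" for e
    proof -
      have "e \<subseteq> vertices S" using S that by (auto simp: is_subgraph_def simple_graph_def)
      then have "\<forall>x\<in>e. g (f x) = x"
        using f by (auto simp: g_def bij_betw_def)
      then show ?thesis by (force simp: image_image)
    qed
    have "uedges S = (\<lambda>e. g ` e) ` (`) f ` uedges S"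
      using gf by (force simp: image_image)
    also have "\<dots> = cycle_edge m v ` {..<m}"
      unfolding E[symmetric] cycle_edges_eq image_image
    proof (rule image_cong[OF refl])
      fix i assume "i \<in> {..<m}"
      moreover have "Suc i mod m < m" using m by simp
      ultimately show "g ` cycle_edge m id i = cycle_edge m v i"
        by (auto simp: cycle_edge_def v_def)
    qed
    finally have ES: "uedges S = cycle_edge m v ` {..<m}" .
    have VS: "vertices S = v ` {..<m}" using v by (simp add: bij_betw_def)
    have "v \<in> embeddings m G"
      using S ES v unfolding embeddings_def
      by (auto simp: is_subgraph_def bij_betw_def v_def)
    moreover have "S = cycle_image m v" using ES VS by (simp add: cycle_image_def prod_eq_iff)
    ultimately show "S \<in> cycle_image m ` embeddings m G" by blast
  qed
qed

lemma card_le_fibres: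
  assumes fin: "finite A" and fib: "\<And>y. y \<in> f ` A \<Longrightarrow> card {x \<in> A. f x = y} \<le> C"
  shows "card A \<le> C * card (f ` A)"
proof -
  have "card A \<le> card (\<Union>y\<in>f ` A. {x \<in> A. f x = y})"
    by (rule card_mono) (use fin in auto)
  also have "\<dots> \<le> (\<Sum>y\<in>f ` A. card {x \<in> A. f x = y})"
    by (rule card_UN_le) (use fin in auto)
  also have "\<dots> \<le> (\<Sum>y\<in>f ` A. C)" by (rule sum_mono) (rule fib)
  finally show ?thesis by (simp add: mult.commute)
qed

lemma card_copies_le:
  assumes "3 \<le> m" "simple_graph G"
  shows "card (copies (cycle_graph m) G) \<le> card (embeddings m G)"
  unfolding copies_cycle_graph[OF assms]
  using assms(2) by (intro card_image_le finite_embeddings) (simp add: simple_graph_def)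

text \<open>Sequences with the same image map \<open>{..<m}\<close> into one set of \<open>m\<close>
  vertices. The crude \<open>m ^ m\<close> in place of \<open>2 * m\<close> affects only
  constants.\<close>

lemma card_embeddings_le:
  assumes "3 \<le> m" "simple_graph G"
  shows "card (embeddings m G) \<le> m ^ m * card (copies (cycle_graph m) G)"
  unfolding copies_cycle_graph[OF assms]
proof (rule card_le_fibres)
  show "finite (embeddings m G)"
    using assms(2) by (intro finite_embeddings) (simp add: simple_graph_def)
  fix S assume "S \<in> cycle_image m ` embeddings m G"
  then obtain w where w: "w \<in> embeddings m G" "S = cycle_image m w" by auto
  have sub: "{v \<in> embeddings m G. cycle_image m v = S} \<subseteq> {..<m} \<rightarrow>\<^sub>E w ` {..<m}"
    using w by (auto simp: embeddings_def cycle_image_def PiE_def Pi_def extensional_def)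
  have "card {v \<in> embeddings m G. cycle_image m v = S} \<le> card ({..<m} \<rightarrow>\<^sub>E w ` {..<m})"
    by (rule card_mono[OF _ sub]) (auto intro: finite_PiE)
  also have "\<dots> = m ^ m"
    using w by (simp add: card_PiE card_image embeddings_def)
  finally show "card {v \<in> embeddings m G. cycle_image m v = S} \<le> m ^ m" .
qed

definition has_rainbow_cycle :: "nat \<Rightarrow> 'a ugraph \<Rightarrow> ('a set \<Rightarrow> nat) \<Rightarrow> bool" where
  "has_rainbow_cycle m G c \<longleftrightarrow> (\<exists>v\<in>embeddings m G. inj_on (\<lambda>i. c (cycle_edge m v i)) {..<m})"

lemma rainbow_cycle_image:
  assumes "3 \<le> m" "inj_on v {..<m}"
  shows "rainbow c (cycle_image m v) \<longleftrightarrow> inj_on (\<lambda>i. c (cycle_edge m v i)) {..<m}"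
  using comp_inj_on_iff[OF inj_on_cycle_edge[OF assms], of c]
  by (simp add: rainbow_def cycle_image_def o_def)

lemma rainbow_free_cycle_iff:
  assumes "3 \<le> m"
  shows "G \<in> rainbow_free n (cycle_graph m) \<longleftrightarrow>
    simple_graph G \<and> card (vertices G) = n \<and>
    (\<exists>c. proper_edge_coloring G c \<and> \<not> has_rainbow_cycle m G c)"
proof (cases "simple_graph G")
  case True
  have "(\<forall>S\<in>copies (cycle_graph m) G. \<not> rainbow c S) \<longleftrightarrow> \<not> has_rainbow_cycle m G c" for c
  proof -
    have "rainbow c (cycle_image m v) \<longleftrightarrow> inj_on (\<lambda>i. c (cycle_edge m v i)) {..<m}"
      if "v \<in> embeddings m G" for v
      using that by (intro rainbow_cycle_image[OF assms]) (simp add: embeddings_def)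
    then show ?thesis
      unfolding copies_cycle_graph[OF assms True] has_rainbow_cycle_def by blast
  qed
  then show ?thesis by (simp add: rainbow_free_def)
qed (simp add: rainbow_free_def)

lemma ex_rainbow_cycle_upper:
  assumes "3 \<le> m" "3 \<le> r"
    and "\<And>(G :: nat ugraph) c. \<lbrakk>simple_graph G; card (vertices G) = n; proper_edge_coloring G c;
      \<not> has_rainbow_cycle r G c\<rbrakk> \<Longrightarrow> card (embeddings m G) \<le> B"
  shows "ex_rainbow n (cycle_graph m) (cycle_graph r) \<le> B"
proof -
  have "uedges (cycle_graph r) \<noteq> {}" using assms(2) by (auto simp: cycle_edges_eq lessThan_empty_iff)
  then obtain G where G: "G \<in> rainbow_free n (cycle_graph r)"
      "ex_rainbow n (cycle_graph m) (cycle_graph r) = card (copies (cycle_graph m) G)"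
    using ex_rainbow_attained by blast
  then show ?thesis
  proof -
    obtain c where "simple_graph G" "card (vertices G) = n" "proper_edge_coloring G c"
        "\<not> has_rainbow_cycle r G c"
      using G(1) rainbow_free_cycle_iff[OF assms(2), of G n] by blast
    then show ?thesis
      using assms(3)[of G c] card_copies_le[OF assms(1), of G] G(2) by linarith
  qed
qed

lemma ex_rainbow_cycle_lower:
  fixes G :: "nat ugraph"
  assumes "3 \<le> m" "3 \<le> r" "simple_graph G" "card (vertices G) = n" "proper_edge_coloring G c"
    "\<not> has_rainbow_cycle r G c"
  shows "card (embeddings m G) \<le> m ^ m * ex_rainbow n (cycle_graph m) (cycle_graph r)"
proof -
  have "G \<in> rainbow_free n (cycle_graph r)"
    using assms rainbow_free_cycle_iff[OF assms(2)] by blast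
  then have "card (copies (cycle_graph m) G) \<le> ex_rainbow n (cycle_graph m) (cycle_graph r)"
    by (rule ex_rainbow_upper)
  then have "m ^ m * card (copies (cycle_graph m) G)
      \<le> m ^ m * ex_rainbow n (cycle_graph m) (cycle_graph r)" by simp
  then show ?thesis
    using card_embeddings_le[OF assms(1,3)] by linarith
qed

section \<open>Fat pairs and the number of 4-cycles\<close>

lemma double_count:
  fixes R :: "'a \<Rightarrow> 'b \<Rightarrow> bool"
  assumes "finite A" "finite B"
  shows "(\<Sum>a\<in>A. card {b \<in> B. R a b}) = (\<Sum>b\<in>B. card {a \<in> A. R a b})"
  using sum.swap_restrict[OF assms, of "\<lambda>_ _. 1::nat" R] by simp

text \<open>Cauchy-Schwarz from Lagrange's identity, carried out over the integers because
  differences occur.\<close>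

lemma sum_mult_squared_le:
  fixes a b :: "'i \<Rightarrow> nat"
  shows "(\<Sum>i\<in>A. a i * b i)\<^sup>2 \<le> (\<Sum>i\<in>A. (a i)\<^sup>2) * (\<Sum>i\<in>A. (b i)\<^sup>2)"
proof -
  let ?a = "\<lambda>i. int (a i)" and ?b = "\<lambda>i. int (b i)"
  have "0 \<le> (\<Sum>i\<in>A. \<Sum>j\<in>A. (?a i * ?b j - ?a j * ?b i)\<^sup>2)"
    by (intro sum_nonneg) auto
  also have "\<dots> = (\<Sum>i\<in>A. \<Sum>j\<in>A. (?a i)\<^sup>2 * (?b j)\<^sup>2) + (\<Sum>i\<in>A. \<Sum>j\<in>A. (?b i)\<^sup>2 * (?a j)\<^sup>2)
      - 2 * (\<Sum>i\<in>A. \<Sum>j\<in>A. (?a i * ?b i) * (?a j * ?b j))"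
    by (simp add: power2_diff power_mult_distrib sum.distrib sum_subtractf sum_distrib_left mult_ac)
  also have "\<dots> = 2 * ((\<Sum>i\<in>A. (?a i)\<^sup>2) * (\<Sum>i\<in>A. (?b i)\<^sup>2)) - 2 * (\<Sum>i\<in>A. ?a i * ?b i)\<^sup>2"
  proof -
    have "(\<Sum>i\<in>A. \<Sum>j\<in>A. (?b i)\<^sup>2 * (?a j)\<^sup>2) = (\<Sum>i\<in>A. \<Sum>j\<in>A. (?a i)\<^sup>2 * (?b j)\<^sup>2)"
      by (subst sum.swap) (simp add: mult.commute)
    then show ?thesis by (simp add: sum_product power2_eq_square)
  qed
  finally have "(\<Sum>i\<in>A. ?a i * ?b i)\<^sup>2 \<le> (\<Sum>i\<in>A. (?a i)\<^sup>2) * (\<Sum>i\<in>A. (?b i)\<^sup>2)" by simp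
  then have "int ((\<Sum>i\<in>A. a i * b i)\<^sup>2) \<le> int ((\<Sum>i\<in>A. (a i)\<^sup>2) * (\<Sum>i\<in>A. (b i)\<^sup>2))" by simp
  then show ?thesis by (simp only: of_nat_le_iff)
qed

section \<open>Paths in relations of large minimum degree\<close>

definition is_path_in :: "('a \<Rightarrow> 'a \<Rightarrow> bool) \<Rightarrow> 'a set \<Rightarrow> nat \<Rightarrow> (nat \<Rightarrow> 'a) \<Rightarrow> bool" where
  "is_path_in F N k x \<longleftrightarrow> inj_on x {..<k} \<and> x ` {..<k} \<subseteq> N \<and> (\<forall>i. Suc i < k \<longrightarrow> F (x i) (x (Suc i)))"

text \<open>Greedy extension: as long as the path has fewer than \<open>k\<close> vertices, they
  cannot exhaust the \<open>k\<close> relatives of its last one.\<close>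

lemma min_degree_path:
  assumes "N \<noteq> {}" and deg: "\<And>x. x \<in> N \<Longrightarrow> k \<le> card {y \<in> N. F x y}" and "finite N" "1 \<le> k"
  shows "\<exists>x. is_path_in F N k x"
proof -
  have "\<exists>x. is_path_in F N (Suc j) x" if "j < k" for j
    using that
  proof (induction j)
    case 0
    obtain a where "a \<in> N" using assms(1) by auto
    then have "is_path_in F N (Suc 0) (\<lambda>_. a)" by (auto simp: is_path_in_def inj_on_def)
    then show ?case by blast
  next
    case (Suc j)
    then obtain x where x: "is_path_in F N (Suc j) x" by auto
    then have "x j \<in> N" by (auto simp: is_path_in_def)
    then have "k \<le> card {y \<in> N. F (x j) y}" by (rule deg)
    moreover have "card (x ` {..<Suc j}) \<le> Suc j"
      using card_image_le[of "{..<Suc j}" x] by simp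
    ultimately have "card (x ` {..<Suc j}) < card {y \<in> N. F (x j) y}" using Suc.prems by linarith
    then obtain y where y: "y \<in> N" "F (x j) y" "y \<notin> x ` {..<Suc j}"
      by (metis (no_types, lifting) card_mono finite_imageI finite_lessThan linorder_not_less mem_Collect_eq subsetI)
    have "is_path_in F N (Suc (Suc j)) (x(Suc j := y))"
      using x y unfolding is_path_in_def
      by (auto simp: inj_on_def less_Suc_eq)
    then show ?case by blast
  qed
  from this[of "k - 1"] assms(4) show ?thesis by simp
qed

text \<open>Degeneracy: without such a path every nonempty subset has an element with fewer than
  \<open>k\<close> relatives. Removing it costs at most \<open>2 * k\<close> pairs, since both
  orders are counted.\<close>

lemma card_no_path:
  assumes "finite N" "1 \<le> k" "symp F" and no: "\<nexists>x. is_path_in F N k x"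
  shows "card {z \<in> N \<times> N. F (fst z) (snd z)} \<le> 2 * k * card N"
  using assms(1) no
proof (induction N rule: finite_psubset_induct)
  case (psubset N)
  show ?case
  proof (cases "N = {}")
    case False
    then obtain a where a: "a \<in> N" "card {y \<in> N. F a y} < k"
      using min_degree_path[of N k F] psubset.prems psubset.hyps assms(2) by (meson not_le)
    let ?N = "N - {a}" and ?D = "{y \<in> N. F a y}"
    have "is_path_in F N k x" if "is_path_in F ?N k x" for x
      using that by (auto simp: is_path_in_def)
    then have IH: "card {z \<in> ?N \<times> ?N. F (fst z) (snd z)} \<le> 2 * k * card ?N"
      using psubset.IH[of ?N] a(1) psubset.prems by blast
    have fin: "finite N" by (rule psubset.hyps)
    have "{z \<in> N \<times> N. F (fst z) (snd z)}
        \<subseteq> {z \<in> ?N \<times> ?N. F (fst z) (snd z)} \<union> ({a} \<times> ?D \<union> ?D \<times> {a})"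
      using assms(3) by (auto dest: sympD)
    then have "card {z \<in> N \<times> N. F (fst z) (snd z)}
        \<le> card ({z \<in> ?N \<times> ?N. F (fst z) (snd z)} \<union> ({a} \<times> ?D \<union> ?D \<times> {a}))"
      by (rule card_mono[rotated]) (use fin in auto)
    also have "\<dots> \<le> card {z \<in> ?N \<times> ?N. F (fst z) (snd z)} + (card ({a} \<times> ?D) + card (?D \<times> {a}))"
      by (meson add_left_mono card_Un_le order_trans)
    also have "\<dots> \<le> 2 * k * card ?N + 2 * k"
      using IH a(2) by (simp add: card_cartesian_product)
    also have "\<dots> = 2 * k * (card ?N + 1)" by simp
    also have "card ?N + 1 = card N" using a(1) fin card_Suc_Diff1 by fastforce
    finally show ?thesis .
  qed simp
qed

section \<open>Neighbourhoods and rainbow subdivisions of fat paths\<close>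

definition nbrs :: "'a ugraph \<Rightarrow> 'a \<Rightarrow> 'a set" where
  "nbrs G a = {x. {a, x} \<in> uedges G}"

definition common :: "'a ugraph \<Rightarrow> 'a \<Rightarrow> 'a \<Rightarrow> 'a set" where
  "common G a b = nbrs G a \<inter> nbrs G b"

lemma nbrs_sym: "x \<in> nbrs G a \<longleftrightarrow> a \<in> nbrs G x"
  by (simp add: nbrs_def insert_commute)

lemma common_sym: "common G a b = common G b a"
  by (auto simp: common_def)

lemma nbrs_subset: "simple_graph G \<Longrightarrow> nbrs G a \<subseteq> vertices G"
  by (auto simp: nbrs_def simple_graph_def)

lemma not_nbrs_self: "simple_graph G \<Longrightarrow> a \<notin> nbrs G a"
  by (force simp: nbrs_def simple_graph_def)

lemma finite_nbrs: "simple_graph G \<Longrightarrow> finite (nbrs G a)"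
  by (rule finite_subset[OF nbrs_subset]) (auto simp: simple_graph_def)

lemma finite_common: "simple_graph G \<Longrightarrow> finite (common G a b)"
  by (simp add: common_def finite_nbrs)

lemma proper_inj_nbrs:
  assumes "proper_edge_coloring G c"
  shows "inj_on (\<lambda>y. c {a, y}) (nbrs G a)"
proof (rule inj_onI)
  fix x y assume xy: "x \<in> nbrs G a" "y \<in> nbrs G a" "c {a, x} = c {a, y}"
  have "{a, x} \<inter> {a, y} \<noteq> {}" by simp
  then have "{a, x} = {a, y}"
    using assms xy unfolding proper_edge_coloring_def nbrs_def mem_Collect_eq by metis
  then show "x = y" by (auto simp: doubleton_eq_iff)
qed

definition fat :: "nat \<Rightarrow> 'a ugraph \<Rightarrow> 'a \<Rightarrow> 'a \<Rightarrow> bool" where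
  "fat K G x y \<longleftrightarrow> x \<noteq> y \<and> K \<le> card (common G x y)"

text \<open>The edges of the subdivided path \<open>x 0, y 0, x 1, y 1, ...\<close> in order: index
  \<open>2 * i\<close> joins \<open>x i\<close> to \<open>y i\<close>, index
  \<open>2 * i + 1\<close> joins \<open>y i\<close> to \<open>x (i + 1)\<close>.\<close>

definition subdiv_colour :: "('a set \<Rightarrow> nat) \<Rightarrow> (nat \<Rightarrow> 'a) \<Rightarrow> (nat \<Rightarrow> 'a) \<Rightarrow> nat \<Rightarrow> nat" where
  "subdiv_colour c x y t = c {x (Suc t div 2), y (t div 2)}"

text \<open>\<open>D\<close> and \<open>W\<close> reserve colours and vertices for the rest of the
  cycle. By properness each forbidden colour excludes at most one neighbour of either endpoint, so
  the choice of \<open>y j\<close> has to avoid at most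
  \<open>2 * (card D + 2 * j) + j + card W\<close> vertices; this explains the bound on
  \<open>K\<close>.\<close>

lemma exists_rainbow_subdivision:
  assumes G: "simple_graph G" and c: "proper_edge_coloring G c"
    and path: "is_path_in (fat K G) N k x"
    and K: "2 * card D + 6 * k + card W < K" and fin: "finite D" "finite W"
    and "Suc j \<le> k"
  shows "\<exists>y. (\<forall>i<j. y i \<in> common G (x i) (x (Suc i))) \<and> inj_on y {..<j} \<and>
     y ` {..<j} \<inter> W = {} \<and> inj_on (subdiv_colour c x y) {..<2 * j} \<and>
     subdiv_colour c x y ` {..<2 * j} \<inter> D = {}"
  using \<open>Suc j \<le> k\<close>
proof (induction j)
  case (Suc j)
  then obtain y where y: "\<forall>i<j. y i \<in> common G (x i) (x (Suc i))" "inj_on y {..<j}"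
     "y ` {..<j} \<inter> W = {}" "inj_on (subdiv_colour c x y) {..<2 * j}"
     "subdiv_colour c x y ` {..<2 * j} \<inter> D = {}" by auto
  let ?S = "common G (x j) (x (Suc j))"
  define U where "U = D \<union> subdiv_colour c x y ` {..<2 * j}"
  define Bad where "Bad a = {z \<in> nbrs G a. c {a, z} \<in> U}" for a
  have finU: "finite U" using fin by (simp add: U_def)
  have cardU: "card U \<le> card D + 2 * j"
  proof -
    have "card (subdiv_colour c x y ` {..<2 * j}) \<le> 2 * j"
      using card_image_le[of "{..<2 * j}"] by fastforce
    then show ?thesis unfolding U_def using card_Un_le by (meson add_left_mono order_trans)
  qed
  have bad: "card (Bad a) \<le> card U" for a
  proof (rule card_inj_on_le[OF _ _ finU])
    show "inj_on (\<lambda>z. c {a, z}) (Bad a)"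
      using proper_inj_nbrs[OF c, of a] by (rule inj_on_subset) (auto simp: Bad_def)
  qed (auto simp: Bad_def)
  have finBad: "finite (Bad a)" for a by (simp add: Bad_def finite_nbrs[OF G])
  have cardy: "card (y ` {..<j}) \<le> j" using card_image_le[of "{..<j}" y] by simp
  let ?X = "W \<union> (y ` {..<j} \<union> (Bad (x j) \<union> Bad (x (Suc j))))"
  have "card ?X \<le> card W + (card (y ` {..<j}) + (card (Bad (x j)) + card (Bad (x (Suc j)))))"
    by (meson add_left_mono card_Un_le order_trans)
  also have "\<dots> < K"
    using cardy bad[of "x j"] bad[of "x (Suc j)"] cardU K Suc.prems by linarith
  also have "\<dots> \<le> card ?S"
    using path Suc.prems by (auto simp: is_path_in_def fat_def)
  finally have "card ?X < card ?S" .
  moreover have "finite ?X" using fin finBad by simp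
  ultimately obtain z where z: "z \<in> ?S" "z \<notin> ?X"
    by (metis card_mono linorder_not_less subsetI)
  have zn: "z \<in> nbrs G (x j)" "z \<in> nbrs G (x (Suc j))" using z(1) by (auto simp: common_def)
  then have zU: "c {x j, z} \<notin> U" "c {x (Suc j), z} \<notin> U"
    using z(2) by (auto simp: Bad_def)
  have xneq: "x j \<noteq> x (Suc j)" using path Suc.prems by (auto simp: is_path_in_def fat_def)
  \<comment> \<open>Both new edges meet in \<open>z\<close>, so properness separates their
    colours.\<close>
  have "x j \<in> nbrs G z" "x (Suc j) \<in> nbrs G z" using zn nbrs_sym by fast+
  then have cneq: "c {x j, z} \<noteq> c {x (Suc j), z}"
    using proper_inj_nbrs[OF c, of z] xneq by (metis (no_types, lifting) inj_onD insert_commute)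
  let ?y = "y(j := z)"
  have old: "subdiv_colour c x ?y t = subdiv_colour c x y t" if "t < 2 * j" for t
    using that by (auto simp: subdiv_colour_def)
  have new: "subdiv_colour c x ?y (2 * j) = c {x j, z}"
    "subdiv_colour c x ?y (Suc (2 * j)) = c {x (Suc j), z}"
    by (auto simp: subdiv_colour_def)
  have split: "{..<2 * Suc j} = insert (Suc (2 * j)) (insert (2 * j) {..<2 * j})" by auto
  have img: "subdiv_colour c x ?y ` {..<2 * j} = subdiv_colour c x y ` {..<2 * j}"
    using old by (intro image_cong) auto
  have "inj_on (subdiv_colour c x ?y) {..<2 * j}"
    using y(4) old by (subst inj_on_cong[where g = "subdiv_colour c x y"]) auto
  then have "inj_on (subdiv_colour c x ?y) {..<2 * Suc j}"
    unfolding split using zU cneq new img by (auto simp: U_def)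
  moreover have "subdiv_colour c x ?y ` {..<2 * Suc j} \<inter> D = {}"
    unfolding split using zU new img y(5) by (auto simp: U_def)
  moreover have "inj_on ?y {..<Suc j}"
    using y(2) z(2) by (auto simp: inj_on_def less_Suc_eq)
  moreover have "?y ` {..<Suc j} \<inter> W = {}"
  proof -
    have "?y ` {..<Suc j} = insert z (y ` {..<j})" by (auto simp: less_Suc_eq image_iff)
    moreover have "insert z (y ` {..<j}) \<inter> W = {}" using y(3) z(2) by simp
    ultimately show ?thesis by (simp only:)
  qed
  moreover have "\<forall>i<Suc j. ?y i \<in> common G (x i) (x (Suc i))"
    using y(1) z(1) by (auto simp: less_Suc_eq)
  ultimately show ?case by blast
qed auto

lemma fat_path_rainbow_cycle:
  assumes G: "simple_graph G" and c: "proper_edge_coloring G c" and k: "2 \<le> k"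
    and path: "is_path_in (fat (10 * k) G) (nbrs G a) k x"
  shows "has_rainbow_cycle (2 * k) G c"
proof -
  \<comment> \<open>Reserved are the colours of the two edges that close the path at
    \<open>a\<close>, and the vertices placed already.\<close>
  define D where "D = {c {a, x 0}, c {a, x (k - 1)}}"
  define W where "W = insert a (x ` {..<k})"
  have "card W \<le> Suc k"
    unfolding W_def using card_insert_le_m1[of "Suc k"] card_image_le[of "{..<k}" x] by fastforce
  moreover have "card D \<le> 2" unfolding D_def by (simp add: card_insert_if)
  \<comment> \<open>\<open>2 * 2 + 6 * k + (k + 1) < 10 * k\<close> for \<open>k \<ge> 2\<close>:
    the origin of the threshold \<open>10 * k\<close>.\<close>
  ultimately have "2 * card D + 6 * k + card W < 10 * k" using k by linarith
  then obtain y where y: "\<And>i. i < k - 1 \<Longrightarrow> y i \<in> common G (x i) (x (Suc i))" "inj_on y {..<k - 1}"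
     "y ` {..<k - 1} \<inter> W = {}" "inj_on (subdiv_colour c x y) {..<2 * (k - 1)}"
     "subdiv_colour c x y ` {..<2 * (k - 1)} \<inter> D = {}"
    using exists_rainbow_subdivision[OF G c path, of D W "k - 1"] k by (auto simp: D_def W_def)
  have xa: "x i \<in> nbrs G a" if "i < k" for i using path that by (auto simp: is_path_in_def)
  have injx: "inj_on x {..<k}" using path by (simp add: is_path_in_def)
  \<comment> \<open>The cycle is \<open>a, x 0, y 0, x 1, ..., y (k - 2), x (k - 1)\<close>, with
    the path vertices at the odd positions.\<close>
  define v where "v = restrict (\<lambda>t. if t = 0 then a else if odd t then x (t div 2) else y (t div 2 - 1)) {..<2 * k}"
  have v0: "v 0 = a" using k by (simp add: v_def)
  have vx: "v (Suc (2 * i)) = x i" if "i < k" for i using that by (simp add: v_def)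
  have vy: "v (Suc (Suc (2 * i))) = y i" if "i < k - 1" for i
  proof -
    have "Suc (Suc (2 * i)) < 2 * k" using that by linarith
    then show ?thesis by (simp add: v_def)
  qed
  have cases: "t = 0 \<or> (\<exists>i<k - 1. t = Suc (2 * i)) \<or> (\<exists>i<k - 1. t = Suc (Suc (2 * i))) \<or> t = Suc (2 * (k - 1))"
    if "t < 2 * k" for t using that by presburger
  have e0: "cycle_edge (2 * k) v 0 = {a, x 0}" using v0 vx[of 0] k by (simp add: cycle_edge_def)
  have e1: "cycle_edge (2 * k) v (Suc (2 * i)) = {x i, y i}" if "i < k - 1" for i
    using vx[of i] vy[of i] that by (simp add: cycle_edge_def)
  have e2: "cycle_edge (2 * k) v (Suc (Suc (2 * i))) = {x (Suc i), y i}" if "i < k - 1" for i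
  proof -
    have "Suc (Suc (Suc (2 * i))) < 2 * k" using that by linarith
    then show ?thesis using vx[of "Suc i"] vy[of i] that by (auto simp: cycle_edge_def)
  qed
  have e3: "cycle_edge (2 * k) v (Suc (2 * (k - 1))) = {a, x (k - 1)}"
  proof -
    have "Suc (Suc (2 * (k - 1))) = 2 * k" using k by simp
    then show ?thesis using vx[of "k - 1"] v0 k by (simp add: cycle_edge_def insert_commute)
  qed
  have edges: "cycle_edge (2 * k) v t \<in> uedges G" if "t < 2 * k" for t
    using cases[OF that]
  proof (elim disjE exE conjE)
    assume "t = 0" then show ?thesis using e0 xa[of 0] k by (simp add: nbrs_def)
  next
    fix i assume "i < k - 1" "t = Suc (2 * i)"
    then show ?thesis using e1 y(1)[of i] by (simp add: common_def nbrs_def)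
  next
    fix i assume "i < k - 1" "t = Suc (Suc (2 * i))"
    then show ?thesis using e2 y(1)[of i] by (simp add: common_def nbrs_def)
  next
    assume "t = Suc (2 * (k - 1))" then show ?thesis using e3 xa[of "k - 1"] k by (simp add: nbrs_def)
  qed
  have anx: "a \<noteq> x i" if "i < k" for i using xa[OF that] not_nbrs_self[OF G] by auto
  have any: "y i \<noteq> a" "i' < k \<Longrightarrow> y i \<noteq> x i'" if "i < k - 1" for i i'
    using y(3) that by (auto simp: W_def)
  have injv: "inj_on v {..<2 * k}"
  proof (rule linorder_inj_onI)
    fix s t assume st: "s < t" "s \<in> {..<2 * k}" "t \<in> {..<2 * k}"
    have x_neq: "x i \<noteq> x j" if "i < j" "j < k" for i j using injx that by (auto simp: inj_on_def)
    have y_neq: "y i \<noteq> y j" if "i < j" "j < k - 1" for i j using y(2) that by (auto simp: inj_on_def)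
    have A: "v t \<noteq> a" if "0 < t" "t < 2 * k" for t
    proof (cases "odd t")
      case True
      then obtain i where "t = Suc (2 * i)" by (elim oddE) simp
      then show ?thesis using vx[of i] anx[of i] that by auto
    next
      case False
      then obtain i where "t = 2 * Suc i" using \<open>0 < t\<close> by (metis evenE gr0_implies_Suc mult_0_right neq0_conv)
      then show ?thesis using vy[of i] any(1)[of i] that by auto
    qed
    show "v s \<noteq> v t"
    proof (cases "s = 0")
      case True then show ?thesis using A[of t] st v0 by auto
    next
      case False
      have d: "\<exists>i. (r = Suc (2 * i) \<and> i < k) \<or> (r = Suc (Suc (2 * i)) \<and> i < k - 1)"
        if "0 < r" "r < 2 * k" for r
        using that by presburger
      obtain i where i: "(s = Suc (2 * i) \<and> i < k) \<or> (s = Suc (Suc (2 * i)) \<and> i < k - 1)"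
        using d[of s] False st by auto
      obtain j where j: "(t = Suc (2 * j) \<and> j < k) \<or> (t = Suc (Suc (2 * j)) \<and> j < k - 1)"
        using d[of t] st by auto
      from i j show ?thesis
        using st(1) vx vy x_neq[of i j] y_neq[of i j] any(2)[of i j] any(2)[of j i]
        by (elim disjE conjE) auto
    qed
  qed auto
  have col: "c (cycle_edge (2 * k) v (Suc t)) = subdiv_colour c x y t" if "t < 2 * (k - 1)" for t
  proof (cases "even t")
    case True
    then obtain i where "t = 2 * i" by (elim evenE)
    then show ?thesis using e1[of i] that by (simp add: subdiv_colour_def)
  next
    case False
    then obtain i where "t = Suc (2 * i)" by (elim oddE) simp
    then show ?thesis using e2[of i] that by (simp add: subdiv_colour_def)
  qed
  let ?f = "\<lambda>t. c (cycle_edge (2 * k) v t)"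
  have "x 0 \<noteq> x (k - 1)" using injx k by (auto dest!: inj_onD[where x = 0 and y = "k - 1"])
  then have "c {a, x 0} \<noteq> c {a, x (k - 1)}"
    using proper_inj_nbrs[OF c, of a] xa[of 0] xa[of "k - 1"] k by (auto simp: inj_on_def)
  then have f0: "?f 0 \<noteq> ?f (Suc (2 * (k - 1)))" using e0 e3 by simp
  have fD: "?f 0 \<in> D" "?f (Suc (2 * (k - 1))) \<in> D" using e0 e3 by (simp_all add: D_def)
  have fcol: "?f ` Suc ` {..<2 * (k - 1)} = subdiv_colour c x y ` {..<2 * (k - 1)}"
    unfolding image_image using col by (intro image_cong) auto
  have "inj_on ?f (Suc ` {..<2 * (k - 1)})"
  proof (rule inj_on_imageI)
    show "inj_on (?f \<circ> Suc) {..<2 * (k - 1)}"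
      using y(4) col by (subst inj_on_cong[where g = "subdiv_colour c x y"]) auto
  qed
  then have "inj_on ?f (insert 0 (insert (Suc (2 * (k - 1))) (Suc ` {..<2 * (k - 1)})))"
    using f0 fD fcol y(5) by (auto simp: image_iff)
  moreover have "{..<2 * k} = insert 0 (insert (Suc (2 * (k - 1))) (Suc ` {..<2 * (k - 1)}))"
  proof -
    have "2 * k = Suc (Suc (2 * (k - 1)))" using k by simp
    then show ?thesis by (simp only: lessThan_Suc_eq_insert_0[of "Suc (2 * (k - 1))"]
      lessThan_Suc[of "2 * (k - 1)"] image_insert) 
  qed
  ultimately have "inj_on ?f {..<2 * k}" by simp
  moreover have "v \<in> embeddings (2 * k) G"
  proof -
    have "v t \<in> vertices G" if "t < 2 * k" for t
      using edges[OF that] G by (auto simp: simple_graph_def cycle_edge_def)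
    moreover have "v \<in> extensional {..<2 * k}" by (simp add: v_def)
    ultimately show ?thesis using injv edges by (auto simp: embeddings_def PiE_def)
  qed
  ultimately show ?thesis by (auto simp: has_rainbow_cycle_def)
qed

section \<open>The sum of the squared codegrees\<close>

definition distinct_pairs :: "'a ugraph \<Rightarrow> ('a \<times> 'a) set" where
  "distinct_pairs G = {p \<in> vertices G \<times> vertices G. fst p \<noteq> snd p}"

text \<open>Squared Hilbert-Schmidt norm of the codegree matrix after removal of its diagonal, which
  holds the degrees.\<close>

definition codegree_energy :: "'a ugraph \<Rightarrow> nat" where
  "codegree_energy G = (\<Sum>p\<in>distinct_pairs G. (card (common G (fst p) (snd p)))\<^sup>2)"

lemma card_fat_pairs_nbrs:
  assumes G: "simple_graph G" and c: "proper_edge_coloring G c" and k: "2 \<le> k"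
    and no: "\<not> has_rainbow_cycle (2 * k) G c" and N: "N \<subseteq> nbrs G a"
  shows "card {z \<in> N \<times> N. fat (10 * k) G (fst z) (snd z)} \<le> 2 * k * card N"
proof (rule card_no_path)
  show "finite N" using N finite_nbrs[OF G] finite_subset by blast
  show "symp (fat (10 * k) G)" by (auto simp: symp_def fat_def common_sym)
  show "\<nexists>x. is_path_in (fat (10 * k) G) N k x"
  proof
    assume "\<exists>x. is_path_in (fat (10 * k) G) N k x"
    then obtain x where "is_path_in (fat (10 * k) G) N k x" ..
    then have "is_path_in (fat (10 * k) G) (nbrs G a) k x"
      using N by (auto simp: is_path_in_def)
    then show False using fat_path_rainbow_cycle[OF G c k] no by blast
  qed
qed (use k in simp)

text \<open>A 4-cycle is a pair of diagonals. Those with a thin diagonal are easily counted; for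
  those with two fat diagonals, two applications of \<open>card_fat_pairs_nbrs\<close> reduce the count
  to the number of edges.\<close>

lemma codegree_energy_le:
  assumes G: "simple_graph G" and c: "proper_edge_coloring G c" and k: "2 \<le> k"
    and no: "\<not> has_rainbow_cycle (2 * k) G c"
  shows "codegree_energy G \<le> 308 * k\<^sup>2 * (card (vertices G))\<^sup>2"
proof -
  define n where "n = card (vertices G)"
  define P where "P = distinct_pairs G"
  define C where "C p = common G (fst p) (snd p)" for p
  define f where "f p = card (C p)" for p
  define Fat where "Fat = {p \<in> P. 10 * k \<le> f p}"
  \<comment> \<open>For \<open>p\<close> and \<open>q\<close> in \<open>P\<close>, the relation says
    that they are the two diagonals of a 4-cycle.\<close>
  define R where "R p q \<longleftrightarrow> q \<in> C p \<times> C p" for p q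
  have finV: "finite (vertices G)" using G by (simp add: simple_graph_def)
  have PV: "P \<subseteq> vertices G \<times> vertices G" by (auto simp: P_def distinct_pairs_def)
  have finP: "finite P" by (rule finite_subset[OF PV]) (simp add: finV)
  have finFat: "finite Fat" "finite (P - Fat)" using finP by (auto simp: Fat_def)
  have finC: "finite (C p)" for p by (simp add: C_def finite_common[OF G])
  have cardP: "card P \<le> n\<^sup>2"
    using card_mono[OF _ PV] finV by (simp add: n_def card_cartesian_product power2_eq_square)
  have CV: "C p \<subseteq> vertices G" for p
    using nbrs_subset[OF G] by (auto simp: C_def common_def)
  have fatnb: "{p \<in> Fat. a \<in> C p} = {p \<in> Fat. p \<in> nbrs G a \<times> nbrs G a}" for a
    by (auto simp: C_def common_def mem_Times_iff nbrs_sym)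
  have Rsym: "R p q = R q p" for p q
    by (auto simp: R_def C_def common_def mem_Times_iff nbrs_sym)
  have count: "card {q \<in> P. R p q} = f p * f p - f p" for p
  proof -
    have "{q \<in> P. R p q} = C p \<times> C p - (\<lambda>x. (x, x)) ` C p"
      using CV[of p] by (auto simp: P_def distinct_pairs_def R_def)
    moreover have "card ((\<lambda>x. (x, x)) ` C p) = f p"
      by (simp add: f_def card_image inj_on_def)
    moreover have "(\<lambda>x. (x, x)) ` C p \<subseteq> C p \<times> C p" by auto
    ultimately show ?thesis
      using finC[of p] by (simp add: card_Diff_subset card_cartesian_product f_def)
  qed
  have count_le: "card {q \<in> A. R p q} \<le> (f p)\<^sup>2" for p A
  proof -
    have "card {q \<in> A. R p q} \<le> card (C p \<times> C p)"
      by (rule card_mono) (use finC in \<open>auto simp: R_def\<close>)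
    then show ?thesis by (simp add: card_cartesian_product f_def power2_eq_square)
  qed
  have thin: "f p \<le> 10 * k" if "p \<in> P - Fat" for p using that by (auto simp: Fat_def)
  have thin_sq: "(f p)\<^sup>2 \<le> 100 * k\<^sup>2" if "p \<in> P - Fat" for p
  proof -
    have "(f p)\<^sup>2 \<le> (10 * k)\<^sup>2" using thin[OF that] by (rule power_mono) simp
    then show ?thesis by (simp add: power_mult_distrib)
  qed
  have thin_sum: "(\<Sum>p\<in>P - Fat. (f p)\<^sup>2) \<le> 100 * k\<^sup>2 * n\<^sup>2"
  proof -
    have "(\<Sum>p\<in>P - Fat. (f p)\<^sup>2) \<le> (\<Sum>p\<in>P - Fat. 100 * k\<^sup>2)"
      by (rule sum_mono) (rule thin_sq)
    also have "\<dots> = 100 * k\<^sup>2 * card (P - Fat)" by simp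
    also have "\<dots> \<le> 100 * k\<^sup>2 * n\<^sup>2"
      using cardP card_mono[OF finP, of "P - Fat"] by (intro mult_left_mono) auto
    finally show ?thesis .
  qed
  have fat_nbrs: "card {q \<in> Fat. q \<in> N \<times> N} \<le> 2 * k * card N" if "N \<subseteq> nbrs G a" for N a
  proof -
    have "finite N" using that finite_nbrs[OF G] finite_subset by blast
    then have "card {q \<in> Fat. q \<in> N \<times> N} \<le> card {z \<in> N \<times> N. fat (10 * k) G (fst z) (snd z)}"
      by (intro card_mono) (auto simp: Fat_def P_def distinct_pairs_def fat_def f_def C_def)
    then show ?thesis using card_fat_pairs_nbrs[OF G c k no that] by linarith
  qed
  \<comment> \<open>\<open>C p\<close> lies in one neighbourhood, so it contains at most
    \<open>2 * k * f p\<close> fat pairs. The sum of \<open>f p\<close> over fat \<open>p\<close> is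
    then counted from the vertices \<open>a\<close>: the fat pairs within \<open>nbrs G a\<close>
    are again linearly many.\<close>
  have fatfat: "(\<Sum>p\<in>Fat. card {q \<in> Fat. R p q}) \<le> 4 * k\<^sup>2 * n\<^sup>2"
  proof -
    have "(\<Sum>p\<in>Fat. card {q \<in> Fat. R p q}) \<le> (\<Sum>p\<in>Fat. 2 * k * f p)"
    proof (rule sum_mono)
      fix p
      have "C p \<subseteq> nbrs G (fst p)" by (simp add: C_def common_def)
      then show "card {q \<in> Fat. R p q} \<le> 2 * k * f p" using fat_nbrs by (simp add: R_def f_def)
    qed
    also have "\<dots> = 2 * k * (\<Sum>p\<in>Fat. card {a \<in> vertices G. a \<in> C p})"
    proof -
      have "{a \<in> vertices G. a \<in> C p} = C p" for p using CV[of p] by blast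
      then show ?thesis by (simp add: sum_distrib_left f_def)
    qed
    also have "\<dots> = 2 * k * (\<Sum>a\<in>vertices G. card {p \<in> Fat. a \<in> C p})"
      using double_count[OF finFat(1) finV] by simp
    also have "\<dots> \<le> 2 * k * (\<Sum>a\<in>vertices G. 2 * k * n)"
    proof (intro mult_left_mono sum_mono)
      fix a
      have "card (nbrs G a) \<le> n"
        unfolding n_def by (rule card_mono[OF finV nbrs_subset[OF G]])
      then have "2 * k * card (nbrs G a) \<le> 2 * k * n" by simp
      then show "card {p \<in> Fat. a \<in> C p} \<le> 2 * k * n"
        unfolding fatnb using fat_nbrs[OF subset_refl, of a] by linarith
    qed simp
    also have "\<dots> = 4 * k\<^sup>2 * n\<^sup>2" by (simp add: n_def power2_eq_square)
    finally show ?thesis .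
  qed
  \<comment> \<open>With at least two common neighbours, discarding the degenerate second diagonals
    loses at most a factor of 2.\<close>
  have "(\<Sum>p\<in>Fat. (f p)\<^sup>2) \<le> (\<Sum>p\<in>Fat. 2 * card {q \<in> P. R p q})"
  proof (rule sum_mono)
    fix p assume "p \<in> Fat"
    then have "2 \<le> f p" using k by (simp add: Fat_def)
    then have "2 * f p \<le> f p * f p" by simp
    then show "(f p)\<^sup>2 \<le> 2 * card {q \<in> P. R p q}" unfolding count power2_eq_square by linarith
  qed
  also have "\<dots> = 2 * (\<Sum>p\<in>Fat. card {q \<in> P - Fat. R p q} + card {q \<in> Fat. R p q})"
  proof -
    have "card {q \<in> P. R p q} = card {q \<in> P - Fat. R p q} + card {q \<in> Fat. R p q}" for p
    proof -
      have "{q \<in> P. R p q} = {q \<in> P - Fat. R p q} \<union> {q \<in> Fat. R p q}" by (auto simp: Fat_def)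
      then show ?thesis using finFat by (simp add: card_Un_disjoint disjoint_iff)
    qed
    then show ?thesis by (simp add: sum_distrib_left)
  qed
  also have "\<dots> = 2 * (\<Sum>p\<in>Fat. card {q \<in> P - Fat. R p q}) + 2 * (\<Sum>p\<in>Fat. card {q \<in> Fat. R p q})"
    by (simp add: sum.distrib)
  \<comment> \<open>A 4-cycle with one fat and one thin diagonal is charged to the thin one.\<close>
  also have "(\<Sum>p\<in>Fat. card {q \<in> P - Fat. R p q}) = (\<Sum>q\<in>P - Fat. card {p \<in> Fat. R q p})"
    by (subst double_count[OF finFat])
      (intro sum.cong refl arg_cong[where f = card] Collect_cong conj_cong Rsym)
  also have "\<dots> \<le> (\<Sum>q\<in>P - Fat. (f q)\<^sup>2)" by (intro sum_mono count_le)
  finally have "(\<Sum>p\<in>Fat. (f p)\<^sup>2) \<le> 2 * (100 * k\<^sup>2 * n\<^sup>2) + 2 * (4 * k\<^sup>2 * n\<^sup>2)"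
    using thin_sum fatfat by linarith
  moreover have "codegree_energy G = (\<Sum>p\<in>P - Fat. (f p)\<^sup>2) + (\<Sum>p\<in>Fat. (f p)\<^sup>2)"
    unfolding codegree_energy_def P_def[symmetric] f_def[symmetric] C_def[symmetric]
    by (rule sum.subset_diff) (use finP in \<open>auto simp: Fat_def\<close>)
  \<comment> \<open>\<open>100 + 2 * 100 + 2 * 4 = 308\<close>.\<close>
  ultimately show ?thesis using thin_sum unfolding n_def[symmetric] by linarith
qed

section \<open>Even cycles from products of the codegree matrix\<close>

text \<open>Zero on the diagonal, so that sums may range over all pairs and follow matrix
  multiplication.\<close>

definition offdiag_common :: "'a ugraph \<Rightarrow> 'a \<Rightarrow> 'a \<Rightarrow> 'a set" where
  "offdiag_common G a b = (if a = b then {} else common G a b)"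

lemma codegree_energy_eq:
  assumes "simple_graph G"
  shows "codegree_energy G = (\<Sum>a\<in>vertices G. \<Sum>b\<in>vertices G. (card (offdiag_common G a b))\<^sup>2)"
proof -
  have fin: "finite (vertices G)" using assms by (simp add: simple_graph_def)
  have "(\<Sum>a\<in>vertices G. \<Sum>b\<in>vertices G. (card (offdiag_common G a b))\<^sup>2)
      = (\<Sum>p\<in>vertices G \<times> vertices G. (card (offdiag_common G (fst p) (snd p)))\<^sup>2)"
    by (simp add: sum.cartesian_product case_prod_beta)
  also have "\<dots> = (\<Sum>p\<in>distinct_pairs G. (card (offdiag_common G (fst p) (snd p)))\<^sup>2)"
    by (rule sum.mono_neutral_right) (use fin in \<open>auto simp: distinct_pairs_def offdiag_common_def\<close>)
  also have "\<dots> = codegree_energy G"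
    unfolding codegree_energy_def by (rule sum.cong) (auto simp: distinct_pairs_def offdiag_common_def)
  finally show ?thesis by simp
qed

text \<open>Only consecutive even vertices are kept apart. This overcounts paths, but the count is
  bounded by an entry of a matrix power.\<close>

definition walks :: "'a ugraph \<Rightarrow> nat \<Rightarrow> 'a \<Rightarrow> 'a \<Rightarrow> (nat \<Rightarrow> 'a) set" where
  "walks G j a b = {v \<in> {..2 * j} \<rightarrow>\<^sub>E vertices G. v 0 = a \<and> v (2 * j) = b \<and>
     (\<forall>i<2 * j. {v i, v (Suc i)} \<in> uedges G) \<and> (\<forall>i<j. v (2 * i) \<noteq> v (2 * i + 2))}"

lemma finite_walks: "finite (vertices G) \<Longrightarrow> finite (walks G j a b)"
  by (rule finite_subset[of _ "{..2 * j} \<rightarrow>\<^sub>E vertices G"]) (auto simp: walks_def intro: finite_PiE)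

text \<open>Cutting at the vertex \<open>d\<close> two steps before the end gives one entry of a
  matrix product.\<close>

lemma card_walks_Suc:
  assumes G: "simple_graph G"
  shows "card (walks G (Suc j) a b) \<le> (\<Sum>d\<in>vertices G. card (walks G j a d) * card (offdiag_common G d b))"
proof -
  let ?S = "SIGMA d:vertices G. walks G j a d \<times> offdiag_common G d b"
  let ?g = "\<lambda>(d, v, x). v(Suc (2 * j) := x, Suc (Suc (2 * j)) := b)"
  have fin: "finite (vertices G)" using G by (simp add: simple_graph_def)
  have "finite (offdiag_common G d b)" for d by (simp add: offdiag_common_def finite_common[OF G])
  then have finS: "finite ?S" using fin finite_walks[OF fin] by (intro finite_SigmaI) auto
  have "walks G (Suc j) a b \<subseteq> ?g ` ?S"
  proof
    fix w assume w: "w \<in> walks G (Suc j) a b"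
    let ?v = "restrict w {..2 * j}"
    have wV: "w \<in> {..Suc (Suc (2 * j))} \<rightarrow>\<^sub>E vertices G" and w0: "w 0 = a" "w (Suc (Suc (2 * j))) = b"
      and adj: "\<And>i. i < Suc (Suc (2 * j)) \<Longrightarrow> {w i, w (Suc i)} \<in> uedges G"
      and dist: "\<And>i. i < Suc j \<Longrightarrow> w (2 * i) \<noteq> w (2 * i + 2)"
      using w by (auto simp: walks_def)
    have "w i \<in> vertices G" if "i \<le> 2 * j" for i using wV that by (auto simp: PiE_iff)
    then have "?v \<in> walks G j a (w (2 * j))"
      using w0 adj dist by (auto simp: walks_def)
    moreover have "w (Suc (2 * j)) \<in> offdiag_common G (w (2 * j)) b"
      using adj[of "2 * j"] adj[of "Suc (2 * j)"] dist[of j] w0(2)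
      by (simp add: offdiag_common_def common_def nbrs_def insert_commute)
    moreover have "w (2 * j) \<in> vertices G" using wV by (auto simp: PiE_iff)
    moreover have "w = ?g (w (2 * j), ?v, w (Suc (2 * j)))"
    proof
      fix i
      show "w i = ?g (w (2 * j), ?v, w (Suc (2 * j))) i"
        using wV w0(2) by (cases "i \<le> 2 * j") (auto simp: PiE_iff extensional_def)
    qed
    ultimately show "w \<in> ?g ` ?S" by (intro image_eqI[of _ _ "(w (2 * j), ?v, w (Suc (2 * j)))"]) auto
  qed
  then have "card (walks G (Suc j) a b) \<le> card (?g ` ?S)"
    by (intro card_mono) (use finS in auto)
  also have "\<dots> \<le> card ?S" by (rule card_image_le[OF finS])
  also have "\<dots> = (\<Sum>d\<in>vertices G. card (walks G j a d \<times> offdiag_common G d b))"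
    by (rule card_SigmaI) (use fin finite_walks[OF fin] \<open>\<And>d. finite (offdiag_common G d b)\<close> in auto)
  finally show ?thesis by (simp add: card_cartesian_product)
qed

text \<open>Submultiplicativity of the Hilbert-Schmidt norm, by Cauchy-Schwarz over the cutting
  vertex \<open>d\<close>. The exponent starts at one: walks of length zero form the identity
  matrix, whose squared norm is the number of vertices.\<close>

lemma walks_energy:
  assumes G: "simple_graph G"
  shows "(\<Sum>a\<in>vertices G. \<Sum>b\<in>vertices G. (card (walks G (Suc j) a b))\<^sup>2) \<le> codegree_energy G ^ Suc j"
proof (induction j)
  case 0
  have fin: "finite (vertices G)" using G by (simp add: simple_graph_def)
  have w0: "card (walks G 0 a d) \<le> (if d = a then 1 else 0)" for a d
  proof (cases "d = a")
    case True
    have "walks G 0 a a \<subseteq> {\<lambda>i. if i = 0 then a else undefined}"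
      by (auto simp: walks_def PiE_iff extensional_def)
    then have "card (walks G 0 a a) \<le> card {\<lambda>i. if i = (0::nat) then a else undefined}"
      by (intro card_mono) auto
    then show ?thesis using True by simp
  next
    case False
    then have "walks G 0 a d = {}" by (auto simp: walks_def)
    then show ?thesis by simp
  qed
  have "card (walks G 1 a b) \<le> card (offdiag_common G a b)" if "a \<in> vertices G" for a b
  proof -
    have "card (walks G 1 a b) \<le> (\<Sum>d\<in>vertices G. card (walks G 0 a d) * card (offdiag_common G d b))"
      using card_walks_Suc[OF G, of 0] by simp
    also have "\<dots> \<le> (\<Sum>d\<in>vertices G. (if d = a then 1 else 0) * card (offdiag_common G d b))"
      by (intro sum_mono mult_right_mono w0) simp
    also have "\<dots> = (\<Sum>d\<in>vertices G. if d = a then card (offdiag_common G d b) else 0)"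
      by (rule sum.cong) auto
    also have "\<dots> = card (offdiag_common G a b)" using that fin by simp
    finally show ?thesis .
  qed
  then show ?case
    unfolding codegree_energy_eq[OF G] by (simp add: sum_mono power_mono)
next
  case (Suc j)
  let ?V = "vertices G" and ?w = "\<lambda>j a b. card (walks G j a b)" and ?f = "\<lambda>a b. card (offdiag_common G a b)"
  have "(\<Sum>a\<in>?V. \<Sum>b\<in>?V. (?w (Suc (Suc j)) a b)\<^sup>2)
      \<le> (\<Sum>a\<in>?V. \<Sum>b\<in>?V. (\<Sum>d\<in>?V. (?w (Suc j) a d)\<^sup>2) * (\<Sum>d\<in>?V. (?f d b)\<^sup>2))"
  proof (intro sum_mono)
    fix a b
    have "(?w (Suc (Suc j)) a b)\<^sup>2 \<le> (\<Sum>d\<in>?V. ?w (Suc j) a d * ?f d b)\<^sup>2"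
      by (intro power_mono card_walks_Suc[OF G]) simp
    also have "\<dots> \<le> (\<Sum>d\<in>?V. (?w (Suc j) a d)\<^sup>2) * (\<Sum>d\<in>?V. (?f d b)\<^sup>2)"
      by (rule sum_mult_squared_le)
    finally show "(?w (Suc (Suc j)) a b)\<^sup>2 \<le> (\<Sum>d\<in>?V. (?w (Suc j) a d)\<^sup>2) * (\<Sum>d\<in>?V. (?f d b)\<^sup>2)" .
  qed
  also have "\<dots> = (\<Sum>a\<in>?V. \<Sum>d\<in>?V. (?w (Suc j) a d)\<^sup>2) * (\<Sum>b\<in>?V. \<Sum>d\<in>?V. (?f d b)\<^sup>2)"
    by (simp add: sum_product)
  also have "(\<Sum>b\<in>?V. \<Sum>d\<in>?V. (?f d b)\<^sup>2) = codegree_energy G"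
    unfolding codegree_energy_eq[OF G] by (rule sum.swap)
  also have "(\<Sum>a\<in>?V. \<Sum>d\<in>?V. (?w (Suc j) a d)\<^sup>2) * codegree_energy G
      \<le> codegree_energy G ^ Suc j * codegree_energy G"
    by (rule mult_right_mono[OF Suc.IH]) simp
  finally show ?case by (simp add: mult.commute)
qed

text \<open>The vertex at position \<open>2 * l - 1\<close> closes a walk through all the others.
  Cauchy-Schwarz over the endpoints of this walk pairs it with their common neighbourhood.\<close>

lemma card_embeddings_even:
  assumes G: "simple_graph G" and l: "2 \<le> l"
  shows "(card (embeddings (2 * l) G))\<^sup>2 \<le> codegree_energy G ^ l"
proof -
  let ?V = "vertices G"
  define j where "j = l - 1"
  have lj: "2 * l = Suc (Suc (2 * j))" "1 \<le> j" using l by (auto simp: j_def)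
  have fin: "finite ?V" using G by (simp add: simple_graph_def)
  let ?S = "SIGMA p:?V \<times> ?V. walks G j (fst p) (snd p) \<times> offdiag_common G (fst p) (snd p)"
  let ?g = "\<lambda>(p, v, x). v(Suc (2 * j) := x)"
  have finc: "finite (offdiag_common G a b)" for a b by (simp add: offdiag_common_def finite_common[OF G])
  then have finS: "finite ?S" using fin finite_walks[OF fin] by (intro finite_SigmaI) auto
  have "embeddings (2 * l) G \<subseteq> ?g ` ?S"
  proof
    fix w assume w: "w \<in> embeddings (2 * l) G"
    let ?v = "restrict w {..2 * j}" and ?p = "(w 0, w (2 * j))"
    have wV: "w \<in> {..<Suc (Suc (2 * j))} \<rightarrow>\<^sub>E ?V" and inj: "inj_on w {..<Suc (Suc (2 * j))}"
      and adj: "\<And>i. i < Suc (Suc (2 * j)) \<Longrightarrow> {w i, w (Suc i mod Suc (Suc (2 * j)))} \<in> uedges G"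
      using w by (auto simp: embeddings_def cycle_edge_def lj)
    have mem: "w i \<in> ?V" if "i \<le> Suc (2 * j)" for i using wV that by (auto simp: PiE_iff)
    have dist: "w (2 * i) \<noteq> w (2 * i + 2)" if "i < j" for i
      using inj_on_eq_iff[OF inj, of "2 * i" "2 * i + 2"] that by simp
    have "{w i, w (Suc i)} \<in> uedges G" if "i < 2 * j" for i using adj[of i] that by simp
    then have "?v \<in> walks G j (w 0) (w (2 * j))"
      using mem dist by (auto simp: walks_def)
    \<comment> \<open>The endpoints of the walk are distinct because \<open>j \<ge> 1\<close>, which
      is where \<open>l \<ge> 2\<close> enters.\<close>
    moreover have "w 0 = w (2 * j) \<longleftrightarrow> 0 = 2 * j" by (rule inj_on_eq_iff[OF inj]) auto
    then have "w (Suc (2 * j)) \<in> offdiag_common G (w 0) (w (2 * j))"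
      using adj[of "2 * j"] adj[of "Suc (2 * j)"] lj(2)
      by (simp add: offdiag_common_def common_def nbrs_def insert_commute)
    moreover have "w = ?g (?p, ?v, w (Suc (2 * j)))"
    proof
      fix i
      show "w i = ?g (?p, ?v, w (Suc (2 * j))) i"
        using wV by (cases "i \<le> 2 * j") (auto simp: PiE_iff extensional_def)
    qed
    ultimately show "w \<in> ?g ` ?S"
      using mem by (intro image_eqI[of _ _ "(?p, ?v, w (Suc (2 * j)))"]) auto
  qed
  then have "card (embeddings (2 * l) G) \<le> card (?g ` ?S)"
    by (intro card_mono) (use finS in auto)
  also have "\<dots> \<le> card ?S" by (rule card_image_le[OF finS])
  also have "\<dots> = (\<Sum>p\<in>?V \<times> ?V. card (walks G j (fst p) (snd p) \<times> offdiag_common G (fst p) (snd p)))"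
    by (rule card_SigmaI) (use fin finite_walks[OF fin] finc in auto)
  finally have "card (embeddings (2 * l) G)
      \<le> (\<Sum>p\<in>?V \<times> ?V. card (walks G j (fst p) (snd p)) * card (offdiag_common G (fst p) (snd p)))"
    by (simp add: card_cartesian_product)
  then have "(card (embeddings (2 * l) G))\<^sup>2
      \<le> (\<Sum>p\<in>?V \<times> ?V. card (walks G j (fst p) (snd p)) * card (offdiag_common G (fst p) (snd p)))\<^sup>2"
    by (rule power_mono) simp
  also have "\<dots> \<le> (\<Sum>p\<in>?V \<times> ?V. (card (walks G j (fst p) (snd p)))\<^sup>2) *
      (\<Sum>p\<in>?V \<times> ?V. (card (offdiag_common G (fst p) (snd p)))\<^sup>2)"
    by (rule sum_mult_squared_le)
  also have "\<dots> = (\<Sum>a\<in>?V. \<Sum>b\<in>?V. (card (walks G j a b))\<^sup>2) * codegree_energy G"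
    by (simp add: codegree_energy_eq[OF G] sum.cartesian_product case_prod_beta)
  also have "\<dots> \<le> codegree_energy G ^ j * codegree_energy G"
    using walks_energy[OF G, of "j - 1"] lj(2) by (intro mult_right_mono) auto
  also have "\<dots> = codegree_energy G ^ l"
  proof -
    have "l = Suc j" using l by (simp add: j_def)
    then show ?thesis by (simp add: mult.commute)
  qed
  finally show ?thesis .
qed

lemma ex_even_upper:
  assumes "2 \<le> k" "2 \<le> l"
  shows "ex_rainbow n (cycle_graph (2 * l)) (cycle_graph (2 * k)) \<le> (18 * k) ^ l * n ^ l"
proof (rule ex_rainbow_cycle_upper)
  fix G :: "nat ugraph" and c
  assume G: "simple_graph G" "card (vertices G) = n" "proper_edge_coloring G c"
    "\<not> has_rainbow_cycle (2 * k) G c"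
  have "(card (embeddings (2 * l) G))\<^sup>2 \<le> codegree_energy G ^ l"
    by (rule card_embeddings_even[OF G(1) assms(2)])
  also have "\<dots> \<le> (308 * k\<^sup>2 * n\<^sup>2) ^ l"
    using codegree_energy_le[OF G(1,3) assms(1) G(4)] G(2) by (intro power_mono) auto
  \<comment> \<open>\<open>308 \<le> 18 * 18\<close>.\<close>
  also have "\<dots> \<le> ((18 * k * n)\<^sup>2) ^ l"
    by (intro power_mono) (auto simp: power_mult_distrib)
  also have "\<dots> = ((18 * k) ^ l * n ^ l)\<^sup>2"
    unfolding power_mult_distrib[symmetric] by (metis mult.commute power_mult)
  finally show "card (embeddings (2 * l) G) \<le> (18 * k) ^ l * n ^ l"
    by (rule power2_le_imp_le) simp
qed (use assms in auto)

section \<open>Coincidences of colours on cycles\<close>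

lemma coincident_disjoint:
  assumes "proper_edge_coloring G c" "3 \<le> m" "v \<in> embeddings m G" "i < m" "j < m" "i \<noteq> j"
    "c (cycle_edge m v i) = c (cycle_edge m v j)"
  shows "{i, Suc i mod m} \<inter> {j, Suc j mod m} = {}"
proof (rule ccontr)
  assume "{i, Suc i mod m} \<inter> {j, Suc j mod m} \<noteq> {}"
  then have meet: "cycle_edge m v i \<inter> cycle_edge m v j \<noteq> {}" by (auto simp: cycle_edge_def)
  have "inj_on v {..<m}" and e: "cycle_edge m v i \<in> uedges G" "cycle_edge m v j \<in> uedges G"
    using assms by (auto simp: embeddings_def)
  then have "cycle_edge m v i \<noteq> cycle_edge m v j"
    using inj_on_eq_iff[OF inj_on_cycle_edge[OF assms(2)], of v i j] assms by auto
  then show False using assms(1,7) e meet unfolding proper_edge_coloring_def by metis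
qed

text \<open>The other end of the edge is common to both cycles, and a proper colouring has only one
  edge of the given colour there.\<close>

lemma coincidence_determines:
  assumes "proper_edge_coloring G c" "v \<in> embeddings m G" "w \<in> embeddings m G"
    and q: "q < m" "E = {q, Suc q mod m}" and xE: "x \<in> E"
    and col: "c (cycle_edge m v q) = c (cycle_edge m w q)"
    and agree: "\<And>z. z \<in> E \<Longrightarrow> z \<noteq> x \<Longrightarrow> v z = w z" and ne: "q \<noteq> Suc q mod m"
  shows "v x = w x"
proof -
  obtain z where z: "E = {z, x}" "z \<noteq> x"
  proof (cases "x = q")
    case True
    then show ?thesis using that[of "Suc q mod m"] ne q(2) by (simp add: insert_commute)
  next
    case False
    then have "x = Suc q mod m" using xE q(2) by blast
    then show ?thesis using that[of q] ne q(2) by simp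
  qed
  have "v z = w z" using z agree[of z] by simp
  then have "v ` E = {v z, v x}" "w ` E = {v z, w x}" by (simp_all add: z(1))
  moreover have "cycle_edge m v q = v ` E" "cycle_edge m w q = w ` E"
    unfolding q(2) by (simp_all add: cycle_edge_def)
  ultimately have "cycle_edge m v q = {v z, v x}" "cycle_edge m w q = {v z, w x}" by simp_all
  moreover have "cycle_edge m v q \<in> uedges G" "cycle_edge m w q \<in> uedges G"
    using assms(2,3) q(1) by (auto simp: embeddings_def)
  ultimately show ?thesis
    using inj_onD[OF proper_inj_nbrs[OF assms(1), of "v z"], of "v x" "w x"] col
    by (simp add: nbrs_def)
qed

definition coincidences :: "nat \<Rightarrow> ('a set \<Rightarrow> nat) \<Rightarrow> (nat \<Rightarrow> 'a) \<Rightarrow> (nat \<times> nat) set" where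
  "coincidences m c v =
     {(i, j). i < j \<and> j < m \<and> c (cycle_edge m v i) = c (cycle_edge m v j)}"

lemma card_embeddings_by_fibres:
  assumes fin: "finite (vertices G)" and H: "H \<subseteq> embeddings m G"
    and xy: "x < m" "y < m" "x \<noteq> y"
    and fib: "\<And>u. card {v \<in> H. restrict v ({..<m} - {x, y}) = u} \<le> C"
  shows "card H \<le> C * card (vertices G) ^ (m - 2)"
proof -
  let ?r = "\<lambda>v. restrict v ({..<m} - {x, y})" and ?P = "({..<m} - {x, y}) \<rightarrow>\<^sub>E vertices G"
  have finH: "finite H" using H finite_embeddings[OF fin] finite_subset by blast
  have "card H \<le> C * card (?r ` H)" by (rule card_le_fibres[OF finH]) (rule fib)
  also have "card (?r ` H) \<le> card ?P"
  proof (rule card_mono)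
    have "?r v \<in> ?P" if "v \<in> H" for v
      using H that by (auto simp: embeddings_def restrict_PiE_iff intro: PiE_mem)
    then show "?r ` H \<subseteq> ?P" by blast
  qed (use fin in \<open>auto intro: finite_PiE\<close>)
  also have "card ?P = card (vertices G) ^ card ({..<m} - {x, y})" by (simp add: card_PiE)
  also have "card ({..<m} - {x, y}) = m - 2" using xy by (subst card_Diff_subset) auto
  finally show ?thesis by simp
qed

text \<open>Otherwise the two pairs of edges would be different perfect matchings of the same four
  positions, and their union would contain a cycle on at most four positions. The cyclic order has
  at least five.\<close>

lemma two_coincidences_position:
  fixes m p q r t :: nat
  assumes "5 \<le> m" "p < q" "q < m" "r < t" "t < m" "(p, q) \<noteq> (r, t)"
    "{p, Suc p mod m} \<inter> {q, Suc q mod m} = {}" "{r, Suc r mod m} \<inter> {t, Suc t mod m} = {}"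
  shows "\<exists>y \<in> {r, Suc r mod m} \<union> {t, Suc t mod m}. y \<notin> {p, Suc p mod m} \<union> {q, Suc q mod m}"
proof -
  have "Suc p mod m = Suc p" "Suc r mod m = Suc r" using assms by auto
  moreover have "Suc q mod m = (if Suc q = m then 0 else Suc q)"
    "Suc t mod m = (if Suc t = m then 0 else Suc t)" using assms by auto
  ultimately show ?thesis using assms by (auto split: if_splits)
qed

text \<open>Take \<open>y\<close> on the second coincidence but off the first, and forget positions
  \<open>q\<close> and \<open>y\<close>. The edge with index \<open>p\<close> is intact, so its
  colour restores position \<open>q\<close>. Then only \<open>y\<close> is missing, and the colour
  of the other edge of the second pair restores it.\<close>

lemma card_several_coincidences:
  assumes G: "simple_graph G" and c: "proper_edge_coloring G c" and m: "5 \<le> m"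
    and pr: "(p, q) \<in> R" "(r, t) \<in> R" "(p, q) \<noteq> (r, t)"
  shows "card {v \<in> embeddings m G. coincidences m c v = R} \<le> card (vertices G) ^ (m - 2)"
proof (cases "{v \<in> embeddings m G. coincidences m c v = R} = {}")
  case False
  let ?H = "{v \<in> embeddings m G. coincidences m c v = R}"
  let ?s = "\<lambda>i. Suc i mod m"
  have ne: "i \<noteq> Suc i mod m" if "i < m" for i using m that by (cases "Suc i = m") auto
  have Hp: "p < q \<and> q < m \<and> c (cycle_edge m v p) = c (cycle_edge m v q)"
    and Hr: "r < t \<and> t < m \<and> c (cycle_edge m v r) = c (cycle_edge m v t)" if "v \<in> ?H" for v
    using that pr by (auto simp: coincidences_def)
  from False obtain v0 where v0: "v0 \<in> ?H" by blast
  have lt: "p < q" "q < m" "r < t" "t < m" using Hp[OF v0] Hr[OF v0] by auto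
  have disj: "{p, ?s p} \<inter> {q, ?s q} = {}" "{r, ?s r} \<inter> {t, ?s t} = {}"
    using coincident_disjoint[OF c, of m v0 p q] coincident_disjoint[OF c, of m v0 r t]
      Hp[OF v0] Hr[OF v0] v0 m by auto
  obtain y where y: "y \<in> {r, ?s r} \<union> {t, ?s t}" "y \<notin> {p, ?s p} \<union> {q, ?s q}"
    using two_coincidences_position[OF m lt(1,2,3,4) pr(3) disj] by blast
  have ym: "y < m" using y(1) lt m by auto
  have "card ?H \<le> 1 * card (vertices G) ^ (m - 2)"
  proof (rule card_embeddings_by_fibres)
    show "q < m" "y < m" "q \<noteq> y" using lt ym y by auto
    fix u
    show "card {v \<in> ?H. restrict v ({..<m} - {q, y}) = u} \<le> 1"
    proof (rule card_le_Suc0_iff_eq[THEN iffD2, unfolded One_nat_def[symmetric]])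
      show "\<forall>v\<in>{v \<in> ?H. restrict v ({..<m} - {q, y}) = u}.
          \<forall>w\<in>{v \<in> ?H. restrict v ({..<m} - {q, y}) = u}. v = w"
      proof (intro ballI)
        fix v w assume vw: "v \<in> {v \<in> ?H. restrict v ({..<m} - {q, y}) = u}"
          "w \<in> {v \<in> ?H. restrict v ({..<m} - {q, y}) = u}"
        then have emb: "v \<in> embeddings m G" "w \<in> embeddings m G" and vH: "v \<in> ?H" "w \<in> ?H" by auto
        have "restrict v ({..<m} - {q, y}) z = restrict w ({..<m} - {q, y}) z" for z using vw by simp
        then have off: "v z = w z" if "z < m" "z \<noteq> q" "z \<noteq> y" for z
          using that by (metis DiffI insertE lessThan_iff restrict_apply' singletonD)
        have sm: "?s i < m" for i using m by simp
        have "v z = w z" if "z \<in> {p, ?s p}" for z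
          using that off[of z] y(2) disj(1) lt sm by auto
        then have "cycle_edge m v p = cycle_edge m w p" by (simp add: cycle_edge_def)
        then have col: "c (cycle_edge m v q) = c (cycle_edge m w q)" using Hp[OF vH(1)] Hp[OF vH(2)] by simp
        have "v q = w q"
          by (rule coincidence_determines[OF c emb lt(2) refl _ col _ ne[OF lt(2)]])
            (use off y(2) sm lt in auto)
        then have off': "v z = w z" if "z < m" "z \<noteq> y" for z using off that by metis
        have "v y = w y"
        proof (cases "y \<in> {t, ?s t}")
          case True
          then have "cycle_edge m v r = cycle_edge m w r"
            using disj(2) off'[of r] off'[of "?s r"] lt sm by (auto simp: cycle_edge_def)
          then have "c (cycle_edge m v t) = c (cycle_edge m w t)" using Hr[OF vH(1)] Hr[OF vH(2)] by simp
          then show ?thesis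
            by (rule coincidence_determines[OF c emb lt(4) refl True _ _ ne[OF lt(4)]])
              (use off' sm lt in auto)
        next
          case False
          then have yr: "y \<in> {r, ?s r}" using y(1) by auto
          have rm: "r < m" using lt by simp
          have "cycle_edge m v t = cycle_edge m w t"
            using False off'[of t] off'[of "?s t"] lt sm by (auto simp: cycle_edge_def)
          then have "c (cycle_edge m v r) = c (cycle_edge m w r)" using Hr[OF vH(1)] Hr[OF vH(2)] by simp
          then show ?thesis
            by (rule coincidence_determines[OF c emb rm refl yr _ _ ne[OF rm]])
              (use off' sm rm in auto)
        qed
        then have "v z = w z" if "z \<in> {..<m}" for z using off' that by (cases "z = y") auto
        then show "v = w"
          using emb by (intro PiE_ext[of v "{..<m}" "\<lambda>_. vertices G" w]) (auto simp: embeddings_def)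
      qed
      show "finite {v \<in> ?H. restrict v ({..<m} - {q, y}) = u}"
        using finite_embeddings[of G m] G by (simp add: simple_graph_def)
    qed
  qed (use G in \<open>auto simp: simple_graph_def\<close>)
  then show ?thesis by simp
next
  case True
  show ?thesis unfolding True by simp
qed

lemma card_vimage_inj_le_1:
  assumes "inj_on g W"
  shows "card {w \<in> W. g w = a} \<le> 1"
proof (cases "finite {w \<in> W. g w = a}")
  case True
  then show ?thesis
    using assms card_le_Suc0_iff_eq[OF True] by (auto simp: inj_on_def)
qed simp

text \<open>If the two endpoints \<open>x\<close>, \<open>y\<close> of the coincident edges had many completions, then combining
  the value at \<open>x\<close> of one of them with the value at \<open>y\<close> of another would give a rainbow cycle.\<close>

lemma card_single_coincidence:
  assumes G: "simple_graph G" and c: "proper_edge_coloring G c" and m: "5 \<le> m"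
    and no: "\<not> has_rainbow_cycle m G c"
  shows "card {v \<in> embeddings m G. coincidences m c v = {(p, q)}} \<le> 5 * card (vertices G) ^ (m - 2)"
proof (cases "{v \<in> embeddings m G. coincidences m c v = {(p, q)}} = {}")
  case False
  let ?H = "{v \<in> embeddings m G. coincidences m c v = {(p, q)}}"
  let ?s = "\<lambda>i. Suc i mod m"
  let ?col = "\<lambda>v i. c (cycle_edge m v i)"
  \<comment> \<open>The later endpoints of the two coincident edges are forgotten. As these edges
    are disjoint, this choice keeps \<open>x\<close> and \<open>y\<close> non-adjacent.\<close>
  define x where "x = ?s p"
  define y where "y = ?s q"
  have ne: "i \<noteq> ?s i" if "i < m" for i using m that by (cases "Suc i = m") auto
  have sm: "?s i < m" for i using m by simp
  have Hp: "p < q \<and> q < m \<and> ?col v p = ?col v q" if "v \<in> ?H" for v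
  proof -
    have "(p, q) \<in> coincidences m c v" using that by simp
    then show ?thesis by (simp add: coincidences_def)
  qed
  have only: "(i = p \<and> j = q) \<or> (i = q \<and> j = p)"
    if "v \<in> ?H" "i < m" "j < m" "i \<noteq> j" "?col v i = ?col v j" for v i j
  proof -
    have "(i, j) \<in> coincidences m c v \<or> (j, i) \<in> coincidences m c v"
      using that(2-5) by (auto simp: coincidences_def)
    then show ?thesis using that(1) by auto
  qed
  from False obtain v0 where v0: "v0 \<in> ?H" by blast
  have lt: "p < q" "p < m" "q < m" "x < m" "y < m" using Hp[OF v0] sm by (auto simp: x_def y_def)
  have disj: "{p, x} \<inter> {q, y} = {}"
    using coincident_disjoint[OF c, of m v0 p q] Hp[OF v0] v0 m by (auto simp: x_def y_def)
  have px: "p \<noteq> x" "q \<noteq> y" "y \<noteq> ?s y" using ne lt by (auto simp: x_def y_def)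
  have syx: "?s y \<noteq> x"
    using Suc_mod_inject[of y m p] disj lt by (auto simp: x_def)
  have "card ?H \<le> 5 * card (vertices G) ^ (m - 2)"
  proof (rule card_embeddings_by_fibres)
    show "x < m" "y < m" "x \<noteq> y" using lt disj by auto
    fix u
    define W where "W = {v \<in> ?H. restrict v ({..<m} - {x, y}) = u}"
    have finW: "finite W"
      using finite_embeddings[of G m] G by (simp add: W_def simple_graph_def)
    have W: "w \<in> ?H" "w \<in> embeddings m G" if "w \<in> W" for w using that by (auto simp: W_def)
    have off: "v z = w z" if "v \<in> W" "w \<in> W" "z < m" "z \<noteq> x" "z \<noteq> y" for v w z
    proof -
      have "restrict v ({..<m} - {x, y}) z = restrict w ({..<m} - {x, y}) z"
        using that by (simp add: W_def)
      then show ?thesis using that by simp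
    qed
    \<comment> \<open>The common colour of the coincident edges is the only freedom: with it,
      \<open>v q\<close> determines \<open>v y\<close> and \<open>v p\<close> determines
      \<open>v x\<close>.\<close>
    have eqI: "v = w" if "v \<in> W" "w \<in> W" "?col v q = ?col w q" for v w
    proof -
      have vy: "v y = w y"
        by (rule coincidence_determines[OF c W(2)[OF that(1)] W(2)[OF that(2)] lt(3) refl _ that(3) _ ne[OF lt(3)]])
          (use off[OF that(1,2)] lt disj px in \<open>auto simp: y_def[symmetric]\<close>)
      have col: "?col v p = ?col w p"
        using Hp[OF W(1)[OF that(1)]] Hp[OF W(1)[OF that(2)]] that(3) by simp
      have vx: "v x = w x"
        by (rule coincidence_determines[OF c W(2)[OF that(1)] W(2)[OF that(2)] lt(2) refl _ col _ ne[OF lt(2)]])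
          (use off[OF that(1,2)] lt disj px in \<open>auto simp: x_def[symmetric]\<close>)
      have "v z = w z" if "z \<in> {..<m}" for z
        using off[OF \<open>v \<in> W\<close> \<open>w \<in> W\<close>, of z] vx vy that by (cases "z = x"; cases "z = y") auto
      then show "v = w"
        using W(2)[OF that(1)] W(2)[OF that(2)]
        by (intro PiE_ext[of v "{..<m}" "\<lambda>_. vertices G" w]) (auto simp: embeddings_def)
    qed
    have injy: "inj_on (\<lambda>w. w y) W"
    proof (rule inj_onI)
      fix v w assume vw: "v \<in> W" "w \<in> W" "v y = w y"
      then have "cycle_edge m v q = cycle_edge m w q"
        using off[OF vw(1,2), of q] lt disj px by (auto simp: cycle_edge_def y_def)
      then show "v = w" using eqI[OF vw(1,2)] by simp
    qed
    have injq: "inj_on (\<lambda>w. ?col w q) W" using eqI by (intro inj_onI)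
    have injsy: "inj_on (\<lambda>w. ?col w y) W"
    proof (rule inj_onI)
      fix v w assume vw: "v \<in> W" "w \<in> W" "?col v y = ?col w y"
      have "v y = w y"
        by (rule coincidence_determines[OF c W(2)[OF vw(1)] W(2)[OF vw(2)] lt(5) refl _ vw(3) _ ne[OF lt(5)]])
          (use off[OF vw(1,2)] sm syx in auto)
      then show "v = w" using injy vw by (auto simp: inj_on_def)
    qed
    show "card {v \<in> ?H. restrict v ({..<m} - {x, y}) = u} \<le> 5"
    proof (cases "W = {}")
      case False
      then obtain w0 where w0: "w0 \<in> W" by blast
      \<comment> \<open>Either \<open>w\<close> is \<open>w0\<close>, or the mixed sequence repeats
        a vertex, or one of its two new edges has the colour of an edge of \<open>w0\<close> at
        position \<open>x\<close>. Each of the five equations admits at most one \<open>w\<close>,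
        whence the constant 5.\<close>
      have "w = w0 \<or> w y = w0 x \<or> ?col w q = ?col w0 x \<or> ?col w y = ?col w0 p \<or> ?col w y = ?col w0 x"
        if w: "w \<in> W" for w
      proof (rule ccontr)
        assume contra: "\<not> ?thesis"
        \<comment> \<open>Position \<open>y\<close> comes from \<open>w\<close>, everything else,
          including \<open>x\<close>, from \<open>w0\<close>. Only the edges with index
          \<open>q\<close> and \<open>y\<close> change, and they agree with those of
          \<open>w\<close>.\<close>
        define h where "h = w0(y := w y)"
        have hw: "cycle_edge m h i = cycle_edge m w i" if "i \<in> {q, y}" for i
        proof -
          have "h q = w q" using off[OF w0 w, of q] lt disj px by (auto simp: h_def)
          moreover have "h y = w y" by (simp add: h_def)
          moreover have "h (?s y) = w (?s y)"
            using off[OF w0 w, of "?s y"] sm[of y] syx px(3) by (simp add: h_def)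
          ultimately show ?thesis using that unfolding cycle_edge_def y_def by auto
        qed
        have h0: "cycle_edge m h i = cycle_edge m w0 i" if "i < m" "i \<notin> {q, y}" for i
        proof -
          have "?s i \<noteq> y" using Suc_mod_inject[of i m q] that lt by (auto simp: y_def)
          then show ?thesis using that by (simp add: cycle_edge_def h_def)
        qed
        have inj0: "inj_on w0 {..<m}" and injw: "inj_on w {..<m}"
          using W(2)[OF w0] W(2)[OF w] by (auto simp: embeddings_def)
        have hne: "w y \<noteq> w0 z" if "z < m" "z \<noteq> y" for z
        proof (cases "z = x")
          case False
          then have "w0 z = w z" using off[OF w0 w] that by simp
          then show ?thesis using inj_on_eq_iff[OF injw, of y z] that lt by auto
        qed (use contra in simp)
        have "inj_on h {..<m}"
          using inj0 hne unfolding h_def inj_on_def by (metis fun_upd_apply lessThan_iff)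
        moreover have "h \<in> {..<m} \<rightarrow>\<^sub>E vertices G"
          using W(2)[OF w0] W(2)[OF w] lt by (auto simp: h_def embeddings_def PiE_iff extensional_def)
        moreover have "cycle_edge m h i \<in> uedges G" if "i < m" for i
          using h0[of i] hw[of i] W(2)[OF w0] W(2)[OF w] that
          by (cases "i \<in> {q, y}") (auto simp: embeddings_def)
        ultimately have "h \<in> embeddings m G" by (simp add: embeddings_def)
        then have "\<not> inj_on (?col h) {..<m}" using no by (auto simp: has_rainbow_cycle_def)
        then obtain i j where ij: "i < m" "j < m" "i \<noteq> j" "?col h i = ?col h j"
          by (auto simp: inj_on_def)
        \<comment> \<open>A collision between a changed edge, coloured as in \<open>w\<close>, and
          an edge of \<open>w0\<close>. If the latter avoids position \<open>x\<close> it belongs to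
          \<open>w\<close> as well, where \<open>(p, q)\<close> is the only coincidence; the
          remaining cases are the excluded equations.\<close>
        have mixed: False if "i \<in> {q, y}" "j < m" "j \<notin> {q, y}" "?col h i = ?col h j" for i j
        proof -
          have iqy: "i \<in> {q, y}" by (rule that(1))
          then have im: "i < m" using lt by auto
          have eq: "?col w i = ?col w0 j" using that h0[of j] hw[of i] by simp
          have "j \<in> {p, x}"
          proof (rule ccontr)
            assume jpx: "j \<notin> {p, x}"
            have "?s j \<noteq> x" "?s j \<noteq> y"
              using Suc_mod_inject[of j m p] Suc_mod_inject[of j m q] jpx that lt
              by (auto simp: x_def y_def)
            then have "cycle_edge m w0 j = cycle_edge m w j"
              using off[OF w0 w, of j] off[OF w0 w, of "?s j"] jpx that sm by (simp add: cycle_edge_def)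
            then have "?col w i = ?col w j" using eq by simp
            then show False using only[OF W(1)[OF w] im that(2)] that jpx by auto
          qed
          then consider "i = q" "j = p" | "i = q" "j = x" | "i = y" "j = p" | "i = y" "j = x"
            using iqy by blast
          then show False
          proof cases
            case 1
            then have "?col w q = ?col w0 q" using eq Hp[OF W(1)[OF w0]] by simp
            then show False using eqI[OF w w0] contra by simp
          qed (use eq contra in auto)
        qed
        show False
        proof (cases "i \<in> {q, y}"; cases "j \<in> {q, y}")
          assume "i \<in> {q, y}" "j \<in> {q, y}"
          then have "?col w i = ?col w j" using ij(4) hw by simp
          then show False
            using only[OF W(1)[OF w] ij(1-3)] \<open>i \<in> {q, y}\<close> \<open>j \<in> {q, y}\<close> disj by auto
        next
          assume "i \<notin> {q, y}" "j \<notin> {q, y}"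
          then have "?col w0 i = ?col w0 j" using ij h0 by simp
          then show False
            using only[OF W(1)[OF w0] ij(1-3)] \<open>i \<notin> {q, y}\<close> \<open>j \<notin> {q, y}\<close> by auto
        qed (use mixed[of i j] mixed[of j i] ij in auto)
      qed
      then have "W \<subseteq> {w0} \<union> ({w \<in> W. w y = w0 x} \<union> ({w \<in> W. ?col w q = ?col w0 x} \<union>
          ({w \<in> W. ?col w y = ?col w0 p} \<union> {w \<in> W. ?col w y = ?col w0 x})))" (is "_ \<subseteq> {w0} \<union> (?A \<union> (?B \<union> (?C \<union> ?D)))")
        by blast
      then have "card W \<le> card ({w0} \<union> (?A \<union> (?B \<union> (?C \<union> ?D))))"
        by (rule card_mono[rotated]) (use finW in auto)
      also have "\<dots> \<le> card {w0} + (card ?A + (card ?B + (card ?C + card ?D)))"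
        by (intro order_trans[OF card_Un_le] add_mono order_refl)
      also have "\<dots> \<le> 5"
        using card_vimage_inj_le_1[OF injy, of "w0 x"] card_vimage_inj_le_1[OF injq, of "?col w0 x"]
          card_vimage_inj_le_1[OF injsy, of "?col w0 p"] card_vimage_inj_le_1[OF injsy, of "?col w0 x"]
        by simp
      finally show ?thesis unfolding W_def .
    next
      case True
      then show ?thesis unfolding W_def[symmetric] by simp
    qed
  qed (use G in \<open>auto simp: simple_graph_def\<close>)
  then show ?thesis .
next
  case True
  show ?thesis unfolding True by simp
qed

text \<open>Embeddings are sorted by their full set of coincidences. The empty set would mean a
  rainbow cycle, and there are at most \<open>2 ^ (m * m)\<close> sets.\<close>

lemma ex_same_cycle_upper:
  assumes m: "5 \<le> m"
  shows "ex_rainbow n (cycle_graph m) (cycle_graph m) \<le> 2 ^ (m * m) * 5 * n ^ (m - 2)"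
proof (rule ex_rainbow_cycle_upper)
  fix G :: "nat ugraph" and c
  assume G: "simple_graph G" "card (vertices G) = n" "proper_edge_coloring G c"
    "\<not> has_rainbow_cycle m G c"
  let ?H = "\<lambda>R. {v \<in> embeddings m G. coincidences m c v = R}"
  let ?T = "Pow ({..<m} \<times> {..<m})"
  have bound: "card (?H R) \<le> 5 * n ^ (m - 2)" for R
  proof -
    consider "R = {}" | p q where "R = {(p, q)}"
      | p q r t where "(p, q) \<in> R" "(r, t) \<in> R" "(p, q) \<noteq> (r, t)"
      by (metis (full_types) insertI1 is_singletonI' is_singleton_def surj_pair)
    then show ?thesis
    proof cases
      case 1
      have "coincidences m c v \<noteq> {}" if "v \<in> embeddings m G" for v
      proof -
        have "\<not> inj_on (\<lambda>i. c (cycle_edge m v i)) {..<m}"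
          using that G(4) by (auto simp: has_rainbow_cycle_def)
        then obtain i j where "i < m" "j < m" "i < j" "c (cycle_edge m v i) = c (cycle_edge m v j)"
          unfolding inj_on_def by (metis lessThan_iff linorder_neqE_nat)
        then show ?thesis by (auto simp: coincidences_def)
      qed
      then have empty: "?H R = {}" using 1 by auto
      show ?thesis unfolding empty by simp
    next
      case (2 p q)
      then show ?thesis using card_single_coincidence[OF G(1,3) m G(4)] G(2) by simp
    next
      case (3 p q r t)
      then show ?thesis using card_several_coincidences[OF G(1,3) m 3] G(2) by simp
    qed
  qed
  have "coincidences m c v \<in> ?T" for v by (auto simp: coincidences_def)
  then have "embeddings m G \<subseteq> (\<Union>R\<in>?T. ?H R)" by blast
  then have "card (embeddings m G) \<le> card (\<Union>R\<in>?T. ?H R)"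
    by (rule card_mono[rotated]) (use finite_embeddings[of G m] G(1) in \<open>auto simp: simple_graph_def\<close>)
  also have "\<dots> \<le> (\<Sum>R\<in>?T. card (?H R))" by (rule card_UN_le) simp
  also have "\<dots> \<le> (\<Sum>R\<in>?T. 5 * n ^ (m - 2))" by (rule sum_mono) (rule bound)
  also have "\<dots> = 2 ^ (m * m) * 5 * n ^ (m - 2)" by (simp add: card_Pow card_cartesian_product)
  finally show "card (embeddings m G) \<le> 2 ^ (m * m) * 5 * n ^ (m - 2)" .
qed (use m in auto)

section \<open>Lower bound constructions\<close>

text \<open>One colour for \<open>M\<close> and a private colour for every other edge: a cycle fails
  to be rainbow exactly when it has two edges in \<open>M\<close>. For \<open>M = {}\<close> all
  cycles are rainbow.\<close>

definition matching_colour :: "nat set set \<Rightarrow> nat set \<Rightarrow> nat" where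
  "matching_colour M e = (if e \<in> M then 0 else Suc (set_encode e))"

lemma proper_matching_colour:
  assumes G: "simple_graph G"
    and M: "\<And>e e'. e \<in> M \<Longrightarrow> e' \<in> M \<Longrightarrow> e \<noteq> e' \<Longrightarrow> e \<inter> e' = {}"
  shows "proper_edge_coloring G (matching_colour M)"
  unfolding proper_edge_coloring_def
proof (intro ballI impI)
  fix e e' assume e: "e \<in> uedges G" "e' \<in> uedges G" "e \<noteq> e' \<and> e \<inter> e' \<noteq> {}"
  have "finite e" "finite e'" using e G by (auto simp: simple_graph_def intro: card_ge_0_finite)
  then have "set_encode e \<noteq> set_encode e'" using e inj_onD[OF inj_on_set_encode] by auto
  moreover have "e \<notin> M \<or> e' \<notin> M" using M e by blast
  ultimately show "matching_colour M e \<noteq> matching_colour M e'" by (auto simp: matching_colour_def)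
qed

lemma card_embeddings_ge:
  assumes "finite (vertices G)" "inj_on F A" "F ` A \<subseteq> embeddings m G"
  shows "card A \<le> card (embeddings m G)"
  by (rule card_inj_on_le[OF assms(2,3) finite_embeddings[OF assms(1)]])

lemma embeddingsI:
  assumes "\<And>i. i < m \<Longrightarrow> f i \<in> vertices G" "inj_on f {..<m}"
    "\<And>i. i < m \<Longrightarrow> {f i, f (Suc i mod m)} \<in> uedges G"
  shows "restrict f {..<m} \<in> embeddings m G"
proof -
  have "Suc i mod m < m" if "i < m" for i using that by simp
  then show ?thesis using assms by (auto simp: embeddings_def cycle_edge_def inj_on_restrict_eq)
qed

lemma odd_cycle_not_alternating:
  fixes P :: "'a \<Rightarrow> bool"
  assumes "odd m" "\<And>i. i < m \<Longrightarrow> P (v i) \<noteq> P (v (Suc i mod m))"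
  shows False
proof -
  have alt: "i < m \<longrightarrow> P (v i) = (P (v 0) = even i)" for i
  proof (induction i)
    case (Suc i)
    show ?case
    proof
      assume i: "Suc i < m"
      then have "P (v i) \<noteq> P (v (Suc i))" using assms(2)[of i] by simp
      then show "P (v (Suc i)) = (P (v 0) = even (Suc i))" using Suc i by auto
    qed
  qed auto
  obtain j where "m = Suc (2 * j)" using assms(1) by (metis oddE Suc_eq_plus1)
  then show False using assms(2)[of "2 * j"] alt[of "2 * j"] by simp
qed

section \<open>Odd cycles: a blow-up with two matchings\<close>

text \<open>Blow-up of \<open>C_m\<close> whose parts are the residue classes modulo
  \<open>m\<close>. Classes 0 and 1, and likewise 2 and 3, are joined by a matching only.\<close>

definition blowup :: "nat \<Rightarrow> nat \<Rightarrow> nat ugraph" where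
  "blowup m n = ({..<n}, {{a, b} | a b. a < n \<and> b < n \<and> b mod m = Suc a mod m \<and>
     (a mod m \<in> {0, 2} \<longrightarrow> b = Suc a)})"

text \<open>Without the edges between two consecutive residue classes the blow-up is bipartite, so an
  odd cycle crosses both of its matchings.\<close>

lemma blowup_crossing:
  assumes m: "odd m" "5 \<le> m" and v: "v \<in> embeddings m (blowup m n)" and j: "j \<in> {0, 2}"
  shows "\<exists>i<m. \<exists>a. cycle_edge m v i = {a, Suc a} \<and> a mod m = j"
proof (rule ccontr)
  assume no: "\<not> ?thesis"
  \<comment> \<open>The shift moves class \<open>j + 1\<close> to 0 and class \<open>j\<close> to
    \<open>m - 1\<close>. Without the edges from class \<open>j\<close> to class
    \<open>j + 1\<close> nothing wraps around, so the parity of \<open>pos\<close> alternates along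
    the cycle.\<close>
  define pos where "pos x = (x + (m - 1 - j)) mod m" for x
  have step: "even (pos b) \<noteq> even (pos a)" if "b mod m = Suc a mod m" "a mod m \<noteq> j" for a b
  proof -
    have "pos b = Suc (a + (m - 1 - j)) mod m"
      unfolding pos_def using mod_add_cong[OF that(1) refl, of "m - 1 - j"] by simp
    then have "pos b = (if Suc (pos a) = m then 0 else Suc (pos a))"
      unfolding pos_def[of a] by (simp only: mod_Suc)
    moreover have "Suc (pos a) \<noteq> m"
    proof -
      have am: "a mod m < m" using m by simp
      have eq: "pos a = (a mod m + (m - 1 - j)) mod m" by (simp add: pos_def mod_add_left_eq)
      show ?thesis
      proof (cases "a mod m < j")
        case True
        then have "a mod m + (m - 1 - j) < m - 1" using j m by auto
        then have "(a mod m + (m - 1 - j)) mod m = a mod m + (m - 1 - j)" by (intro mod_less) linarith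
        then show ?thesis using eq \<open>_ < m - 1\<close> by linarith
      next
        case False
        then have "a mod m + (m - 1 - j) = (a mod m - 1 - j) + m" using that(2) am by linarith
        then have "pos a = (a mod m - 1 - j) mod m" unfolding eq by simp
        also have "\<dots> = a mod m - 1 - j" using am by (intro mod_less) linarith
        finally show ?thesis using am m that(2) False by linarith
      qed
    qed
    ultimately have "pos b = Suc (pos a)" by simp
    then show ?thesis by simp
  qed
  have "even (pos (v i)) \<noteq> even (pos (v (Suc i mod m)))" if "i < m" for i
  proof -
    have "cycle_edge m v i \<in> uedges (blowup m n)" using v that by (simp add: embeddings_def)
    then obtain a b where ab: "cycle_edge m v i = {a, b}" "b mod m = Suc a mod m"
      "a mod m \<in> {0, 2} \<longrightarrow> b = Suc a" by (auto simp: blowup_def)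
    have "a mod m \<noteq> j"
    proof
      assume "a mod m = j"
      then have "b = Suc a" using ab(3) j by auto
      then have "cycle_edge m v i = {a, Suc a}" using ab(1) by simp
      then show False using no that \<open>a mod m = j\<close> by metis
    qed
    then have "even (pos b) \<noteq> even (pos a)" using step ab by blast
    moreover have "{v i, v (Suc i mod m)} = {a, b}" using ab by (simp add: cycle_edge_def)
    ultimately show ?thesis by (auto simp: doubleton_eq_iff)
  qed
  then show False by (rule odd_cycle_not_alternating[OF m(1), of "\<lambda>x. even (pos x)" v])
qed

lemma simple_blowup:
  assumes "5 \<le> m"
  shows "simple_graph (blowup m n)"
  unfolding simple_graph_def
proof (intro conjI ballI)
  fix e assume "e \<in> uedges (blowup m n)"
  then obtain a b where ab: "e = {a, b}" "a < n" "b < n" "b mod m = Suc a mod m"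
    by (auto simp: blowup_def)
  have "a \<noteq> b"
  proof
    assume "a = b"
    then have "a mod m = Suc a mod m" using ab(4) by simp
    then show False using assms by (auto simp: mod_Suc split: if_splits)
  qed
  then show "e \<subseteq> vertices (blowup m n)" "card e = 2" using ab by (auto simp: blowup_def)
qed (simp add: blowup_def)

text \<open>Every \<open>m\<close>-cycle crosses both matchings, which share a colour. Positions 1
  and 3 are the partners of positions 0 and 2; all positions except 1 and 3 choose freely among
  \<open>n div m\<close> vertices of their class.\<close>

lemma ex_odd_lower:
  assumes m: "odd m" "5 \<le> m"
  shows "(n div m) ^ (m - 2) \<le> m ^ m * ex_rainbow n (cycle_graph m) (cycle_graph m)"
proof -
  define N where "N = n div m"
  let ?G = "blowup m n"
  define M where "M = {{a, Suc a} | a. a mod m = 0 \<or> a mod m = 2}"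
  have G: "simple_graph ?G" by (rule simple_blowup[OF m(2)])
  have disj: "e \<inter> e' = {}" if in_M: "e \<in> M" "e' \<in> M" and ne: "e \<noteq> e'" for e e'
  proof -
    have M_D: "\<exists>a. e = {a, Suc a} \<and> (a mod m = 0 \<or> a mod m = 2)" if "e \<in> M" for e
      using that by (simp only: M_def mem_Collect_eq)
    obtain a b where ab: "e = {a, Suc a}" "e' = {b, Suc b}"
        "a mod m = 0 \<or> a mod m = 2" "b mod m = 0 \<or> b mod m = 2"
      using M_D[OF in_M(1)] M_D[OF in_M(2)] by (elim exE conjE) (rule that)
    have "Suc z mod m \<noteq> 0 \<and> Suc z mod m \<noteq> 2" if z: "z mod m = 0 \<or> z mod m = 2" for z
    proof -
      have "Suc z mod m = Suc (z mod m)" using z m(2) by (auto simp: mod_Suc)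
      then show ?thesis using z by auto
    qed
    from this[OF ab(3)] this[OF ab(4)] have "a \<noteq> Suc b" "b \<noteq> Suc a" using ab(3,4) by metis+
    moreover have "a \<noteq> b" using ne ab by blast
    ultimately have "a \<noteq> b" "a \<noteq> Suc b" "b \<noteq> Suc a" by simp_all
    then show ?thesis using ab by auto
  qed
  have "\<not> has_rainbow_cycle m ?G (matching_colour M)"
    unfolding has_rainbow_cycle_def
  proof (intro notI, elim bexE)
    fix v assume v: "v \<in> embeddings m ?G" "inj_on (\<lambda>i. matching_colour M (cycle_edge m v i)) {..<m}"
    obtain i a where i: "i < m" "cycle_edge m v i = {a, Suc a}" "a mod m = 0"
      using blowup_crossing[OF m v(1), of 0] by auto
    obtain j b where j: "j < m" "cycle_edge m v j = {b, Suc b}" "b mod m = 2"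
      using blowup_crossing[OF m v(1), of 2] by auto
    have "cycle_edge m v i \<in> M" "cycle_edge m v j \<in> M" using i j by (auto simp: M_def)
    then have "matching_colour M (cycle_edge m v i) = matching_colour M (cycle_edge m v j)"
      by (simp add: matching_colour_def)
    then have "i = j" using inj_onD[OF v(2)] i j by simp
    then have "{a, Suc a} = {b, Suc b}" using i j by simp
    then have "a = b" by (auto simp: doubleton_eq_iff)
    then show False using i j by simp
  qed
  then have upper: "card (embeddings m ?G) \<le> m ^ m * ex_rainbow n (cycle_graph m) (cycle_graph m)"
    using m proper_matching_colour[OF G disj]
    by (intro ex_rainbow_cycle_lower[OF _ _ G]) (auto simp: blowup_def)
  define \<rho> :: "nat \<Rightarrow> nat" where "\<rho> i = (if i = 1 then 0 else if i = 3 then 2 else i)" for i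
  define f where "f g i = m * g (\<rho> i) + i" for g :: "nat \<Rightarrow> nat" and i
  let ?A = "({..<m} - {1, 3}) \<rightarrow>\<^sub>E {..<N}"
  have \<rho>: "\<rho> i \<in> {..<m} - {1, 3}" if "i < m" for i using that m by (auto simp: \<rho>_def)
  have fmod: "f g i mod m = i" if "i < m" for g i using that by (simp add: f_def)
  have "card ?A \<le> card (embeddings m ?G)"
  proof (rule card_embeddings_ge)
    show "finite (vertices ?G)" by (simp add: blowup_def)
    show "inj_on (\<lambda>g. restrict (f g) {..<m}) ?A"
    proof (rule inj_onI)
      fix g h assume gh: "g \<in> ?A" "h \<in> ?A" "restrict (f g) {..<m} = restrict (f h) {..<m}"
      have "g i = h i" if "i \<in> {..<m} - {1, 3}" for i
      proof -
        have "f g i = f h i" using fun_cong[OF gh(3), of i] that by simp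
        then show ?thesis using that m by (simp add: f_def \<rho>_def)
      qed
      then show "g = h" using gh(1,2) by (rule PiE_ext[rotated 2])
    qed
    show "(\<lambda>g. restrict (f g) {..<m}) ` ?A \<subseteq> embeddings m ?G"
    proof clarify
      fix g assume g: "g \<in> ?A"
      have fn: "f g i < n" if "i < m" for i
      proof -
        have "g (\<rho> i) < N" using PiE_mem[OF g \<rho>[OF that]] by simp
        then have "m * Suc (g (\<rho> i)) \<le> m * N" by (intro mult_le_mono2) simp
        also have "\<dots> \<le> n" by (simp add: N_def)
        finally show ?thesis using that by (simp add: f_def)
      qed
      show "restrict (f g) {..<m} \<in> embeddings m ?G"
      proof (rule embeddingsI)
        fix i assume i: "i < m"
        then have si: "Suc i mod m < m" by simp
        show "f g i \<in> vertices ?G" using fn[OF i] by (simp add: blowup_def)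
        have "f g (Suc i mod m) mod m = Suc (f g i) mod m"
          using fmod[OF si] fmod[OF i] by (metis mod_Suc_eq)
        moreover have "f g (Suc i mod m) = Suc (f g i)" if "i \<in> {0, 2}"
          using that m by (auto simp: f_def \<rho>_def)
        ultimately have edge: "f g i < n \<and> f g (Suc i mod m) < n \<and> f g (Suc i mod m) mod m = Suc (f g i) mod m \<and>
            (f g i mod m \<in> {0, 2} \<longrightarrow> f g (Suc i mod m) = Suc (f g i))"
          using fn[OF i] fn[OF si] fmod[OF i] by simp
        show "{f g i, f g (Suc i mod m)} \<in> uedges ?G"
          unfolding blowup_def snd_conv mem_Collect_eq
          by (rule exI[of _ "f g i"], rule exI[of _ "f g (Suc i mod m)"]) (use edge in simp)
      next
        show "inj_on (f g) {..<m}" using fmod by (metis inj_onI lessThan_iff)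
      qed
    qed
  qed
  moreover have "card ?A = N ^ (m - 2)"
  proof -
    have "card ({..<m} - {1, 3}) = m - 2" using m by (subst card_Diff_subset) auto
    then show ?thesis by (simp add: card_PiE)
  qed
  ultimately show ?thesis using upper unfolding N_def by linarith
qed

section \<open>Even cycles of length at least 6 against themselves: hubs and a matching\<close>

definition hub_matching :: "nat \<Rightarrow> nat \<Rightarrow> nat set set" where
  "hub_matching s n = {{s + 2 * r, Suc (s + 2 * r)} | r. Suc (s + 2 * r) < n}"

lemma hub_matchingI: "Suc (s + 2 * r) < n \<Longrightarrow> {s + 2 * r, Suc (s + 2 * r)} \<in> hub_matching s n"
  by (auto simp: hub_matching_def)

text \<open>A cycle of length \<open>2 * s + 2\<close> here has at most \<open>2 * s\<close> edges at the \<open>s\<close> hubs, hence at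
  least two in the matching.\<close>

definition hub_graph :: "nat \<Rightarrow> nat \<Rightarrow> nat ugraph" where
  "hub_graph s n = ({..<n}, {{a, b} | a b. a < s \<and> s \<le> b \<and> b < n} \<union> hub_matching s n)"

lemma simple_hub_graph: "simple_graph (hub_graph s n)"
  by (auto simp: simple_graph_def hub_graph_def hub_matching_def)

lemma hub_matching_disjoint:
  assumes "e \<in> hub_matching s n" "e' \<in> hub_matching s n" "e \<noteq> e'"
  shows "e \<inter> e' = {}"
proof -
  obtain r r' where r: "e = {s + 2 * r, Suc (s + 2 * r)}" "e' = {s + 2 * r', Suc (s + 2 * r')}"
    using assms by (auto simp: hub_matching_def)
  then have "r \<noteq> r'" using assms by auto
  then show ?thesis using r by auto
qed

lemma hub_graph_no_rainbow:
  "\<not> has_rainbow_cycle (2 * s + 2) (hub_graph s n) (matching_colour (hub_matching s n))"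
  unfolding has_rainbow_cycle_def
proof (intro notI, elim bexE)
  let ?m = "2 * s + 2" and ?M = "hub_matching s n"
  fix v assume v: "v \<in> embeddings ?m (hub_graph s n)"
    and rb: "inj_on (\<lambda>i. matching_colour ?M (cycle_edge ?m v i)) {..<?m}"
  have inj: "inj_on v {..<?m}" using v by (simp add: embeddings_def)
  let ?A = "{i \<in> {..<?m}. v i < s}" and ?B = "{i \<in> {..<?m}. v (Suc i mod ?m) < s}"
  have "card ?A \<le> card {..<s}"
    by (rule card_inj_on_le[of v]) (auto intro: inj_on_subset[OF inj])
  moreover have "card ?B \<le> card {..<s}"
  proof (rule card_inj_on_le[of "\<lambda>i. v (Suc i mod ?m)"])
    show "inj_on (\<lambda>i. v (Suc i mod ?m)) ?B"
    proof (rule inj_onI)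
      fix i j assume ij: "i \<in> ?B" "j \<in> ?B" "v (Suc i mod ?m) = v (Suc j mod ?m)"
      then have "Suc i mod ?m = Suc j mod ?m"
        using inj_onD[OF inj ij(3)] by simp
      then show "i = j" using Suc_mod_inject[of i ?m j] ij by simp
    qed
  qed auto
  ultimately have "card (?A \<union> ?B) \<le> 2 * s" using card_Un_le[of ?A ?B] by simp
  moreover have "?A \<union> ?B \<subseteq> {..<?m}" by auto
  ultimately have "\<not> card ({..<?m} - (?A \<union> ?B)) \<le> Suc 0"
    by (subst card_Diff_subset) auto
  then obtain i j where ij: "i \<in> {..<?m} - (?A \<union> ?B)" "j \<in> {..<?m} - (?A \<union> ?B)" "i \<noteq> j"
    using card_le_Suc0_iff_eq[of "{..<?m} - (?A \<union> ?B)"] by auto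
  have inM: "cycle_edge ?m v i \<in> ?M" if "i \<in> {..<?m} - (?A \<union> ?B)" for i
  proof -
    have "cycle_edge ?m v i \<in> uedges (hub_graph s n)" using v that by (auto simp: embeddings_def)
    moreover have "\<not> v i < s" "\<not> v (Suc i mod ?m) < s" using that by auto
    ultimately show ?thesis by (auto simp: hub_graph_def cycle_edge_def doubleton_eq_iff)
  qed
  have "matching_colour ?M (cycle_edge ?m v i) = matching_colour ?M (cycle_edge ?m v j)"
    using inM[OF ij(1)] inM[OF ij(2)] by (simp add: matching_colour_def)
  then show False using inj_onD[OF rb] ij by blast
qed

text \<open>For \<open>m = 2 * k\<close> there are \<open>s = k - 1\<close> hubs. The cycles counted
  run through \<open>0, \<beta> 0, 1, \<beta> 1, ..., w, \<beta> w, \<beta> w + 1, w + 1, \<beta> (w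
  + 1), \<beta> (w + 1) + 1\<close>. They use all hubs and exactly two matching edges, and each of
  the \<open>s\<close> values of \<open>\<beta>\<close> is chosen freely.\<close>

lemma ex_even_same_lower:
  fixes w n :: nat
  defines "m \<equiv> 2 * w + 6" and "s \<equiv> w + 2"
  shows "(n div (3 * s)) ^ s \<le> m ^ m * ex_rainbow n (cycle_graph m) (cycle_graph m)"
proof -
  let ?G = "hub_graph s n"
  \<comment> \<open>Above the \<open>s\<close> hubs, \<open>2 * s * N\<close> vertices are used, and
    \<open>s + 2 * s * N \<le> 3 * s * N\<close> once \<open>N \<ge> 1\<close>.\<close>
  define N where "N = n div (3 * s)"
  have m_eq: "2 * s + 2 = m" by (simp add: m_def s_def)
  have upper: "card (embeddings m ?G) \<le> m ^ m * ex_rainbow n (cycle_graph m) (cycle_graph m)"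
    using hub_graph_no_rainbow[of s n] proper_matching_colour[OF simple_hub_graph hub_matching_disjoint]
    unfolding m_eq by (intro ex_rainbow_cycle_lower[OF _ _ simple_hub_graph]) (auto simp: hub_graph_def m_def)
  \<comment> \<open>The pair chosen for \<open>i\<close> has an index congruent to \<open>i\<close>
    modulo \<open>s\<close>, so different \<open>i\<close> never collide.\<close>
  define \<beta> where "\<beta> g i = s + 2 * (s * g i + i)" for g :: "nat \<Rightarrow> nat" and i
  define f where "f g t = (if t < 2 * w + 2 then if even t then t div 2 else \<beta> g (t div 2)
     else if t = 2 * w + 2 then Suc (\<beta> g w) else if t = 2 * w + 3 then w + 1
     else if t = 2 * w + 4 then \<beta> g (w + 1) else Suc (\<beta> g (w + 1)))" for g t
  let ?A = "{..<s} \<rightarrow>\<^sub>E {..<N}"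
  have lt_s: "w < s" "w + 1 < s" "0 < s" "\<And>i. i \<le> w \<Longrightarrow> i < s" by (auto simp: s_def)
  have f_even: "f g (2 * i) = i" if "i \<le> w" for g i using that by (simp add: f_def)
  have f_odd: "f g (Suc (2 * i)) = \<beta> g i" if "i \<le> w" for g i using that by (simp add: f_def)
  have f_end: "f g (2 * w + 2) = Suc (\<beta> g w)" "f g (2 * w + 3) = w + 1"
    "f g (2 * w + 4) = \<beta> g (w + 1)" "f g (2 * w + 5) = Suc (\<beta> g (w + 1))" for g
    by (simp_all add: f_def)
  have f_end': "f g (Suc (Suc (2 * w))) = Suc (\<beta> g w)" for g by (simp add: f_def)
  have cases: "(\<exists>i\<le>w. t = 2 * i) \<or> (\<exists>i\<le>w. t = Suc (2 * i)) \<or> t = 2 * w + 2 \<or> t = 2 * w + 3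
      \<or> t = 2 * w + 4 \<or> t = 2 * w + 5" if "t < m" for t
    using that unfolding m_def by presburger
  have bound: "Suc (s + 2 * (P + i)) < n" if "i < s" "s + P \<le> Q" "s \<le> Q" "3 * Q \<le> n" for P Q i
    using that by arith
  have \<beta>_ge: "s \<le> \<beta> g i" for g i by (simp add: \<beta>_def)
  have "card ?A \<le> card (embeddings m ?G)"
  proof (rule card_embeddings_ge)
    show "finite (vertices ?G)" by (simp add: hub_graph_def)
    show "inj_on (\<lambda>g. restrict (f g) {..<m}) ?A"
    proof (rule inj_onI)
      fix g h assume gh: "g \<in> ?A" "h \<in> ?A" "restrict (f g) {..<m} = restrict (f h) {..<m}"
      have eq: "f g t = f h t" if "t < m" for t using fun_cong[OF gh(3), of t] that by simp
      have "g i = h i" if "i \<in> {..<s}" for i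
      proof -
        have "\<beta> g i = \<beta> h i"
        proof (cases "i \<le> w")
          case True
          then show ?thesis using eq[of "Suc (2 * i)"] f_odd by (simp add: m_def)
        next
          case False
          then have "i = w + 1" using that by (simp add: s_def)
          then show ?thesis using eq[of "2 * w + 4"] f_end f_end' by (simp add: m_def)
        qed
        then show ?thesis using lt_s(3) unfolding \<beta>_def by simp
      qed
      then show "g = h" using gh(1,2) by (rule PiE_ext[rotated 2])
    qed
    show "(\<lambda>g. restrict (f g) {..<m}) ` ?A \<subseteq> embeddings m ?G"
    proof clarify
      fix g assume g: "g \<in> ?A"
      have \<beta>n: "Suc (\<beta> g i) < n" if "i < s" for i
      proof -
        have gi: "g i < N" using PiE_mem[OF g, of i] that by simp
        then have "s * Suc (g i) \<le> s * N" by (intro mult_le_mono2) simp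
        then have "s + s * g i \<le> s * N" by (simp only: mult_Suc_right)
        moreover have "s \<le> s * N" using gi by (cases N) auto
        moreover have "3 * (s * N) \<le> n" unfolding N_def by (metis mult.assoc times_div_less_eq_dividend)
        ultimately show ?thesis unfolding \<beta>_def by (rule bound[OF that])
      qed
      have \<beta>n': "\<beta> g i < n" if "i < s" for i using \<beta>n[OF that] by simp
      have sn: "s < n" using \<beta>n'[of 0] \<beta>_ge[of g 0] lt_s(3) by simp
      have hub: "{i, b} \<in> uedges ?G" "{b, i} \<in> uedges ?G" if "i < s" "s \<le> b" "b < n" for i b
        using that unfolding hub_graph_def by (auto simp: insert_commute)
      have mat: "{\<beta> g i, Suc (\<beta> g i)} \<in> uedges ?G" if "i < s" for i
      proof -
        have "{\<beta> g i, Suc (\<beta> g i)} \<in> hub_matching s n"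
          using \<beta>n[OF that] unfolding \<beta>_def by (rule hub_matchingI)
        then show ?thesis by (simp add: hub_graph_def)
      qed
      show "restrict (f g) {..<m} \<in> embeddings m ?G"
      proof (rule embeddingsI)
        fix t assume t: "t < m"
        show "f g t \<in> vertices ?G"
          using cases[OF t] \<beta>n \<beta>n' sn lt_s
          by (elim disjE exE conjE) (auto simp: hub_graph_def f_even f_odd f_end f_end')
        show "{f g t, f g (Suc t mod m)} \<in> uedges ?G"
          using cases[OF t]
        proof (elim disjE exE conjE)
          fix i assume i: "i \<le> w" "t = 2 * i"
          then have "Suc t mod m = Suc (2 * i)" by (simp add: m_def)
          then show ?thesis using lt_s i f_even f_odd hub[of i "\<beta> g i"] \<beta>n'[of i] \<beta>_ge by simp
        next
          fix i assume i: "i \<le> w" "t = Suc (2 * i)"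
          show ?thesis
          proof (cases "i = w")
            case True
            then have "Suc t mod m = 2 * w + 2" using i by (simp add: m_def)
            then show ?thesis using lt_s i True f_odd f_end f_end' mat[of w] by simp
          next
            case False
            then have "Suc t mod m = 2 * Suc i" using i by (simp add: m_def)
            then show ?thesis using lt_s i False f_odd f_even[of "Suc i"] hub[of "Suc i" "\<beta> g i"] \<beta>n'[of i] \<beta>_ge by simp
          qed
        next
          assume i: "t = 2 * w + 2"
          then have "Suc t mod m = 2 * w + 3" by (simp add: m_def)
          then show ?thesis using lt_s i f_end f_end' hub[of "w + 1" "Suc (\<beta> g w)"] \<beta>n[of w] \<beta>_ge[of g w] by simp
        next
          assume i: "t = 2 * w + 3"
          then have "Suc t mod m = 2 * w + 4" by (simp add: m_def)
          then show ?thesis using lt_s i f_end f_end' hub[of "w + 1" "\<beta> g (w + 1)"] \<beta>n'[of "w + 1"] \<beta>_ge[of g "w + 1"] by simp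
        next
          assume i: "t = 2 * w + 4"
          then have "Suc t mod m = 2 * w + 5" by (simp add: m_def)
          then show ?thesis using lt_s i f_end f_end' mat[of "w + 1"] by simp
        next
          assume i: "t = 2 * w + 5"
          then have "Suc t = m" by (simp add: m_def)
          then have "Suc t mod m = 2 * 0" by simp
          then show ?thesis
            using lt_s i f_end f_end' f_even[of 0] hub[of 0 "Suc (\<beta> g (w + 1))"] \<beta>n[of "w + 1"] \<beta>_ge[of g "w + 1"] by simp
        qed
      next
        \<comment> \<open>A left inverse of \<open>f g\<close>: the position is read off from the
          hub, or from the index of the matching pair modulo \<open>s\<close> and the side within
          the pair.\<close>
        define dec where "dec x = (if x < s then (if x \<le> w then 2 * x else 2 * w + 3)
          else if even (x - s) then (if (x - s) div 2 mod s \<le> w then Suc (2 * ((x - s) div 2 mod s)) else 2 * w + 4)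
          else (if (x - s) div 2 mod s \<le> w then 2 * w + 2 else 2 * w + 5))" for x
        have \<beta>_dec: "(\<beta> g i - s) div 2 mod s = i" "(Suc (\<beta> g i) - s) div 2 mod s = i" if "i < s" for i
        proof -
          have "(\<beta> g i - s) div 2 = s * g i + i" "(Suc (\<beta> g i) - s) div 2 = s * g i + i"
            unfolding \<beta>_def by simp_all
          then show "(\<beta> g i - s) div 2 mod s = i" "(Suc (\<beta> g i) - s) div 2 mod s = i"
            using that by (simp_all only: mod_mult_self4 mod_less)
        qed
        have \<beta>_even: "even (\<beta> g i - s)" "odd (Suc (\<beta> g i) - s)" for i unfolding \<beta>_def by simp_all
        have \<beta>_not: "\<not> \<beta> g i < s" "\<not> Suc (\<beta> g i) < s" for i using \<beta>_ge[of g i] by simp_all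
        have dec_hub: "dec x = (if x \<le> w then 2 * x else 2 * w + 3)" if "x < s" for x
          using that by (simp add: dec_def)
        have dec_\<beta>: "dec (\<beta> g i) = (if i \<le> w then Suc (2 * i) else 2 * w + 4)"
          "dec (Suc (\<beta> g i)) = (if i \<le> w then 2 * w + 2 else 2 * w + 5)" if "i < s" for i
          by (simp_all only: dec_def \<beta>_not \<beta>_even \<beta>_dec[OF that] if_False if_True)
        have "dec (f g t) = t" if "t < m" for t
          using cases[OF that]
        proof (elim disjE exE conjE)
          fix i assume "i \<le> w" "t = 2 * i"
          then show ?thesis using dec_hub[of i] lt_s(4)[of i] by (simp add: f_even)
        next
          fix i assume "i \<le> w" "t = Suc (2 * i)"
          then show ?thesis using dec_\<beta>(1)[of i] lt_s(4)[of i] by (simp add: f_odd)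
        next
          assume "t = 2 * w + 2"
          then show ?thesis using dec_\<beta>(2)[OF lt_s(1)] by (simp only: f_end) simp
        next
          assume "t = 2 * w + 3"
          then show ?thesis using dec_hub[OF lt_s(2)] by (simp only: f_end) simp
        next
          assume "t = 2 * w + 4"
          then show ?thesis using dec_\<beta>(1)[OF lt_s(2)] by (simp only: f_end) simp
        next
          assume "t = 2 * w + 5"
          then show ?thesis using dec_\<beta>(2)[OF lt_s(2)] by (simp only: f_end) simp
        qed
        then show "inj_on (f g) {..<m}" by (intro inj_on_inverseI[of _ dec]) simp
      qed
    qed
  qed
  moreover have "card ?A = N ^ s" by (simp add: card_PiE)
  ultimately show ?thesis using upper unfolding N_def by linarith
qed

section \<open>\<open>C_4\<close> against itself\<close>

text \<open>The two perfect matchings of \<open>N\<close> disjoint 4-cycles, serving as colour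
  classes.\<close>

definition square_edges :: "nat \<Rightarrow> nat set set \<times> nat set set" where
  "square_edges N = ({{4 * r, 4 * r + 1} | r. r < N} \<union> {{4 * r + 2, 4 * r + 3} | r. r < N},
     {{4 * r + 1, 4 * r + 2} | r. r < N} \<union> {{4 * r, 4 * r + 3} | r. r < N})"

text \<open>With a single hub, the two matching edges of a 4-cycle would be adjacent, so the hub
  construction yields nothing here. Disjoint 4-cycles coloured alternately with two colours give the
  linear bound.\<close>

lemma ex_C4_lower: "n div 4 \<le> 4 ^ 4 * ex_rainbow n (cycle_graph 4) (cycle_graph 4)"
proof -
  define N where "N = n div 4"
  define E0 where "E0 = fst (square_edges N)"
  define E1 where "E1 = snd (square_edges N)"
  note E = E0_def E1_def square_edges_def
  let ?G = "({..<n}, E0 \<union> E1)" and ?c = "\<lambda>e. if e \<in> E0 then 0 else 1 :: nat"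
  have n4: "4 * r + 3 < n" if "r < N" for r using that unfolding N_def by linarith
  have G: "simple_graph ?G"
    unfolding simple_graph_def
  proof (intro conjI ballI)
    fix e assume "e \<in> uedges ?G"
    then show "e \<subseteq> vertices ?G" "card e = 2"
      unfolding E by (auto dest!: n4 simp: card_insert_if)
  qed simp
  have d0: "e \<inter> e' = {}" if e: "e \<in> E0" "e' \<in> E0" "e \<noteq> e'" for e e'
  proof -
    have *: "\<exists>q. e = {2 * q, Suc (2 * q)}" if "e \<in> E0" for e
    proof -
      from that consider r where "e = {4 * r, 4 * r + 1}" | r where "e = {4 * r + 2, 4 * r + 3}"
        unfolding E by auto
      then show ?thesis
      proof cases
        case (1 r)
        then show ?thesis by (intro exI[of _ "2 * r"]) simp
      next
        case (2 r)
        moreover have "4 * r + 2 = 2 * (2 * r + 1)" "4 * r + 3 = Suc (2 * (2 * r + 1))" by simp_all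
        ultimately show ?thesis by metis
      qed
    qed
    obtain q q' where q: "e = {2 * q, Suc (2 * q)}" "e' = {2 * q', Suc (2 * q')}"
      using *[OF e(1)] *[OF e(2)] by (elim exE) (rule that)
    moreover have "2 * q \<noteq> Suc (2 * q')" "2 * q' \<noteq> Suc (2 * q)" by presburger+
    ultimately show ?thesis using e(3) by auto
  qed
  have d1: "e \<inter> e' = {}" if e: "e \<in> E1" "e' \<in> E1" "e \<noteq> e'" for e e'
  proof -
    have *: "(\<exists>r. e = {4 * r + 1, 4 * r + 2}) \<or> (\<exists>r. e = {4 * r, 4 * r + 3})" if "e \<in> E1" for e
      using that unfolding E by auto
    have arith: "4 * r \<noteq> 4 * r' + 1" "4 * r \<noteq> 4 * r' + 2" "4 * r \<noteq> 4 * r' + 3"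
      "4 * r + 1 \<noteq> 4 * r' + 2" "4 * r + 1 \<noteq> 4 * r' + 3" "4 * r + 2 \<noteq> 4 * r' + 3" for r r' :: nat
      by presburger+
    from *[OF e(1)] *[OF e(2)] show ?thesis
    proof (elim disjE exE)
      fix r r' assume "e = {4 * r + 1, 4 * r + 2}" "e' = {4 * r' + 1, 4 * r' + 2}"
      then show ?thesis using e(3) arith[of r r'] arith[of r' r] by auto
    next
      fix r r' assume "e = {4 * r + 1, 4 * r + 2}" "e' = {4 * r', 4 * r' + 3}"
      then show ?thesis using arith[of r r'] arith[of r' r] by auto
    next
      fix r r' assume "e = {4 * r, 4 * r + 3}" "e' = {4 * r' + 1, 4 * r' + 2}"
      then show ?thesis using arith[of r r'] arith[of r' r] by auto
    next
      fix r r' assume "e = {4 * r, 4 * r + 3}" "e' = {4 * r', 4 * r' + 3}"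
      then show ?thesis using e(3) arith[of r r'] arith[of r' r] by auto
    qed
  qed
  have c: "proper_edge_coloring ?G ?c"
    unfolding proper_edge_coloring_def
  proof (intro ballI impI)
    fix e e' assume e: "e \<in> uedges ?G" "e' \<in> uedges ?G" "e \<noteq> e' \<and> e \<inter> e' \<noteq> {}"
    then have "\<not> (e \<in> E0 \<and> e' \<in> E0)" "\<not> (e \<in> E1 \<and> e' \<in> E1)" using d0[of e e'] d1[of e e'] by blast+
    then show "?c e \<noteq> ?c e'" using e by auto
  qed
  have "\<not> has_rainbow_cycle 4 ?G ?c"
    unfolding has_rainbow_cycle_def
  proof (intro notI, elim bexE)
    fix v assume "inj_on (\<lambda>i. ?c (cycle_edge 4 v i)) {..<4}"
    then have "card {..<4::nat} \<le> card {0, 1::nat}" by (rule card_inj_on_le) auto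
    then show False by simp
  qed
  then have upper: "card (embeddings 4 ?G) \<le> 4 ^ 4 * ex_rainbow n (cycle_graph 4) (cycle_graph 4)"
    by (intro ex_rainbow_cycle_lower[OF _ _ G _ c]) auto
  have "card {..<N} \<le> card (embeddings 4 ?G)"
  proof (rule card_embeddings_ge)
    show "inj_on (\<lambda>r. restrict (\<lambda>i. 4 * r + i) {..<4::nat}) {..<N}"
      by (rule inj_onI) (drule fun_cong[of _ _ 0], simp)
    show "(\<lambda>r. restrict (\<lambda>i. 4 * r + i) {..<4::nat}) ` {..<N} \<subseteq> embeddings 4 ?G"
    proof clarify
      fix r assume r: "r < N"
      show "restrict (\<lambda>i. 4 * r + i) {..<4::nat} \<in> embeddings 4 ?G"
      proof (rule embeddingsI)
        fix i :: nat assume i: "i < 4"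
        show "4 * r + i \<in> vertices ?G" using n4[OF r] i by simp
        consider "i = 0" | "i = 1" | "i = 2" | "i = 3" using i by linarith
        then show "{4 * r + i, 4 * r + Suc i mod 4} \<in> uedges ?G"
        proof cases
          case 1 then show ?thesis using r unfolding E by auto
        next
          case 2
          then have "Suc i = 2" by simp
          then have "{4 * r + i, 4 * r + Suc i mod 4} = {4 * r + 1, 4 * r + 2}" using 2 by simp
          then show ?thesis using r unfolding E by auto
        next
          case 3
          then have "Suc i = 3" by simp
          then have "{4 * r + i, 4 * r + Suc i mod 4} = {4 * r + 2, 4 * r + 3}" using 3 by simp
          then show ?thesis using r unfolding E by auto
        next
          case 4
          then have "{4 * r + i, 4 * r + Suc i mod 4} = {4 * r, 4 * r + 3}" by auto
          then show ?thesis using r unfolding E by auto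
        qed
      qed (auto simp: inj_on_def)
    qed
  qed simp
  then show ?thesis using upper by (simp add: N_def)
qed

section \<open>Even cycles against other even cycles of length at least 6\<close>

text \<open>\<open>C_2l\<close> with every other vertex blown up: the hubs below \<open>l\<close>
  stay single, and the vertices of one residue class lie between two consecutive hubs.\<close>

definition thick_cycle :: "nat \<Rightarrow> nat \<Rightarrow> nat ugraph" where
  "thick_cycle l n = ({..<n}, {{b mod l, b} | b. l \<le> b \<and> b < n} \<union> {{Suc b mod l, b} | b. l \<le> b \<and> b < n})"

lemma thick_cycle_edgeD:
  assumes "{x, y} \<in> uedges (thick_cycle l n)" "0 < l"
  shows "(x < l) \<noteq> (y < l)"
    and "x < l \<Longrightarrow> y mod l = x \<or> Suc y mod l = x"
proof -
  obtain b where b: "l \<le> b" "{x, y} = {b mod l, b} \<or> {x, y} = {Suc b mod l, b}"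
    using assms(1) by (auto simp: thick_cycle_def)
  have lt: "b mod l < l" "Suc b mod l < l" using assms(2) by simp_all
  have "(x = b \<and> (y = b mod l \<or> y = Suc b mod l)) \<or> (y = b \<and> (x = b mod l \<or> x = Suc b mod l))"
    using b(2) by (auto simp: doubleton_eq_iff)
  then show "(x < l) \<noteq> (y < l)" "x < l \<Longrightarrow> y mod l = x \<or> Suc y mod l = x"
    using b(1) lt by (elim disjE conjE; simp)+
qed

lemma simple_thick_cycle:
  assumes "0 < l"
  shows "simple_graph (thick_cycle l n)"
  unfolding simple_graph_def
proof (intro conjI ballI)
  fix e assume e: "e \<in> uedges (thick_cycle l n)"
  then obtain a b where b: "e = {a, b}" "l \<le> b" "b < n" "a = b mod l \<or> a = Suc b mod l"
    unfolding thick_cycle_def by auto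
  have "a < l" using b(4) assms by auto
  then show "e \<subseteq> vertices (thick_cycle l n)" "card e = 2" using b by (auto simp: thick_cycle_def)
qed (simp add: thick_cycle_def)

lemma mod_add_left_cancel_nat:
  fixes a b c m :: nat
  shows "(c + a) mod m = (c + b) mod m \<Longrightarrow> a mod m = b mod m"
  by (auto simp: nat_mod_eq_iff)

text \<open>The hubs on a cycle of length \<open>2 * k\<close> form a cycle of length \<open>k\<close> in the cyclic order of
  the \<open>l\<close> hubs, which for \<open>k \<ge> 3\<close> must go around.\<close>

lemma thick_cycle_embeddings_empty:
  assumes k: "3 \<le> k" "k \<noteq> l" and l: "2 \<le> l"
  shows "embeddings (2 * k) (thick_cycle l n) = {}"
proof (rule ccontr)
  assume "embeddings (2 * k) (thick_cycle l n) \<noteq> {}"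
  then obtain v where v: "v \<in> embeddings (2 * k) (thick_cycle l n)" by blast
  let ?m = "2 * k"
  \<comment> \<open>Periodic extension of the cycle, so that one can step past its end.\<close>
  define w where "w i = v (i mod ?m)" for i
  have inj: "inj_on v {..<?m}" using v by (simp add: embeddings_def)
  have m0: "0 < ?m" and l0: "0 < l" using k l by simp_all
  have w_eq: "i mod ?m = j mod ?m" if "w i = w j" for i j
    using inj_onD[OF inj, of "i mod ?m" "j mod ?m"] that m0 by (simp add: w_def)
  have adj: "{w i, w (Suc i)} \<in> uedges (thick_cycle l n)" for i
  proof -
    have "i mod ?m < ?m" using m0 by simp
    then have "cycle_edge ?m v (i mod ?m) \<in> uedges (thick_cycle l n)"
      using v unfolding embeddings_def by blast
    then show ?thesis by (simp add: cycle_edge_def w_def mod_Suc_eq)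
  qed
  have adj': "{w (Suc i), w i} \<in> uedges (thick_cycle l n)" for i
    using adj[of i] by (simp add: insert_commute)
  have alt: "(w i < l) \<noteq> (w (Suc i) < l)" for i by (rule thick_cycle_edgeD(1)[OF adj l0])
  obtain p0 where p0: "w p0 < l" using alt[of 0] by blast
  define h where "h i = w (p0 + 2 * i)" for i
  have h_l: "h i < l" for i
  proof (induction i)
    case (Suc i)
    then show ?case using alt[of "p0 + 2 * i"] alt[of "Suc (p0 + 2 * i)"] by (simp add: h_def)
  qed (simp add: h_def p0)
  define W where "W = range h"
  have W_l: "W \<subseteq> {..<l}" using h_l by (auto simp: W_def)
  have h_mod: "h i = h (i mod k)" for i
  proof -
    have "(p0 + 2 * i) mod ?m = (p0 + 2 * (i mod k)) mod ?m"
      by (metis mod_add_right_eq mult_mod_right)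
    then show ?thesis by (simp add: h_def w_def)
  qed
  have inj_h: "inj_on h {..<k}"
  proof (rule inj_onI)
    fix i j assume ij: "i \<in> {..<k}" "j \<in> {..<k}" "h i = h j"
    then have "(p0 + 2 * i) mod ?m = (p0 + 2 * j) mod ?m"
      by (intro w_eq) (simp add: h_def)
    then have "(2 * i) mod ?m = (2 * j) mod ?m" by (rule mod_add_left_cancel_nat)
    then show "i = j" using ij by simp
  qed
  have "W = h ` {..<k}"
  proof
    show "W \<subseteq> h ` {..<k}"
    proof
      fix x assume "x \<in> W"
      then obtain i where "x = h i" by (auto simp: W_def)
      then have "x = h (i mod k)" using h_mod[of i] by simp
      then show "x \<in> h ` {..<k}" using k by auto
    qed
  qed (auto simp: W_def)
  then have "card W = k" using inj_h by (simp add: card_image)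
  \<comment> \<open>Here \<open>k \<noteq> l\<close> enters. A nonempty proper subset of the cyclic
    order is not closed under successors, so the cycle visits some hub whose successor it
    misses.\<close>
  then have "W \<noteq> {..<l}" using k(2) by auto
  have "\<exists>i. Suc (h i) mod l \<notin> W"
  proof (rule ccontr)
    assume "\<not> ?thesis"
    then have closed: "Suc x mod l \<in> W" if "x \<in> W" for x using that by (auto simp: W_def)
    have "(h 0 + j) mod l \<in> W" for j
    proof (induction j)
      case 0
      then show ?case using h_l[of 0] by (simp add: W_def)
    next
      case (Suc j)
      then show ?case using closed[OF Suc] by (simp add: mod_Suc_eq)
    qed
    moreover have "(h 0 + (l - h 0 + x)) mod l = x" if "x < l" for x
      using that h_l[of 0] by simp
    ultimately have "{..<l} \<subseteq> W" by (metis lessThan_iff subsetI)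
    then show False using W_l \<open>W \<noteq> {..<l}\<close> by blast
  qed
  then obtain i where i: "Suc (h i) mod l \<notin> W" ..
  define p where "p = p0 + 2 * i"
  have hp: "h i = w p" by (simp add: h_def p_def)
  have wpk: "w (p + ?m) = w p" by (simp add: w_def)
  \<comment> \<open>As the successor of \<open>w p\<close> is not visited, every other visited hub
    sharing a neighbour with it must be its predecessor.\<close>
  have pred: "Suc z mod l = w p"
    if z: "z \<in> W" "z \<noteq> w p" and b: "{w p, b} \<in> uedges (thick_cycle l n)" "{z, b} \<in> uedges (thick_cycle l n)" for z b
  proof -
    have "w p < l" using h_l[of i] hp by simp
    then have 1: "b mod l = w p \<or> Suc b mod l = w p" using thick_cycle_edgeD(2)[OF b(1) l0] by simp
    have "z < l" using z W_l by auto
    then have 2: "b mod l = z \<or> Suc b mod l = z" using thick_cycle_edgeD(2)[OF b(2) l0] by simp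
    have S: "Suc b mod l = Suc (b mod l) mod l" by (simp add: mod_Suc_eq)
    show ?thesis
    proof (cases "b mod l = w p")
      case True
      then have "z = Suc (w p) mod l" using 2 S z(2) by auto
      then show ?thesis using i hp z(1) by simp
    next
      case False
      then have "Suc b mod l = w p" using 1 by simp
      moreover have "b mod l = z" using 2 z(2) \<open>Suc b mod l = w p\<close> by auto
      ultimately show ?thesis using S by simp
    qed
  qed
  have ne: "w (p + j) \<noteq> w p" if "0 < j" "j < ?m" for j
  proof
    assume "w (p + j) = w p"
    then have "(p + j) mod ?m = (p + 0) mod ?m" by (intro w_eq) simp
    then have "j mod ?m = 0 mod ?m" by (rule mod_add_left_cancel_nat)
    then show False using that by simp
  qed
  have inW: "w (p + 2 * j) \<in> W" for j
  proof -
    have "w (p + 2 * j) = h (i + j)" by (simp add: h_def p_def algebra_simps)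
    then show ?thesis by (simp add: W_def)
  qed
  have "Suc (w (p + 2)) mod l = w p"
    by (rule pred[of _ "w (Suc p)"])
      (use inW[of 1] ne[of 2] k adj[of p] adj'[of "Suc p"] in simp_all)
  moreover have "Suc (w (p + 2 * (k - 1))) mod l = w p"
  proof (rule pred[of _ "w (Suc (p + 2 * (k - 1)))"])
    show "w (p + 2 * (k - 1)) \<in> W" by (rule inW)
    show "w (p + 2 * (k - 1)) \<noteq> w p" using k by (intro ne) auto
    show "{w (p + 2 * (k - 1)), w (Suc (p + 2 * (k - 1)))} \<in> uedges (thick_cycle l n)" by (rule adj)
    have eq: "Suc (Suc (p + 2 * (k - 1))) = p + ?m" using k by simp
    show "{w p, w (Suc (p + 2 * (k - 1)))} \<in> uedges (thick_cycle l n)"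
      using adj'[of "Suc (p + 2 * (k - 1))"] unfolding eq wpk .
  qed
  moreover have "w (p + 2) < l" "w (p + 2 * (k - 1)) < l"
    using inW[of 1] inW[of "k - 1"] W_l by auto
  \<comment> \<open>The hubs two steps away on either side of \<open>w p\<close> both equal its
    predecessor, but for \<open>k \<ge> 3\<close> they are different vertices of the cycle.\<close>
  ultimately have "w (p + 2) = w (p + 2 * (k - 1))" using Suc_mod_inject by metis
  then have "(p + 2) mod ?m = (p + 2 * (k - 1)) mod ?m" by (rule w_eq)
  then have "2 mod ?m = (2 * (k - 1)) mod ?m" by (rule mod_add_left_cancel_nat)
  then show False using k by simp
qed

lemma ex_even_lower:
  assumes k: "3 \<le> k" "k \<noteq> l" and l: "2 \<le> l"
  shows "(n div (2 * l)) ^ l \<le> (2 * l) ^ (2 * l) * ex_rainbow n (cycle_graph (2 * l)) (cycle_graph (2 * k))"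
proof -
  let ?m = "2 * l" and ?G = "thick_cycle l n"
  define N where "N = n div ?m"
  have G: "simple_graph ?G" using l by (intro simple_thick_cycle) simp
  have "\<not> has_rainbow_cycle (2 * k) ?G (matching_colour {})"
    using thick_cycle_embeddings_empty[OF assms] by (simp add: has_rainbow_cycle_def)
  then have upper: "card (embeddings ?m ?G) \<le> ?m ^ ?m * ex_rainbow n (cycle_graph ?m) (cycle_graph (2 * k))"
    using k l proper_matching_colour[OF G, of "{}"]
    by (intro ex_rainbow_cycle_lower[OF _ _ G]) (auto simp: thick_cycle_def)
  \<comment> \<open>The successor on \<open>g i\<close> lifts the vertex above the hubs;
    \<open>l * N + l \<le> 2 * l * N \<le> n\<close> leaves room for this once
    \<open>N \<ge> 1\<close>.\<close>
  define \<beta> where "\<beta> g i = l * Suc (g i) + i" for g :: "nat \<Rightarrow> nat" and i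
  define f where "f g t = (if even t then t div 2 else \<beta> g (t div 2))" for g t
  let ?A = "{..<l} \<rightarrow>\<^sub>E {..<N}"
  have f_even: "f g (2 * i) = i" and f_odd: "f g (Suc (2 * i)) = \<beta> g i" for g i
    by (simp_all add: f_def)
  have cases: "(\<exists>i<l. t = 2 * i) \<or> (\<exists>i<l. t = Suc (2 * i))" if "t < ?m" for t
    using that by presburger
  have \<beta>_mod: "\<beta> g i mod l = i" if "i < l" for g i
    using that unfolding \<beta>_def by (simp only: mod_mult_self4 mod_less)
  have \<beta>_ge: "l \<le> \<beta> g i" for g i by (simp add: \<beta>_def)
  have "card ?A \<le> card (embeddings ?m ?G)"
  proof (rule card_embeddings_ge)
    show "finite (vertices ?G)" by (simp add: thick_cycle_def)
    show "inj_on (\<lambda>g. restrict (f g) {..<?m}) ?A"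
    proof (rule inj_onI)
      fix g h assume gh: "g \<in> ?A" "h \<in> ?A" "restrict (f g) {..<?m} = restrict (f h) {..<?m}"
      have "g i = h i" if "i \<in> {..<l}" for i
      proof -
        have "Suc (2 * i) < ?m" using that by auto
        then have "\<beta> g i = \<beta> h i" using fun_cong[OF gh(3), of "Suc (2 * i)"] f_odd by simp
        then show ?thesis using l by (simp add: \<beta>_def)
      qed
      then show "g = h" using gh(1,2) by (rule PiE_ext[rotated 2])
    qed
    show "(\<lambda>g. restrict (f g) {..<?m}) ` ?A \<subseteq> embeddings ?m ?G"
    proof clarify
      fix g assume g: "g \<in> ?A"
      have \<beta>n: "\<beta> g i < n" if "i < l" for i
      proof -
        have gi: "g i < N" using PiE_mem[OF g, of i] that by simp
        then have "l * Suc (g i) \<le> l * N" by (intro mult_le_mono2) simp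
        moreover have "l \<le> l * N" using gi by (cases N) auto
        moreover have "2 * (l * N) \<le> n" unfolding N_def by (metis mult.assoc times_div_less_eq_dividend)
        ultimately show ?thesis using that unfolding \<beta>_def by linarith
      qed
      have ln: "l < n" using \<beta>n[of 0] \<beta>_ge[of g 0] l by simp
      have e1: "{i, \<beta> g i} \<in> uedges ?G" if "i < l" for i
      proof -
        have "{\<beta> g i mod l, \<beta> g i} \<in> uedges ?G"
          unfolding thick_cycle_def using \<beta>n[OF that] \<beta>_ge[of g i] by auto
        then show ?thesis using \<beta>_mod[OF that] by simp
      qed
      have e2: "{\<beta> g i, Suc i mod l} \<in> uedges ?G" if "i < l" for i
      proof -
        have "{Suc (\<beta> g i) mod l, \<beta> g i} \<in> uedges ?G"
          unfolding thick_cycle_def using \<beta>n[OF that] \<beta>_ge[of g i] by auto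
        moreover have "Suc (\<beta> g i) mod l = Suc i mod l" using \<beta>_mod[OF that, of g] by (metis mod_Suc_eq)
        ultimately show ?thesis by (simp add: insert_commute)
      qed
      show "restrict (f g) {..<?m} \<in> embeddings ?m ?G"
      proof (rule embeddingsI)
        fix t assume t: "t < ?m"
        show "f g t \<in> vertices ?G"
          using cases[OF t] \<beta>n ln by (elim disjE exE conjE) (auto simp: thick_cycle_def f_even f_odd)
        show "{f g t, f g (Suc t mod ?m)} \<in> uedges ?G"
          using cases[OF t]
        proof (elim disjE exE conjE)
          fix i assume i: "i < l" "t = 2 * i"
          then have "Suc t mod ?m = Suc (2 * i)" by simp
          then show ?thesis using i f_even f_odd e1 by simp
        next
          fix i assume i: "i < l" "t = Suc (2 * i)"
          have "Suc t mod ?m = (2 * Suc i) mod (2 * l)" using i by simp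
          also have "\<dots> = 2 * (Suc i mod l)" by (rule mult_mod_right[symmetric])
          finally show ?thesis using i f_even f_odd e2 by simp
        qed
      next
        show "inj_on (f g) {..<?m}"
        proof (rule inj_onI)
          fix t u assume tu: "t \<in> {..<?m}" "u \<in> {..<?m}" "f g t = f g u"
          have t: "t < ?m" and u: "u < ?m" using tu by auto
          have \<beta>_eq: "\<beta> g i = \<beta> g j \<longleftrightarrow> i = j" if "i < l" "j < l" for i j
            using \<beta>_mod that by metis
          have \<beta>_neq: "i \<noteq> \<beta> g j" "\<beta> g j \<noteq> i" if "i < l" for i j
            using \<beta>_ge[of g j] that by auto
          from cases[OF t] cases[OF u] tu(3) show "t = u"
            by (elim disjE exE conjE) (simp_all add: f_even f_odd \<beta>_eq \<beta>_neq)
        qed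
      qed
    qed
  qed
  moreover have "card ?A = N ^ l" by (simp add: card_PiE)
  ultimately show ?thesis using upper unfolding N_def by linarith
qed

section \<open>Point-line incidence graphs over finite fields\<close>

text \<open>The polynomial splits, and a repeated linear factor would give a common root with the
  derivative.\<close>

lemma card_roots_simple:
  fixes p :: "'a :: alg_closed_field poly"
  assumes p: "p \<noteq> 0" and simple: "\<And>x. poly p x = 0 \<Longrightarrow> poly (pderiv p) x \<noteq> 0"
  shows "card {x. poly p x = 0} = Polynomial.degree p"
proof -
  obtain A where A: "size A = Polynomial.degree p"
      "p = smult (Polynomial.lead_coeff p) (\<Prod>x\<in>#A. [:- x, 1:])"
    using alg_closed_imp_factorization[OF p] by blast
  have lc: "Polynomial.lead_coeff p \<noteq> 0" using p by simp
  have roots: "{x. poly p x = 0} = set_mset A"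
  proof -
    have "poly p x = 0 \<longleftrightarrow> x \<in># A" for x
    proof -
      have "poly p x = Polynomial.lead_coeff p * (\<Prod>y\<in>#A. x - y)"
        by (subst A(2)) (simp add: poly_prod_mset image_mset.compositionality o_def)
      then show ?thesis using lc by (auto simp: prod_mset_zero_iff)
    qed
    then show ?thesis by auto
  qed
  have count: "count A x \<le> 1" for x
  proof (rule ccontr)
    assume "\<not> count A x \<le> 1"
    then have "{#x, x#} \<subseteq># A" by (simp add: subseteq_mset_def)
    then obtain B where "A = {#x, x#} + B" by (metis subset_mset.le_iff_add)
    then have "p = [:- x, 1:] * ([:- x, 1:] * smult (Polynomial.lead_coeff p) (\<Prod>y\<in>#B. [:- y, 1:]))"
      by (subst A(2)) simp
    then obtain r where r: "p = [:- x, 1:] * ([:- x, 1:] * r)" by blast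
    have "poly p x = 0" by (simp add: r)
    moreover have "poly (pderiv p) x = 0"
      unfolding r pderiv_mult poly_add poly_mult by simp
    ultimately show False using simple by blast
  qed
  have "count A x = 1" if "x \<in># A" for x
    using count[of x] that count_greater_zero_iff[of A x] by linarith
  then have "size A = card (set_mset A)" by (simp add: size_multiset_overloaded_eq)
  then show ?thesis using A(1) roots by simp
qed

text \<open>Since \<open>x / 0 = 0\<close>, closure under division can be demanded for zero
  denominators too.\<close>

definition is_subfield :: "'a :: field set \<Rightarrow> bool" where
  "is_subfield F \<longleftrightarrow> (\<forall>x\<in>F. \<forall>y\<in>F. x + y \<in> F \<and> x - y \<in> F \<and> x * y \<in> F \<and> x / y \<in> F)"

lemma CHAR_gf2: "CHAR(gf2) = 2"
proof -
  have "(2 :: gf2) = 0"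
  proof -
    have "(1 :: gf2) + 1 = 0" by transfer simp
    then show ?thesis by (metis one_add_one)
  qed
  then have "of_nat 2 = (0 :: gf2)" by simp
  then have "CHAR(gf2) dvd 2" using of_nat_eq_0_iff_char_dvd by blast
  moreover have "CHAR(gf2) \<noteq> 1" by simp
  ultimately show ?thesis by (metis prime_nat_iff two_is_prime_nat)
qed

text \<open>The fixed points of the \<open>t\<close>-fold Frobenius map in the algebraic closure of
  the two-element field. They are the roots of \<open>x ^ q - x\<close>, whose derivative is the
  constant \<open>- 1\<close>, so there are \<open>q\<close> of them; they form a field because the
  map respects sums and products.\<close>

lemma exists_subfield_card_power_2:
  assumes "1 \<le> t"
  shows "\<exists>F :: gf2 alg_closure set. is_subfield F \<and> card F = 2 ^ t"
proof -
  let ?q = "2 ^ t :: nat"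
  have char: "CHAR(gf2 alg_closure) = 2" by (simp add: CHAR_gf2)
  have two: "(2 :: gf2 alg_closure) = 0"
    using of_nat_CHAR[where 'a = "gf2 alg_closure"] by (simp only: char) simp
  have neg: "- x = x" for x :: "gf2 alg_closure"
  proof -
    have "x + x = 2 * x" by simp
    then have "x + x = 0" by (simp only: two mult_zero_left)
    then show ?thesis by (metis add_eq_0_iff)
  qed
  define F where "F = {x :: gf2 alg_closure. x ^ ?q = x}"
  define p where "p = Polynomial.monom (1 :: gf2 alg_closure) ?q + [:0, - 1:]"
  have q1: "1 < ?q" using assms by (intro one_less_power) auto
  have deg: "Polynomial.degree p = ?q"
  proof -
    have "Polynomial.degree [:0, - 1 :: gf2 alg_closure:] < Polynomial.degree (Polynomial.monom (1 :: gf2 alg_closure) ?q)"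
      using q1 by (simp add: degree_monom_eq)
    then have "Polynomial.degree p = Polynomial.degree (Polynomial.monom (1 :: gf2 alg_closure) ?q)"
      unfolding p_def by (rule degree_add_eq_left)
    then show ?thesis by (simp add: degree_monom_eq)
  qed
  have roots: "{x. poly p x = 0} = F" by (auto simp: p_def F_def poly_monom)
  have "of_nat ?q = (0 :: gf2 alg_closure)"
    using assms by (simp add: two)
  then have "pderiv p = - 1"
    by (simp add: p_def pderiv_add pderiv_monom pderiv_pCons one_pCons)
  then have "card F = ?q"
    using card_roots_simple[of p] deg q1 roots by fastforce
  moreover have "is_subfield F"
  proof -
    have "(x + y) ^ ?q = x ^ ?q + y ^ ?q" for x y :: "gf2 alg_closure"
      by (rule freshmans_dream'[where n = t]) (simp_all add: CHAR_gf2)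
    then have plus: "x + y \<in> F" if "x \<in> F" "y \<in> F" for x y using that by (simp add: F_def)
    moreover have "x - y \<in> F" if "x \<in> F" "y \<in> F" for x y
      using plus[OF that] neg[of y] by (metis diff_conv_add_uminus)
    moreover have "x * y \<in> F" "x / y \<in> F" if "x \<in> F" "y \<in> F" for x y
      using that by (simp_all add: F_def power_mult_distrib power_divide)
    ultimately show ?thesis by (simp add: is_subfield_def)
  qed
  ultimately show ?thesis by blast
qed

section \<open>Points, lines and general position in the affine plane\<close>

text \<open>A line is given by slope and intercept. This leaves out the vertical lines and indexes
  points and lines by the same set.\<close>

definition on_line :: "'a :: field \<times> 'a \<Rightarrow> 'a \<times> 'a \<Rightarrow> bool" where
  "on_line P L \<longleftrightarrow> snd P = fst L * fst P + snd L"

definition line_through :: "'a :: field \<times> 'a \<Rightarrow> 'a \<times> 'a \<Rightarrow> 'a \<times> 'a" where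
  "line_through P Q = (let m = (snd Q - snd P) / (fst Q - fst P) in (m, snd P - m * fst P))"

lemma on_line_through:
  assumes "fst P \<noteq> fst Q"
  shows "on_line P (line_through P Q)" "on_line Q (line_through P Q)"
proof -
  show "on_line P (line_through P Q)" by (simp add: on_line_def line_through_def Let_def)
  define m where "m = (snd Q - snd P) / (fst Q - fst P)"
  have "m * (fst Q - fst P) = snd Q - snd P" using assms by (simp add: m_def)
  then have "snd Q = m * fst Q + (snd P - m * fst P)" by (simp add: algebra_simps)
  then show "on_line Q (line_through P Q)"
    by (simp add: on_line_def line_through_def Let_def m_def)
qed

lemma line_through_in:
  assumes "is_subfield F" "P \<in> F \<times> F" "Q \<in> F \<times> F"
  shows "line_through P Q \<in> F \<times> F"
  using assms by (auto simp: line_through_def Let_def is_subfield_def mem_Times_iff)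

lemma two_points_one_line:
  assumes "on_line P L" "on_line Q L" "on_line P M" "on_line Q M" "P \<noteq> Q"
  shows "L = M"
proof -
  have eq: "fst L * fst P + snd L = fst M * fst P + snd M"
    "fst L * fst Q + snd L = fst M * fst Q + snd M"
    using assms by (auto simp: on_line_def)
  have "(fst L - fst M) * (fst P - fst Q) =
      (fst L * fst P + snd L) - (fst L * fst Q + snd L) - ((fst M * fst P + snd M) - (fst M * fst Q + snd M))"
    by (simp add: algebra_simps)
  also have "\<dots> = 0" using eq by simp
  finally consider "fst L = fst M" | "fst P = fst Q" by auto
  then show ?thesis
  proof cases
    case 1
    then show ?thesis using eq by (simp add: prod_eq_iff)
  next
    case 2
    then show ?thesis using assms by (auto simp: on_line_def prod_eq_iff)
  qed
qed

text \<open>Distinct abscissae let every two points span a non-vertical line; the absence of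
  collinear triples makes the lines along a cycle distinct. Ordering the indices suits the extension
  by one last point.\<close>

definition general_position :: "'a :: field set \<Rightarrow> nat \<Rightarrow> (nat \<Rightarrow> 'a \<times> 'a) set" where
  "general_position F j = {u \<in> {..<j} \<rightarrow>\<^sub>E F \<times> F.
     (\<forall>i<j. \<forall>i'<i. fst (u i) \<noteq> fst (u i')) \<and>
     (\<forall>i<j. \<forall>i'<i. \<forall>i''<i'. \<nexists>L. on_line (u i) L \<and> on_line (u i') L \<and> on_line (u i'') L)}"

text \<open>A new point has to avoid \<open>j\<close> vertical lines and at most \<open>j^2\<close>
  secants, each with at most \<open>card F\<close> points.\<close>

lemma card_general_position_Suc:
  assumes fin: "finite F"
  shows "card (general_position F j) * ((card F)\<^sup>2 - (j + j\<^sup>2) * card F) \<le> card (general_position F (Suc j))"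
proof -
  let ?q = "card F"
  define col where "col u i = {P \<in> F \<times> F. fst P = fst (u i)}" for u :: "nat \<Rightarrow> 'a \<times> 'a" and i :: nat
  define lin where "lin u p = {P \<in> F \<times> F. \<exists>L. on_line (u (fst p)) L \<and> on_line (u (snd p)) L \<and> on_line P L}"
    for u :: "nat \<Rightarrow> 'a \<times> 'a" and p :: "nat \<times> nat"
  define pairs where "pairs = {p \<in> {..<j} \<times> {..<j}. snd p < fst p}"
  define bad where "bad u = (\<Union>i<j. col u i) \<union> (\<Union>p\<in>pairs. lin u p)" for u
  have finP: "finite (general_position F k)" for k
    by (rule finite_subset[of _ "{..<k} \<rightarrow>\<^sub>E F \<times> F"])
      (auto simp: general_position_def intro!: finite_PiE fin)
  have fin2: "finite (F \<times> F)" using fin by simp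
  have pairs: "finite pairs" "card pairs \<le> j\<^sup>2"
  proof -
    have "pairs \<subseteq> {..<j} \<times> {..<j}" by (auto simp: pairs_def)
    then show "finite pairs" "card pairs \<le> j\<^sup>2"
      using card_mono[of "{..<j} \<times> {..<j}" pairs] finite_subset
      by (auto simp: card_cartesian_product power2_eq_square)
  qed
  have card_col: "card (col u i) \<le> ?q" for u i
    by (rule card_inj_on_le[OF _ _ fin, of snd]) (auto simp: col_def inj_on_def)
  have card_lin: "card (lin u p) \<le> ?q" if u: "u \<in> general_position F j" and p: "p \<in> pairs" for u p
  proof (rule card_inj_on_le[OF _ _ fin, of fst])
    show "inj_on fst (lin u p)"
    proof (rule inj_onI)
      fix P Q assume PQ: "P \<in> lin u p" "Q \<in> lin u p" "fst P = fst Q"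
      then obtain L M where L: "on_line (u (fst p)) L" "on_line (u (snd p)) L" "on_line P L"
        and M: "on_line (u (fst p)) M" "on_line (u (snd p)) M" "on_line Q M" by (auto simp: lin_def)
      have "fst (u (fst p)) \<noteq> fst (u (snd p))" using u p by (auto simp: general_position_def pairs_def)
      then have "u (fst p) \<noteq> u (snd p)" by auto
      then have "L = M" by (rule two_points_one_line[OF L(1,2) M(1,2)])
      then show "P = Q" using L M PQ by (simp add: on_line_def prod_eq_iff)
    qed
  qed (auto simp: lin_def)
  have card_bad: "card (bad u) \<le> (j + j\<^sup>2) * ?q" if u: "u \<in> general_position F j" for u
  proof -
    have "card (bad u) \<le> card (\<Union>i<j. col u i) + card (\<Union>p\<in>pairs. lin u p)"
      unfolding bad_def by (rule card_Un_le)
    also have "\<dots> \<le> (\<Sum>i<j. card (col u i)) + (\<Sum>p\<in>pairs. card (lin u p))"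
      by (intro add_mono card_UN_le pairs) simp
    also have "\<dots> \<le> (\<Sum>i<j. ?q) + (\<Sum>p\<in>pairs. ?q)"
      by (intro add_mono sum_mono card_col card_lin[OF u])
    also have "\<dots> = j * ?q + card pairs * ?q" by simp
    also have "\<dots> \<le> j * ?q + j\<^sup>2 * ?q" using pairs(2) by simp
    finally show ?thesis by (simp add: add_mult_distrib)
  qed
  let ?S = "SIGMA u:general_position F j. F \<times> F - bad u"
  have "card (general_position F j) * (?q\<^sup>2 - (j + j\<^sup>2) * ?q)
      = (\<Sum>u\<in>general_position F j. ?q\<^sup>2 - (j + j\<^sup>2) * ?q)" by simp
  also have "\<dots> \<le> (\<Sum>u\<in>general_position F j. card (F \<times> F - bad u))"
  proof (rule sum_mono)
    fix u assume u: "u \<in> general_position F j"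
    have "bad u \<subseteq> F \<times> F" by (auto simp: bad_def col_def lin_def)
    then have "card (F \<times> F - bad u) = ?q\<^sup>2 - card (bad u)"
      using fin2 finite_subset by (subst card_Diff_subset) (auto simp: card_cartesian_product power2_eq_square)
    then show "?q\<^sup>2 - (j + j\<^sup>2) * ?q \<le> card (F \<times> F - bad u)" using card_bad[OF u] by simp
  qed
  also have "\<dots> = card ?S" by (rule card_SigmaI[symmetric]) (use finP fin2 in auto)
  also have "\<dots> \<le> card (general_position F (Suc j))"
  proof (rule card_inj_on_le[OF _ _ finP])
    show "inj_on (\<lambda>(u, P). u(j := P)) ?S"
    proof (rule inj_onI, clarify)
      fix u P w Q
      assume uw: "u \<in> general_position F j" "w \<in> general_position F j" "u(j := P) = w(j := Q)"
      have "u i = w i" if "i \<in> {..<j}" for i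
        using fun_cong[OF uw(3), of i] that by simp
      then have "u = w"
        using uw(1,2) by (intro PiE_ext[of u "{..<j}" "\<lambda>_. F \<times> F"]) (auto simp: general_position_def)
      then show "u = w \<and> P = Q" using fun_cong[OF uw(3), of j] by simp
    qed
    show "(\<lambda>(u, P). u(j := P)) ` ?S \<subseteq> general_position F (Suc j)"
    proof clarify
      fix u a b assume u: "u \<in> general_position F j" and P: "a \<in> F" "b \<in> F" "(a, b) \<notin> bad u"
      let ?w = "u(j := (a, b))"
      have uE: "u \<in> {..<j} \<rightarrow>\<^sub>E F \<times> F" and
        u1: "\<And>i i'. i < j \<Longrightarrow> i' < i \<Longrightarrow> fst (u i) \<noteq> fst (u i')" and
        u2: "\<And>i i' i'' L. i < j \<Longrightarrow> i' < i \<Longrightarrow> i'' < i' \<Longrightarrow>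
          \<not> (on_line (u i) L \<and> on_line (u i') L \<and> on_line (u i'') L)"
        using u unfolding general_position_def by blast+
      have n1: "a \<noteq> fst (u i)" if "i < j" for i
        using P that by (auto simp: bad_def col_def)
      have n2: "\<not> (on_line (a, b) L \<and> on_line (u i) L \<and> on_line (u i') L)" if "i < j" "i' < i" for i i' L
      proof
        assume L: "on_line (a, b) L \<and> on_line (u i) L \<and> on_line (u i') L"
        have "(i, i') \<in> pairs" using that by (simp add: pairs_def)
        moreover have "(a, b) \<in> lin u (i, i')" using L P(1,2) unfolding lin_def mem_Collect_eq fst_conv snd_conv by blast
        ultimately show False using P(3) unfolding bad_def by blast
      qed
      show "?w \<in> general_position F (Suc j)"
        unfolding general_position_def mem_Collect_eq
      proof (intro conjI allI impI notI)
        show "?w \<in> {..<Suc j} \<rightarrow>\<^sub>E F \<times> F"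
          using uE P(1,2) by (auto simp: PiE_iff extensional_def less_Suc_eq)
        fix i i' assume i: "i < Suc j" "i' < i"
        show "fst (?w i) = fst (?w i') \<Longrightarrow> False"
          using i u1[of i i'] n1[of i'] by (cases "i = j") auto
        fix i'' assume i'': "i'' < i'"
        assume "\<exists>L. on_line (?w i) L \<and> on_line (?w i') L \<and> on_line (?w i'') L"
        then obtain L where L: "on_line (?w i) L \<and> on_line (?w i') L \<and> on_line (?w i'') L" ..
        show False
        proof (cases "i = j")
          case True
          then show False using L n2[of i' i'' L] i i'' by simp
        next
          case False
          then show False using L u2[of i i' i'' L] i i'' by simp
        qed
      qed
    qed
  qed
  finally show ?thesis .
qed

text \<open>The hypothesis leaves at least half of the plane for each further point, at the cost of
  a factor 2 per point.\<close>

lemma card_general_position: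
  assumes fin: "finite F" and q: "2 * (l + l\<^sup>2) \<le> card F"
  shows "j \<le> l \<Longrightarrow> ((card F)\<^sup>2) ^ j \<le> 2 ^ j * card (general_position F j)"
proof (induction j)
  case 0
  have "general_position F 0 = {\<lambda>_. undefined}" by (auto simp: general_position_def)
  then show ?case by simp
next
  case (Suc j)
  let ?q = "card F"
  have "j + j\<^sup>2 \<le> l + l\<^sup>2" using Suc.prems by (intro add_mono power_mono) auto
  then have "2 * (j + j\<^sup>2) * ?q \<le> ?q * ?q" using q by (intro mult_right_mono) auto
  then have "2 * ((j + j\<^sup>2) * ?q) \<le> ?q\<^sup>2" by (simp only: power2_eq_square mult.assoc)
  then have half: "?q\<^sup>2 \<le> 2 * (?q\<^sup>2 - (j + j\<^sup>2) * ?q)" by arith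
  have "(?q\<^sup>2) ^ Suc j = (?q\<^sup>2) ^ j * ?q\<^sup>2" by simp
  also have "\<dots> \<le> (2 ^ j * card (general_position F j)) * (2 * (?q\<^sup>2 - (j + j\<^sup>2) * ?q))"
    using Suc half by (intro mult_mono) auto
  also have "\<dots> = 2 ^ Suc j * (card (general_position F j) * (?q\<^sup>2 - (j + j\<^sup>2) * ?q))" by simp
  also have "\<dots> \<le> 2 ^ Suc j * card (general_position F (Suc j))"
    by (intro mult_left_mono card_general_position_Suc[OF fin]) simp
  finally show ?case .
qed

section \<open>Cycles in the incidence graph\<close>

text \<open>\<open>\<phi>\<close> numbers points (\<open>Inl\<close>) and lines
  (\<open>Inr\<close>). Vertices below \<open>n\<close> without a number assigned stay isolated, so
  that \<open>n\<close> can be arbitrary.\<close>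

definition incidence_graph ::
  "'a :: field set \<Rightarrow> (('a \<times> 'a) + ('a \<times> 'a) \<Rightarrow> nat) \<Rightarrow> nat \<Rightarrow> nat ugraph" where
  "incidence_graph F \<phi> n = ({..<n}, {{\<phi> (Inl P), \<phi> (Inr L)} | P L. P \<in> F \<times> F \<and> L \<in> F \<times> F \<and> on_line P L})"

lemma incidence_graph_edgeD:
  assumes "{a, b} \<in> uedges (incidence_graph F \<phi> n)"
  shows "\<exists>P L. P \<in> F \<times> F \<and> L \<in> F \<times> F \<and> on_line P L \<and>
    ((a = \<phi> (Inl P) \<and> b = \<phi> (Inr L)) \<or> (b = \<phi> (Inl P) \<and> a = \<phi> (Inr L)))"
proof -
  obtain P L where "{a, b} = {\<phi> (Inl P), \<phi> (Inr L)}" "P \<in> F \<times> F" "L \<in> F \<times> F" "on_line P L"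
    using assms unfolding incidence_graph_def snd_conv mem_Collect_eq by blast
  then show ?thesis unfolding doubleton_eq_iff by blast
qed

text \<open>A 4-cycle would consist of two points lying on two common lines.\<close>

lemma incidence_graph_no_C4:
  fixes F :: "'a :: field set"
  assumes inj: "inj_on \<phi> ((F \<times> F) <+> (F \<times> F))"
  shows "embeddings 4 (incidence_graph F \<phi> n) = {}"
proof (rule ccontr)
  assume "embeddings 4 (incidence_graph F \<phi> n) \<noteq> {}"
  then obtain v where v: "v \<in> embeddings 4 (incidence_graph F \<phi> n)" by blast
  let ?FF = "F \<times> F"
  have inj_v: "inj_on v {..<4}" and e: "\<And>i. i < 4 \<Longrightarrow> {v i, v (Suc i mod 4)} \<in> uedges (incidence_graph F \<phi> n)"
    using v by (auto simp: embeddings_def cycle_edge_def)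
  have s: "Suc 0 mod 4 = 1" "Suc 1 mod 4 = (2 :: nat)" "Suc 2 mod 4 = (3 :: nat)" "Suc 3 mod 4 = (0 :: nat)" by simp_all
  have e4: "{v 0, v 1} \<in> uedges (incidence_graph F \<phi> n)" "{v 1, v 2} \<in> uedges (incidence_graph F \<phi> n)"
    "{v 2, v 3} \<in> uedges (incidence_graph F \<phi> n)" "{v 3, v 0} \<in> uedges (incidence_graph F \<phi> n)"
    using e[of 0] e[of 1] e[of 2] e[of 3] unfolding s by simp_all
  have v_ne: "v 0 \<noteq> v 2" "v 1 \<noteq> v 3" using inj_v by (auto dest: inj_onD)
  have ll: "P = Q" if "\<phi> (Inl P) = \<phi> (Inl Q)" "P \<in> ?FF" "Q \<in> ?FF" for P Q
    using inj_onD[OF inj that(1)] that by auto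
  have rr: "P = Q" if "\<phi> (Inr P) = \<phi> (Inr Q)" "P \<in> ?FF" "Q \<in> ?FF" for P Q
    using inj_onD[OF inj that(1)] that by auto
  have lr: "\<phi> (Inl P) \<noteq> \<phi> (Inr Q)" if "P \<in> ?FF" "Q \<in> ?FF" for P Q
    using inj_onD[OF inj, of "Inl P" "Inr Q"] that by auto
  have key: False
    if ed: "{a, b} \<in> uedges (incidence_graph F \<phi> n)" "{b, c} \<in> uedges (incidence_graph F \<phi> n)"
      "{c, d} \<in> uedges (incidence_graph F \<phi> n)" "{d, a} \<in> uedges (incidence_graph F \<phi> n)"
      and ne: "a \<noteq> c" "b \<noteq> d" and a: "a = \<phi> (Inl P)" "P \<in> ?FF" for a b c d P
  proof -
    obtain L where L: "L \<in> ?FF" "on_line P L" "b = \<phi> (Inr L)"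
      using incidence_graph_edgeD[OF ed(1)] a ll lr by metis
    obtain Q where Q: "Q \<in> ?FF" "on_line Q L" "c = \<phi> (Inl Q)"
      using incidence_graph_edgeD[OF ed(2)] L rr lr by metis
    obtain M where M: "M \<in> ?FF" "on_line Q M" "d = \<phi> (Inr M)"
      using incidence_graph_edgeD[OF ed(3)] Q ll lr by metis
    have "on_line P M" using incidence_graph_edgeD[OF ed(4)] M a rr ll lr by metis
    then show False using two_points_one_line[of P L Q M] L Q M a ne by auto
  qed
  \<comment> \<open>One of two consecutive vertices is a point; the cycle is rotated to start
    there.\<close>
  show False
  proof (cases "\<exists>P\<in>?FF. v 0 = \<phi> (Inl P)")
    case True
    then show False using key[OF e4 v_ne] by blast
  next
    case False
    then obtain P where "v 1 = \<phi> (Inl P)" "P \<in> ?FF"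
      using incidence_graph_edgeD[OF e4(1)] by blast
    then show False using key[OF e4(2,3,4,1) v_ne(2) v_ne(1)[symmetric]] by blast
  qed
qed

text \<open>The definition tests decreasing indices; this form accepts any order.\<close>

lemma general_position_three:
  assumes u: "u \<in> general_position F l" and lt: "i < l" "j < l" "k < l"
    and ne: "i \<noteq> j" "j \<noteq> k" "i \<noteq> k"
    and on: "on_line (u i) L" "on_line (u j) L" "on_line (u k) L"
  shows False
proof -
  have *: False if "i < l" "i' < i" "i'' < i'" "on_line (u i) L" "on_line (u i') L" "on_line (u i'') L" for i i' i''
    using u that unfolding general_position_def by blast
  consider "i < j" "j < k" | "i < k" "k < j" | "j < i" "i < k" | "j < k" "k < i" | "k < i" "i < j" | "k < j" "j < i"
    using ne by linarith
  then show False using *[of k j i] *[of j k i] *[of k i j] *[of i k j] *[of j i k] *[of i j k] lt on by cases auto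
qed

text \<open>The cycle visits \<open>u 0\<close>, the line through \<open>u 0\<close> and
  \<open>u 1\<close>, then \<open>u 1\<close>, and so on; its points recover the tuple.\<close>

lemma card_embeddings_incidence_graph:
  fixes F :: "'a :: field set"
  assumes F: "is_subfield F" "finite F" and l: "3 \<le> l"
    and inj: "inj_on \<phi> ((F \<times> F) <+> (F \<times> F))" and range: "\<phi> ` ((F \<times> F) <+> (F \<times> F)) \<subseteq> {..<n}"
  shows "card (general_position F l) \<le> card (embeddings (2 * l) (incidence_graph F \<phi> n))"
proof -
  let ?FF = "F \<times> F" and ?m = "2 * l" and ?G = "incidence_graph F \<phi> n"
  define line where "line u i = line_through (u i) (u (Suc i mod l))" for u :: "nat \<Rightarrow> 'a \<times> 'a" and i
  define f where "f u t = (if even t then \<phi> (Inl (u (t div 2))) else \<phi> (Inr (line u (t div 2))))" for u t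
  have f_even: "f u (2 * i) = \<phi> (Inl (u i))" and f_odd: "f u (Suc (2 * i)) = \<phi> (Inr (line u i))" for u i
    by (simp_all add: f_def)
  have cases: "(\<exists>i<l. t = 2 * i) \<or> (\<exists>i<l. t = Suc (2 * i))" if "t < ?m" for t
    using that by presburger
  have ll: "P = Q" if "\<phi> (Inl P) = \<phi> (Inl Q)" "P \<in> ?FF" "Q \<in> ?FF" for P Q
    using inj_onD[OF inj that(1)] that by auto
  have rr: "P = Q" if "\<phi> (Inr P) = \<phi> (Inr Q)" "P \<in> ?FF" "Q \<in> ?FF" for P Q
    using inj_onD[OF inj that(1)] that by auto
  have lr: "\<phi> (Inl P) \<noteq> \<phi> (Inr Q)" if "P \<in> ?FF" "Q \<in> ?FF" for P Q
    using inj_onD[OF inj, of "Inl P" "Inr Q"] that by auto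
  have uF: "u i \<in> ?FF" if "u \<in> general_position F l" "i < l" for u i
    using that by (auto simp: general_position_def PiE_iff)
  show ?thesis
  proof (rule card_embeddings_ge)
    show "finite (vertices ?G)" by (simp add: incidence_graph_def)
    show "inj_on (\<lambda>u. restrict (f u) {..<?m}) (general_position F l)"
    proof (rule inj_onI)
      fix u w assume uw: "u \<in> general_position F l" "w \<in> general_position F l"
        "restrict (f u) {..<?m} = restrict (f w) {..<?m}"
      have "u i = w i" if "i \<in> {..<l}" for i
      proof -
        have il: "i < l" "2 * i < ?m" using that by auto
        then have "\<phi> (Inl (u i)) = \<phi> (Inl (w i))" using fun_cong[OF uw(3), of "2 * i"] f_even by simp
        then show ?thesis using ll uF uw(1,2) il by blast
      qed
      then show "u = w"
        using uw(1,2) by (intro PiE_ext[of u "{..<l}" "\<lambda>_. ?FF"]) (auto simp: general_position_def)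
    qed
    show "(\<lambda>u. restrict (f u) {..<?m}) ` general_position F l \<subseteq> embeddings ?m ?G"
    proof clarify
      fix u assume u: "u \<in> general_position F l"
      have sl: "Suc i mod l < l" for i using l by simp
      have fst_ne: "fst (u i) \<noteq> fst (u j)" if "i < l" "j < l" "i \<noteq> j" for i j
        using u that unfolding general_position_def by (cases "i < j") (auto, metis nat_neq_iff)
      have sne: "i \<noteq> Suc i mod l" if "i < l" for i
        using that l by (auto simp: mod_Suc split: if_splits)
      have on: "on_line (u i) (line u i)" "on_line (u (Suc i mod l)) (line u i)" if "i < l" for i
        unfolding line_def using on_line_through fst_ne[OF that sl sne[OF that]] by blast+
      have lineF: "line u i \<in> ?FF" if "i < l" for i
        unfolding line_def using line_through_in[OF F(1)] uF[OF u] that sl by blast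
      \<comment> \<open>If lines \<open>i\<close> and \<open>j\<close> coincide, they carry three
        distinct points: \<open>u i\<close>, its successor and \<open>u j\<close>, or, when
        \<open>j\<close> is the successor of \<open>i\<close>, the points \<open>u i\<close>,
        \<open>u j\<close> and the successor of \<open>u j\<close>, which differs from
        \<open>u i\<close> because \<open>l \<ge> 3\<close>.\<close>
      have line_inj: "i = j" if "line u i = line u j" "i < l" "j < l" for i j
      proof (rule ccontr)
        assume ne: "i \<noteq> j"
        show False
        proof (cases "j = Suc i mod l")
          case True
          then have "i \<noteq> Suc j mod l" using Suc_mod_neq[of l i j] l that by simp
          then show False
            using general_position_three[OF u that(2,3) sl[of j] ne sne[OF that(3)]] on[OF that(2)] on[OF that(3)] that(1)
            by metis
        next
          case False
          then show False
            using general_position_three[OF u that(2) sl[of i] that(3) sne[OF that(2)], of "line u i"]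
              on[OF that(2)] on[OF that(3)] that(1) ne by metis
        qed
      qed
      have u_inj: "i = j" if "u i = u j" "i < l" "j < l" for i j
        using fst_ne[of i j] that by auto
      have edge: "{\<phi> (Inl P), \<phi> (Inr L)} \<in> uedges ?G" if "P \<in> ?FF" "L \<in> ?FF" "on_line P L" for P L
        using that unfolding incidence_graph_def snd_conv mem_Collect_eq by blast
      show "restrict (f u) {..<?m} \<in> embeddings ?m ?G"
      proof (rule embeddingsI)
        fix t assume t: "t < ?m"
        show "f u t \<in> vertices ?G"
          using cases[OF t]
        proof (elim disjE exE conjE)
          fix i assume i: "i < l" "t = 2 * i"
          have "Inl (u i) \<in> ?FF <+> ?FF" using uF[OF u i(1)] by (rule InlI)
          then have "\<phi> (Inl (u i)) \<in> {..<n}" by (intro subsetD[OF range] imageI)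
          then show ?thesis using i f_even by (simp add: incidence_graph_def)
        next
          fix i assume i: "i < l" "t = Suc (2 * i)"
          have "Inr (line u i) \<in> ?FF <+> ?FF" using lineF[OF i(1)] by (rule InrI)
          then have "\<phi> (Inr (line u i)) \<in> {..<n}" by (intro subsetD[OF range] imageI)
          then show ?thesis using i f_odd by (simp add: incidence_graph_def)
        qed
        show "{f u t, f u (Suc t mod ?m)} \<in> uedges ?G"
          using cases[OF t]
        proof (elim disjE exE conjE)
          fix i assume i: "i < l" "t = 2 * i"
          then have "Suc t mod ?m = Suc (2 * i)" by simp
          then show ?thesis
            using edge[OF uF[OF u i(1)] lineF[OF i(1)] on(1)[OF i(1)]] i f_even f_odd by simp
        next
          fix i assume i: "i < l" "t = Suc (2 * i)"
          have "Suc t mod ?m = (2 * Suc i) mod (2 * l)" using i by simp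
          also have "\<dots> = 2 * (Suc i mod l)" by (rule mult_mod_right[symmetric])
          finally have "f u (Suc t mod ?m) = \<phi> (Inl (u (Suc i mod l)))" by (simp only: f_even)
          moreover have "f u t = \<phi> (Inr (line u i))" using i f_odd by simp
          ultimately show ?thesis
            using edge[OF uF[OF u sl[of i]] lineF[OF i(1)] on(2)[OF i(1)]] by (simp only: insert_commute)
        qed
      next
        show "inj_on (f u) {..<?m}"
        proof (rule inj_onI)
          fix s t assume st: "s \<in> {..<?m}" "t \<in> {..<?m}" "f u s = f u t"
          have s: "s < ?m" and t: "t < ?m" using st by auto
          from cases[OF s] cases[OF t] show "s = t"
          proof (elim disjE exE conjE)
            fix i j assume ij: "i < l" "s = 2 * i" "j < l" "t = 2 * j"
            then have "u i = u j" using st(3) f_even ll uF[OF u] by simp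
            then show ?thesis using u_inj ij by simp
          next
            fix i j assume ij: "i < l" "s = Suc (2 * i)" "j < l" "t = Suc (2 * j)"
            then have "line u i = line u j" using st(3) f_odd rr lineF by simp
            then show ?thesis using line_inj ij by simp
          next
            fix i j assume ij: "i < l" "s = 2 * i" "j < l" "t = Suc (2 * j)"
            then show ?thesis using st(3) f_even f_odd lr[OF uF[OF u ij(1)] lineF[OF ij(3)]] by simp
          next
            fix i j assume ij: "i < l" "s = Suc (2 * i)" "j < l" "t = 2 * j"
            then show ?thesis using st(3) f_even f_odd lr[OF uF[OF u ij(3)] lineF[OF ij(1)]] by simp
          qed
        qed
      qed
    qed
  qed
qed

lemma ex_even_C4_lower:
  assumes l: "3 \<le> l" and n: "32 * (l + l\<^sup>2)\<^sup>2 < n"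
  shows "n ^ l \<le> 16 ^ l * ((2 * l) ^ (2 * l) * ex_rainbow n (cycle_graph (2 * l)) (cycle_graph 4))"
proof -
  \<comment> \<open>The largest power \<open>q\<close> of 2 for which the \<open>2 * q^2\<close>
    points and lines fit into \<open>n\<close> vertices; doubling \<open>q\<close> multiplies the
    square by 4.\<close>
  have "\<exists>t. 2 * (2 ^ t)\<^sup>2 \<le> n \<and> n < 8 * (2 ^ t)\<^sup>2"
  proof -
    have "n < 2 * (2 ^ n)\<^sup>2"
    proof -
      have "n < 2 ^ n" by (rule less_exp)
      also have "(2 :: nat) ^ n \<le> (2 ^ n)\<^sup>2" by (simp add: power2_eq_square)
      finally show ?thesis by simp
    qed
    moreover have "\<not> n < 2 * (2 ^ 0)\<^sup>2"
    proof -
      have "1 \<le> (l + l\<^sup>2)\<^sup>2" using l by (intro one_le_power) auto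
      then show ?thesis using n by simp
    qed
    ultimately obtain t where "\<not> n < 2 * (2 ^ t)\<^sup>2" "n < 2 * (2 ^ Suc t)\<^sup>2"
      using ex_least_nat_less[of "\<lambda>t. n < 2 * (2 ^ t)\<^sup>2" n] by blast
    then show ?thesis by (intro exI[of _ t]) (simp add: power_mult_distrib)
  qed
  then obtain t where t: "2 * (2 ^ t)\<^sup>2 \<le> n" "n < 8 * (2 ^ t :: nat)\<^sup>2" by blast
  let ?q = "2 ^ t :: nat"
  \<comment> \<open>\<open>8 * q^2 > n > 32 * (l + l^2)^2\<close> gives
    \<open>q > 2 * (l + l^2)\<close>, as general position asks; this is the origin of the threshold
    for \<open>n\<close>.\<close>
  have "(2 * (l + l\<^sup>2))\<^sup>2 = 4 * (l + l\<^sup>2)\<^sup>2" by (simp only: power_mult_distrib) simp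
  then have "(2 * (l + l\<^sup>2))\<^sup>2 < ?q\<^sup>2" using n t(2) by linarith
  then have q: "2 * (l + l\<^sup>2) < ?q" by (rule power_less_imp_less_base) simp
  then have "1 \<le> t" using l by (cases t) auto
  then obtain F :: "gf2 alg_closure set" where F: "is_subfield F" "card F = ?q"
    using exists_subfield_card_power_2 by blast
  have fin: "finite F" using F(2) by (intro card_ge_0_finite) simp
  let ?V = "(F \<times> F) <+> (F \<times> F)"
  have finV: "finite ?V" using fin by simp
  have cardV: "card ?V \<le> n"
    using t(1) fin by (simp add: card_Plus card_cartesian_product F(2) power2_eq_square)
  obtain \<phi> where \<phi>: "bij_betw \<phi> ?V {0..<card ?V}" using ex_bij_betw_finite_nat[OF finV] by blast
  have inj: "inj_on \<phi> ?V" using \<phi> by (simp add: bij_betw_def)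
  have "\<phi> ` ?V = {0..<card ?V}" using \<phi> by (simp add: bij_betw_def)
  then have range: "\<phi> ` ?V \<subseteq> {..<n}" using cardV by auto
  let ?G = "incidence_graph F \<phi> n"
  have G: "simple_graph ?G"
    unfolding simple_graph_def
  proof (intro conjI ballI)
    fix e assume "e \<in> uedges ?G"
    then obtain P L where e: "e = {\<phi> (Inl P), \<phi> (Inr L)}" "P \<in> F \<times> F" "L \<in> F \<times> F"
      unfolding incidence_graph_def snd_conv mem_Collect_eq by blast
    have mem: "Inl P \<in> ?V" "Inr L \<in> ?V" using e by blast+
    then have "\<phi> (Inl P) \<noteq> \<phi> (Inr L)" using inj_onD[OF inj _ mem] by auto
    then show "card e = 2" using e(1) by simp
    have "\<phi> (Inl P) \<in> {..<n}" "\<phi> (Inr L) \<in> {..<n}" by (intro subsetD[OF range] imageI mem)+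
    then show "e \<subseteq> vertices ?G" by (simp add: e(1) incidence_graph_def)
  qed (simp add: incidence_graph_def)
  have "\<not> has_rainbow_cycle 4 ?G (matching_colour {})"
    using incidence_graph_no_C4[OF inj] by (simp add: has_rainbow_cycle_def)
  then have upper: "card (embeddings (2 * l) ?G)
      \<le> (2 * l) ^ (2 * l) * ex_rainbow n (cycle_graph (2 * l)) (cycle_graph 4)"
    using l proper_matching_colour[OF G, of "{}"]
    by (intro ex_rainbow_cycle_lower[OF _ _ G]) (auto simp: incidence_graph_def)
  \<comment> \<open>\<open>16 = 8 * 2\<close>: the 8 comes from \<open>n < 8 * q^2\<close>, the 2
    from each point in general position.\<close>
  have "n ^ l \<le> (8 * ?q\<^sup>2) ^ l" using t(2) by (intro power_mono) auto
  also have "\<dots> = 8 ^ l * (?q\<^sup>2) ^ l" by (rule power_mult_distrib)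
  also have "\<dots> \<le> 8 ^ l * (2 ^ l * card (general_position F l))"
    using card_general_position[OF fin, of l l] q F(2) by (intro mult_left_mono) auto
  also have "\<dots> = (8 * 2) ^ l * card (general_position F l)" by (simp only: power_mult_distrib mult.assoc)
  also have "\<dots> \<le> (8 * 2) ^ l * card (embeddings (2 * l) ?G)"
    by (intro mult_left_mono card_embeddings_incidence_graph F fin l inj range) simp
  also have "\<dots> \<le> (8 * 2) ^ l * ((2 * l) ^ (2 * l) * ex_rainbow n (cycle_graph (2 * l)) (cycle_graph 4))"
    by (intro mult_left_mono upper) simp
  finally show ?thesis by simp
qed

section \<open>Asymptotics\<close>

lemma bigo_nat:
  fixes f :: "nat \<Rightarrow> nat"
  assumes "\<And>n. f n \<le> K * n ^ r"
  shows "(\<lambda>n. real (f n)) \<in> O(\<lambda>n. real n ^ r)"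
proof (rule bigoI)
  have "real (f n) \<le> real K * real n ^ r" for n
    using assms[of n] by (metis of_nat_le_iff of_nat_mult of_nat_power)
  then show "\<forall>\<^sub>F n in at_top. norm (real (f n)) \<le> real K * norm (real n ^ r)" by simp
qed

lemma bigomega_nat:
  fixes f :: "nat \<Rightarrow> nat"
  assumes "\<And>n. n0 \<le> n \<Longrightarrow> n ^ r \<le> C * f n"
  shows "(\<lambda>n. real (f n)) \<in> \<Omega>(\<lambda>n. real n ^ r)"
  unfolding bigomega_iff_bigo
proof (rule bigoI)
  have "real n ^ r \<le> real C * real (f n)" if "n0 \<le> n" for n
    using assms[OF that] by (metis of_nat_le_iff of_nat_mult of_nat_power)
  then show "\<forall>\<^sub>F n in at_top. norm (real n ^ r) \<le> real C * norm (real (f n))"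
    by (auto simp: eventually_at_top_linorder)
qed

text \<open>\<open>n div d\<close> is at least \<open>n / (2 * d)\<close> from \<open>n = d\<close>
  on.\<close>

lemma bigomega_div:
  fixes f :: "nat \<Rightarrow> nat"
  assumes "0 < d" "\<And>n. (n div d) ^ r \<le> C * f n"
  shows "(\<lambda>n. real (f n)) \<in> \<Omega>(\<lambda>n. real n ^ r)"
proof (rule bigomega_nat)
  fix n assume n: "d \<le> n"
  have "1 \<le> n div d" using n assms(1) by (simp add: Suc_le_eq div_greater_zero_iff)
  then have "d \<le> d * (n div d)" by simp
  moreover have "n mod d < d" using assms(1) by simp
  moreover have "n = d * (n div d) + n mod d" by simp
  ultimately have "n \<le> 2 * d * (n div d)" by linarith
  then have "n ^ r \<le> (2 * d * (n div d)) ^ r" by (rule power_mono) simp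
  also have "\<dots> = (2 * d) ^ r * (n div d) ^ r" by (rule power_mult_distrib)
  also have "\<dots> \<le> (2 * d) ^ r * (C * f n)" by (intro mult_left_mono assms) simp
  finally show "n ^ r \<le> (2 * d) ^ r * C * f n" by (simp only: mult.assoc)
qed

lemma ex_even_same_bigomega:
  assumes "2 \<le> k"
  shows "(\<lambda>n. real (ex_rainbow n (cycle_graph (2 * k)) (cycle_graph (2 * k)))) \<in> \<Omega>(\<lambda>n. real n ^ (k - 1))"
proof (cases "k = 2")
  case True
  have "(n div 4) ^ 1 \<le> 4 ^ 4 * ex_rainbow n (cycle_graph 4) (cycle_graph 4)" for n
    using ex_C4_lower[of n] by simp
  then have "(\<lambda>n. real (ex_rainbow n (cycle_graph 4) (cycle_graph 4))) \<in> \<Omega>(\<lambda>n. real n ^ 1)"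
    by (rule bigomega_div[rotated]) simp
  then show ?thesis using True by simp
next
  case False
  then obtain w where w: "k = w + 3" using assms by (metis add.commute le_Suc_ex le_antisym not_less_eq_eq numeral_3_eq_3 numeral_2_eq_2)
  have eqs: "2 * k = 2 * w + 6" "k - 1 = w + 2" using w by simp_all
  show ?thesis
    unfolding eqs by (rule bigomega_div[OF _ ex_even_same_lower]) simp
qed

text \<open>Two vertices of \<open>thick_cycle\<close> with the same two hubs form a 4-cycle with
  them, so for \<open>k = 2\<close> the incidence graph takes over.\<close>

lemma ex_even_bigomega:
  assumes "2 \<le> k" "2 \<le> l" "k \<noteq> l"
  shows "(\<lambda>n. real (ex_rainbow n (cycle_graph (2 * l)) (cycle_graph (2 * k)))) \<in> \<Omega>(\<lambda>n. real n ^ l)"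
proof (cases "k = 2")
  case True
  have l: "3 \<le> l" using assms True by simp
  have "n ^ l \<le> 16 ^ l * (2 * l) ^ (2 * l) * ex_rainbow n (cycle_graph (2 * l)) (cycle_graph 4)"
    if "Suc (32 * (l + l\<^sup>2)\<^sup>2) \<le> n" for n
    using ex_even_C4_lower[OF l, of n] that by (simp add: mult.assoc)
  then show ?thesis unfolding True by (intro bigomega_nat) simp
next
  case False
  then have "3 \<le> k" using assms by simp
  then show ?thesis using assms by (intro bigomega_div[OF _ ex_even_lower]) auto
qed

theorem theorem1p2:
  fixes k l :: nat
  assumes "k \<ge> 2" and "l \<ge> 2"
  shows "(\<lambda>n. real (ex_rainbow n (cycle_graph (2 * k + 1)) (cycle_graph (2 * k + 1))))
           \<in> \<Theta>(\<lambda>n. real n ^ (2 * k - 1))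
       \<and> (\<lambda>n. real (ex_rainbow n (cycle_graph (2 * k)) (cycle_graph (2 * k))))
           \<in> \<Omega>(\<lambda>n. real n ^ (k - 1))
       \<and> (\<lambda>n. real (ex_rainbow n (cycle_graph (2 * k)) (cycle_graph (2 * k))))
           \<in> O(\<lambda>n. real n ^ k)
       \<and> (k \<noteq> l \<longrightarrow>
           (\<lambda>n. real (ex_rainbow n (cycle_graph (2 * l)) (cycle_graph (2 * k))))
             \<in> \<Theta>(\<lambda>n. real n ^ l))"
proof (intro conjI impI)
  have m: "odd (2 * k + 1)" "5 \<le> 2 * k + 1" "2 * k + 1 - 2 = 2 * k - 1" using assms by simp_all
  show "(\<lambda>n. real (ex_rainbow n (cycle_graph (2 * k + 1)) (cycle_graph (2 * k + 1))))
      \<in> \<Theta>(\<lambda>n. real n ^ (2 * k - 1))"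
  proof (rule bigthetaI)
    show "(\<lambda>n. real (ex_rainbow n (cycle_graph (2 * k + 1)) (cycle_graph (2 * k + 1))))
        \<in> O(\<lambda>n. real n ^ (2 * k - 1))"
      by (rule bigo_nat) (rule ex_same_cycle_upper[OF m(2), unfolded m(3)])
    show "(\<lambda>n. real (ex_rainbow n (cycle_graph (2 * k + 1)) (cycle_graph (2 * k + 1))))
        \<in> \<Omega>(\<lambda>n. real n ^ (2 * k - 1))"
      by (rule bigomega_div[OF _ ex_odd_lower[OF m(1,2), unfolded m(3)]]) simp
  qed
  show "(\<lambda>n. real (ex_rainbow n (cycle_graph (2 * k)) (cycle_graph (2 * k)))) \<in> \<Omega>(\<lambda>n. real n ^ (k - 1))"
    by (rule ex_even_same_bigomega[OF assms(1)])
  show "(\<lambda>n. real (ex_rainbow n (cycle_graph (2 * k)) (cycle_graph (2 * k)))) \<in> O(\<lambda>n. real n ^ k)"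
    by (rule bigo_nat[OF ex_even_upper[OF assms(1,1)]])
  assume "k \<noteq> l"
  show "(\<lambda>n. real (ex_rainbow n (cycle_graph (2 * l)) (cycle_graph (2 * k)))) \<in> \<Theta>(\<lambda>n. real n ^ l)"
    by (rule bigthetaI[OF bigo_nat[OF ex_even_upper[OF assms]] ex_even_bigomega[OF assms \<open>k \<noteq> l\<close>]])
qed

end
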